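(* For system (S) with $\lambda\in\Lambda_1$, the maximum number of local critical periods that can bifurcate from the bi-center at $(\pm1,0)$ is $3$, and there are exactly $3$ local critical periods bifurcating from the bi-center after a suitable perturbation.
   Context: System (S), with parameter $\lambda=(a_2,a_3,a_4,a_6,a_7,a_8,a_9,a_{10})\in\mathbb{R}^8$, is $$\dot x=-x^4y+a_2x^3y^2+a_3x^2y^3+a_4xy^4,$$ $$\dot y=-\tfrac14x-a_6y+\tfrac14x^5+a_6x^4y+a_7x^3y^2+a_8x^2y^3+a_9xy^4+a_{10}y^5.$$ It is invariant under $(x,y)\mapsto(-x,-y)$ and has singular points $(\pm1,0)$. A bi-center at $(\pm1,0)$ means that both points are centers. The set $$\Lambda_1=\left\{\lambda\in\mathbb{R}^8: a_6=0,\ a_8=\tfrac13a_2(1-2a_7),\ a_9=\tfrac12a_3(1-a_7),\ a_{10}=\tfrac15a_4(3-2a_7)\right\}$$ is a family of parameters for which (S) is known to have a bi-center at $(\pm1,0)$. Replacing $x$ by $x+1$ moves $(1,0)$ to the origin and gives a system $\dot x=-y+\cdots$, $\dot y=x+\cdots$. Let $P(h,\lambda)$ be the period of the orbit through $(h,0)$ for small $h>0$. For $\lambda_*\in\Lambda_1$, $k$ local critical periods bifurcate from the center (equivalently, by symmetry, the bi-center) if there is $\varepsilon_0>0$ such that for every $0<\varepsilon<\varepsilon_0$ and every sufficiently small neighborhood $W$ of $\lambda_*$ in $\Lambda_1$ there is $\lambda_1\in W$ such that $\partial_hP(h,\lambda_1)=0$ has $k$ solutions $h\in(0,\varepsilon)$.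 The maximum number is the maximum of such $k$ over all $\lambda_*\in\Lambda_1$; "exactly $3$ after a suitable perturbation" means that this number is attained at some $\lambda_*\in\Lambda_1$ by suitable nearby parameters in $\Lambda_1$. *)

theory Defs
  imports "HOL-Analysis.Analysis"
begin

text \<open>A parameter is a tuple \<open>(a2, a3, a4, a6, a7, a8, a9, a10)\<close>; the product topology on this
  type is the topology of the eight-dimensional real space.\<close>

type_synonym param = "real \<times> real \<times> real \<times> real \<times> real \<times> real \<times> real \<times> real"

fun system_S :: "param \<Rightarrow> real \<times> real \<Rightarrow> real \<times> real" where
  "system_S (a2, a3, a4, a6, a7, a8, a9, a10) (x, y) =
     (- (x^4 * y) + a2 * x^3 * y^2 + a3 * x^2 * y^3 + a4 * x * y^4,
      - (1/4) * x - a6 * y + (1/4) * x^5 + a6 * x^4 * y + a7 * x^3 * y^2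
        + a8 * x^2 * y^3 + a9 * x * y^4 + a10 * y^5)"

fun shifted_S :: "param \<Rightarrow> real \<times> real \<Rightarrow> real \<times> real" where
  "shifted_S p (x, y) = system_S p (x + 1, y)"

definition Lambda1 :: "param set" where
  "Lambda1 = {(a2, a3, a4, a6, a7, a8, a9, a10).
     a6 = 0 \<and> a8 = 1/3 * a2 * (1 - 2 * a7) \<and> a9 = 1/2 * a3 * (1 - a7)
     \<and> a10 = 1/5 * a4 * (3 - 2 * a7)}"

definition orbit_through ::
  "(real \<times> real \<Rightarrow> real \<times> real) \<Rightarrow> real \<times> real \<Rightarrow> (real \<Rightarrow> real \<times> real) \<Rightarrow> bool" where
  "orbit_through F z \<phi> \<longleftrightarrow>
     \<phi> 0 = z \<and> (\<forall>t. (\<phi> has_vector_derivative F (\<phi> t)) (at t))"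

text \<open>The period of a closed orbit is its least positive period, so equilibria have none.\<close>

definition orbit_has_period ::
  "(real \<times> real \<Rightarrow> real \<times> real) \<Rightarrow> real \<times> real \<Rightarrow> real \<Rightarrow> bool" where
  "orbit_has_period F z T \<longleftrightarrow>
     (\<exists>\<phi>. orbit_through F z \<phi> \<and> 0 < T \<and> (\<forall>t. \<phi> (t + T) = \<phi> t) \<and>
        (\<forall>T'. 0 < T' \<and> T' < T \<longrightarrow> \<not> (\<forall>t. \<phi> (t + T') = \<phi> t)))"

definition P :: "real \<Rightarrow> param \<Rightarrow> real" where
  "P h p = (THE T. orbit_has_period (shifted_S p) (h, 0) T)"

text \<open>\<^const>\<open>P\<close> is meaningful only where the orbit is closed, so this is required near \<open>h\<close> before
  speaking of the derivative of the period there.\<close>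

definition critical_at :: "param \<Rightarrow> real \<Rightarrow> bool" where
  "critical_at p h \<longleftrightarrow>
     (\<forall>\<^sub>F h' in nhds h. \<exists>T. orbit_has_period (shifted_S p) (h', 0) T) \<and>
     ((\<lambda>h'. P h' p) has_real_derivative 0) (at h)"

definition nbhd_in_Lambda1 :: "param \<Rightarrow> param set \<Rightarrow> bool" where
  "nbhd_in_Lambda1 p W \<longleftrightarrow> openin (top_of_set Lambda1) W \<and> p \<in> W"

text \<open>The number of solutions is exactly \<open>k\<close>: an isochronous parameter, for which every small \<open>h\<close>
  is a solution, contributes no \<open>k\<close>. By the symmetry proved at the end of this theory, the
  orbits around \<open>(-1, 0)\<close> have the same periods, so only \<open>(1, 0)\<close> is considered.\<close>

definition critical_periods_bifurcate :: "param \<Rightarrow> nat \<Rightarrow> bool" where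
  "critical_periods_bifurcate p k \<longleftrightarrow>
     (\<exists>\<epsilon>0>0. \<forall>\<epsilon>. 0 < \<epsilon> \<and> \<epsilon> < \<epsilon>0 \<longrightarrow>
        (\<exists>W0. nbhd_in_Lambda1 p W0 \<and>
          (\<forall>W. nbhd_in_Lambda1 p W \<and> W \<subseteq> W0 \<longrightarrow>
            (\<exists>p1\<in>W. finite {h \<in> {0<..<\<epsilon>}. critical_at p1 h} \<and>
                     card {h \<in> {0<..<\<epsilon>}. critical_at p1 h} = k))))"

lemma system_S_minus: "system_S p (- z) = - system_S p z"
proof -
  obtain a2 a3 a4 a6 a7 a8 a9 a10 where "p = (a2, a3, a4, a6, a7, a8, a9, a10)"
    by (metis surj_pair)
  then show ?thesis
    by (cases z) (simp add: algebra_simps)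
qed

lemma orbit_through_minus:
  assumes "orbit_through (system_S p) z \<phi>"
  shows "orbit_through (system_S p) (- z) (\<lambda>t. - \<phi> t)"
  using assms unfolding orbit_through_def system_S_minus
  by (auto intro: has_vector_derivative_minus)

lemma orbit_has_period_minus:
  "orbit_has_period (system_S p) (- z) T \<longleftrightarrow> orbit_has_period (system_S p) z T"
proof -
  have imp: "orbit_has_period (system_S p) (- w) T" if per: "orbit_has_period (system_S p) w T" for w
  proof -
    obtain \<phi> where "orbit_through (system_S p) w \<phi>" "0 < T" "\<forall>t. \<phi> (t + T) = \<phi> t"
      "\<forall>T'. 0 < T' \<and> T' < T \<longrightarrow> \<not> (\<forall>t. \<phi> (t + T') = \<phi> t)"
      using per unfolding orbit_has_period_def by auto
    then show ?thesis
      unfolding orbit_has_period_def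
      by (intro exI[of _ "\<lambda>t. - \<phi> t"]) (simp add: orbit_through_minus)
  qed
  from imp[of z] imp[of "- z"] show ?thesis by auto
qed

end

theory Submission
  imports Defs "HOL-Complex_Analysis.Complex_Analysis"
begin

text \<open>In the variables \<open>x = e\<^sup>-\<^sup>q\<^sup>/\<^sup>4\<close> and \<open>u = y / x\<close> the orbits around \<open>(1, 0)\<close> are the level curves
  \<open>q\<^sup>2 Y2(q) + 16 e\<^sup>-\<^sup>2\<^sup>n\<^sup>q u\<^sup>2 Y1(u) = \<rho>\<^sup>2\<close>, where \<open>Y1(u) = 1 - a u - b u\<^sup>2 - c u\<^sup>3\<close>, \<open>q\<^sup>2 Y2(q)\<close> is twice the
  integral of \<open>(e\<^sup>s - 1) e\<^sup>-\<^sup>2\<^sup>n\<^sup>s\<close> over \<open>[0, q]\<close>, and \<open>(a, b, c, n)\<close> are affine coordinates on \<open>\<Lambda>\<^sub>1\<close>.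
  Introducing the angle on these curves expresses the period as an integral \<open>T(\<rho>, a, b, c, n)\<close> over
  \<open>[0, 2\<pi>]\<close> which is even and holomorphic in \<open>\<rho>\<close>. Lagrange inversion for the inverses of
  \<open>u \<mapsto> u \<surd>Y1(u)\<close> and \<open>q \<mapsto> q \<surd>Y2(q)\<close> together with the Wallis integrals gives the Taylor coefficients
  \<open>2\<pi> \<tau>\<^sub>k\<close> of \<open>T\<close> at \<open>\<rho>\<^sup>2\<^sup>k\<close> for \<open>k \<le> 4\<close>. Modulo \<open>\<tau>\<^sub>1, \<dots>, \<tau>\<^sub>k\<^sub>-\<^sub>1\<close> the coefficient \<open>\<tau>\<^sub>k\<close> is a positive multiple of
  a polynomial in \<open>a, b, c\<close> minus a polynomial in \<open>n\<close>. Eliminating \<open>b\<close> and \<open>c\<close> by means of the first two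
  leaves two polynomials \<open>F3\<close> and \<open>F4\<close> in \<open>y = a\<^sup>2\<close> and \<open>n\<close>, which have no common zero with \<open>y \<ge> 0\<close>.

  Hence one of the derivatives of \<open>T\<close> of order \<open>2, 4, 6, 8\<close> does not vanish near \<open>\<rho> = 0\<close>, so that by
  Rolle's theorem the odd function \<open>\<partial>\<^sub>\<rho> T\<close> has at most \<open>7\<close> zeros there, at most three of them negative.
  Conversely \<open>F3(\<sqdot>, -1/2)\<close> changes sign at a point where \<open>F4 > 0\<close>; changing first \<open>y\<close>, then \<open>c\<close>, then \<open>b\<close>
  by ever smaller amounts makes \<open>\<tau>\<^sub>3 < 0\<close>, \<open>\<tau>\<^sub>2 > 0\<close> and \<open>\<tau>\<^sub>1 < 0\<close>, and each change creates a new zero.\<close>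

subsection \<open>A positivity test for polynomials in two variables\<close>

text \<open>The first integral comes from a linear equation: on \<open>Lambda1\<close> the function
  w = u^2 Y1(u) satisfies dw/dq = 2 n w - (e^q - 1)/8 along orbits, and e^(-2 n q) is its
  integrating factor. Setting q sqrt(Y2(q)) = \<rho> cos \<theta> and 4 e^(-n q) u sqrt(Y1(u)) =
  -\<rho> sin \<theta> then turns dt/d\<theta> into a product of values of q', U' and an
  exponential.

  The orbit through (h, 0) with h > 0 has q = -4 ln(1 + h) < 0 there, hence \<rho> < 0; this is why
  negative zeros are counted and why the signs of the Taylor coefficients appear reversed.

  The obstacle is uniformity in the parameter. The bound must hold for all parameters near a given
  one on a common interval of h, and each sign fixed in the construction must survive the later
  perturbations. Everything is therefore kept jointly continuous in \<rho> and the parameter, and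
  holomorphic in \<rho>; Cauchy's inequality passes the joint continuity on to every
  \<rho>-derivative.\<close>

text \<open>\<open>homog [c\<^sub>0, \<dots>, c\<^sub>L\<^sub>-\<^sub>1] num den\<close> is the pair of \<open>\<Sum> c\<^sub>i num\<^sup>i den\<^sup>L\<^sup>-\<^sup>1\<^sup>-\<^sup>i\<close> and \<open>den\<^sup>L\<close>, computed by Horner's
  scheme so that rewriting alone evaluates it.\<close>

fun homog :: "'a::comm_ring_1 list \<Rightarrow> 'a \<Rightarrow> 'a \<Rightarrow> 'a \<times> 'a" where
  "homog [] num den = (0, 1)"
| "homog (c # cs) num den = (case homog cs num den of (h, d) \<Rightarrow> (c * d + num * h, den * d))"

lemma snd_homog: "snd (homog cs num den) = den ^ length cs"
  by (induction cs) (auto split: prod.splits)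

lemma fst_homog_Cons:
  "fst (homog (c # cs) num den) = c * den ^ length cs + num * fst (homog cs num den)"
  using snd_homog[of cs num den] by (auto split: prod.splits)

lemma fst_homog_divide:
  fixes num den :: "'a::field"
  assumes "den \<noteq> 0" "cs \<noteq> []"
  shows "fst (homog cs num den) = den ^ (length cs - 1) * fst (homog cs (num / den) 1)"
  using assms(2)
proof (induction cs)
  case (Cons c cs)
  show ?case
  proof (cases "cs = []")
    case False
    then have "den ^ length cs = den * den ^ (length cs - 1)"
      by (cases cs) auto
    then show ?thesis
      using Cons.IH[OF False] assms(1) by (simp add: fst_homog_Cons algebra_simps del: homog.simps)
  qed simp
qed simp

lemma fst_homog_smult:
  "fst (homog (map (\<lambda>c. k * c) cs) num den) = k * fst (homog cs num den)"
  by (induction cs) (simp_all add: fst_homog_Cons algebra_simps del: homog.simps(2))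

lemma poly_fst_homog:
  "poly (fst (homog cs num den)) x = fst (homog (map (\<lambda>c. poly c x) cs) (poly num x) (poly den x))"
  by (induction cs) (simp_all add: fst_homog_Cons del: homog.simps(2))

definition eval_rows :: "real list list \<Rightarrow> real \<Rightarrow> real \<Rightarrow> real" where
  "eval_rows R y n = fst (homog (map (\<lambda>r. fst (homog r n 1)) R) y 1)"

text \<open>The numerator of \<open>eval_rows\<close> after n = N/D and y = Y/E, with the
  denominators cleared. The inner variable t of the result parametrizes an interval of n, the outer
  variable s the position of y relative to bounds that depend on t.\<close>

definition subst_rows ::
  "real list list \<Rightarrow> real poly \<Rightarrow> real poly \<Rightarrow> real poly poly \<Rightarrow> real poly poly \<Rightarrow> real poly poly" where
  "subst_rows R N D Y E =
     fst (homog (map (\<lambda>r. [:fst (homog (map (\<lambda>c. [:c:]) r) N D):]) R) Y E)"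

lemma poly_subst_rows:
  "poly (poly (subst_rows R N D Y E) [:s:]) t =
     fst (homog (map (\<lambda>r. fst (homog r (poly N t) (poly D t))) R)
       (poly (poly Y [:s:]) t) (poly (poly E [:s:]) t))"
  by (simp add: subst_rows_def poly_fst_homog o_def)

definition nonneg1 :: "real poly \<Rightarrow> bool" where
  "nonneg1 p \<longleftrightarrow> (\<forall>i. 0 \<le> coeff p i)"

definition nonneg2 :: "real poly poly \<Rightarrow> bool" where
  "nonneg2 p \<longleftrightarrow> (\<forall>i. nonneg1 (coeff p i))"

definition pos2 :: "real poly poly \<Rightarrow> bool" where
  "pos2 p \<longleftrightarrow> nonneg2 p \<and> 0 < coeff (coeff p 0) 0"

lemma nonneg1_simps: "nonneg1 0" "nonneg1 (pCons a p) \<longleftrightarrow> 0 \<le> a \<and> nonneg1 p"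
  by (auto simp: nonneg1_def coeff_pCons split: nat.splits)

lemma nonneg2_simps: "nonneg2 0" "nonneg2 (pCons a p) \<longleftrightarrow> nonneg1 a \<and> nonneg2 p"
  by (auto simp: nonneg2_def nonneg1_def coeff_pCons split: nat.splits)

lemma pos2_pCons: "pos2 (pCons (pCons a q) p) \<longleftrightarrow> 0 < a \<and> nonneg1 q \<and> nonneg2 p"
  by (auto simp: pos2_def nonneg1_simps nonneg2_simps)

lemma nonneg1_imp_poly_nonneg: "nonneg1 p \<Longrightarrow> 0 \<le> t \<Longrightarrow> 0 \<le> poly p t"
  by (induction p) (auto simp: nonneg1_simps)

lemma nonneg2_imp_poly_nonneg: "nonneg2 p \<Longrightarrow> 0 \<le> t \<Longrightarrow> 0 \<le> s \<Longrightarrow> 0 \<le> poly (poly p [:s:]) t"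
  by (induction p) (auto simp: nonneg2_simps intro: nonneg1_imp_poly_nonneg add_nonneg_nonneg)

lemma pos2_imp_poly_pos:
  assumes "pos2 p" "0 \<le> t" "0 \<le> s"
  shows "0 < poly (poly p [:s:]) t"
proof -
  obtain a q p' where p: "p = pCons (pCons a q) p'"
    by (metis pCons_cases)
  have "0 < a" "0 \<le> t * poly q t" "0 \<le> s * poly (poly p' [:s:]) t"
    using assms unfolding p pos2_pCons
    by (auto intro: mult_nonneg_nonneg[OF _ nonneg1_imp_poly_nonneg] mult_nonneg_nonneg[OF _ nonneg2_imp_poly_nonneg])
  then show ?thesis by (simp add: p)
qed

text \<open>Equal row lengths let one power of D be taken out of all rows; this power and that of E
  are positive, so \<open>eval_rows\<close> has the sign of the cleared polynomial, whose
  coefficients are inspected by \<open>pos2\<close>. This is why the coefficient tables are padded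
  with zeros.\<close>

lemma eval_rows_pos:
  assumes "pos2 (subst_rows R N D Y E)" "\<forall>r\<in>set R. length r = L" "R \<noteq> []" "L \<noteq> 0"
    and "0 \<le> t" "0 \<le> s" "0 < poly D t" "0 < poly (poly E [:s:]) t"
  shows "0 < eval_rows R (poly (poly Y [:s:]) t / poly (poly E [:s:]) t) (poly N t / poly D t)"
proof -
  let ?n = "poly N t / poly D t" and ?k = "poly D t ^ (L - 1)"
  have *: "map (\<lambda>r. fst (homog r (poly N t) (poly D t))) R =
    map (\<lambda>c. ?k * c) (map (\<lambda>r. fst (homog r ?n 1)) R)"
    unfolding map_map o_def
  proof (intro map_cong refl)
    fix r assume "r \<in> set R"
    then show "fst (homog r (poly N t) (poly D t)) = ?k * fst (homog r ?n 1)"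
      using assms(2,4,7) fst_homog_divide[of "poly D t" r "poly N t"] by fastforce
  qed
  have "0 < poly (poly (subst_rows R N D Y E) [:s:]) t"
    using assms by (intro pos2_imp_poly_pos)
  then have "0 < ?k * (poly (poly E [:s:]) t ^ (length R - 1) *
      eval_rows R (poly (poly Y [:s:]) t / poly (poly E [:s:]) t) ?n)"
    using assms(3,8) unfolding poly_subst_rows * fst_homog_smult eval_rows_def
    by (subst (asm) fst_homog_divide) auto
  then show ?thesis
    using assms(7,8) by (simp add: zero_less_mult_iff)
qed

text \<open>The Moebius substitution \<open>s = (y - \<alpha>) / (\<beta> - y)\<close> sends the strip \<open>\<alpha> \<le> y < \<beta>\<close> to the half line
  \<open>s \<ge> 0\<close>, where nonnegative coefficients suffice.\<close>

lemma eval_rows_pos_between: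
  assumes "pos2 (subst_rows R N D [:A, B:] [:E, E:])" "\<forall>r\<in>set R. length r = L" "R \<noteq> []" "L \<noteq> 0"
    and "0 \<le> t" "0 < poly D t" "0 < poly E t"
    and "poly A t / poly E t \<le> y" "y < poly B t / poly E t"
  shows "0 < eval_rows R y (poly N t / poly D t)"
proof -
  define s where "s = (y * poly E t - poly A t) / (poly B t - y * poly E t)"
  have d: "0 < poly B t - y * poly E t" "0 \<le> y * poly E t - poly A t"
    using assms(7-9) by (simp_all add: field_simps)
  then have s: "0 \<le> s" by (simp add: s_def)
  have "poly A t + s * poly B t = y * (poly E t * (1 + s))"
    using d by (simp add: s_def field_simps)
  then have "(poly A t + s * poly B t) / (poly E t + s * poly E t) = y"
    using assms(7) s by (simp add: divide_eq_eq algebra_simps add_pos_nonneg less_imp_neq[symmetric])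
  with eval_rows_pos[OF assms(1-5) s assms(6)] assms(7) s show ?thesis
    by (simp add: add_pos_nonneg)
qed

text \<open>On an unbounded range of y the translation s = y - A/E replaces the Moebius map, which
  gives y = (A + s E) / E.\<close>

lemma eval_rows_pos_above:
  assumes "pos2 (subst_rows R N D [:A, E:] [:E:])" "\<forall>r\<in>set R. length r = L" "R \<noteq> []" "L \<noteq> 0"
    and "0 \<le> t" "0 < poly D t" "0 < poly E t" "poly A t / poly E t \<le> y"
  shows "0 < eval_rows R y (poly N t / poly D t)"
proof -
  define s where "s = y - poly A t / poly E t"
  have s: "0 \<le> s" using assms(8) by (simp add: s_def)
  have "(poly A t + s * poly E t) / poly E t = y"
    using assms(7) by (simp add: s_def field_simps)
  with eval_rows_pos[OF assms(1-5) s assms(6)] assms(7) show ?thesis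
    by simp
qed

text \<open>Row \<open>i\<close> of \<open>rows3\<close> and \<open>rows4\<close> lists the coefficients, as a polynomial in \<open>n\<close>, of \<open>y\<^sup>i\<close> in the polynomials
  obtained by the elimination in \<open>F3_eq\<close> and \<open>F4_eq\<close> below.\<close>

definition rows3 :: "real list list" where
  "rows3 =
  [[4194304, 60817408, 415498240, 1657274368, 4165206016, 6629097472, 6647971840, 3892314112, 1073741824],
   [48513024, 506290176, 2424619008, 6586933248, 9698476032, 8100642816, 3104833536, 0, 0],
   [23466240, 341591040, 1402894080, 1366364160, 375459840, 0, 0, 0, 0],
   [83349000, 583443000, 333396000, 0, 0, 0, 0, 0, 0],
   [61618725, 0, 0, 0, 0, 0, 0, 0, 0]]"

definition rows4 :: "real list list" where
  "rows4 =
  [[-2399141888, -51581550592, -490774462464, -2750766120960, -9968884383744, -24261172396032, -39875537534976, -44012257935360, -31409565597696, -13204876951552, -2456721293312],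
   [-17616273408, -359703871488, -2816521961472, -12110924906496, -31360695828480, -48443699625984, -45064351383552, -23021047775232, -4509765992448, 0, 0],
   [-17850792960, -352449377280, -2569268782080, -8157812382720, -10277075128320, -5639190036480, -1142450749440, 0, 0, 0, 0],
   [-54992377440, -757283567040, -3071516928480, -3029134268160, -879878039040, 0, 0, 0, 0, 0, 0],
   [-50570219700, -353991537900, -202280878800, 0, 0, 0, 0, 0, 0, 0, 0],
   [-10343908575, 0, 0, 0, 0, 0, 0, 0, 0, 0, 0]]"

text \<open>The coefficients of F4 + 63 (3 y - 5) F3, as \<open>eval_rows34\<close> shows; a common
  zero of F3 and F4 is a zero of this combination. The number 63 is the quotient of the normalizing
  factors 257191200 and 4082400 of F4 and F3, and the term 3 y makes the coefficient of y^5
  positive.\<close>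

definition rows34 :: "real list list" where
  "rows34 =
  [[-3720347648, -70739034112, -621656408064, -3272807546880, -11280924278784, -26349338099712, -41969648664576, -45238336880640, -31747794272256, -13204876951552, -2456721293312],
   [-32105152512, -507690786816, -3501747781632, -13872584024064, -33628491841536, -49742502690816, -44785907269632, -22285400408064, -4306828787712, 0, 0],
   [-16073697024, -364361711616, -2552927424768, -7343286709248, -8562333007872, -4108168544256, -555637211136, 0, 0, 0, 0],
   [-76812193080, -876507405480, -2911389687360, -2770891441920, -808916129280, 0, 0, 0, 0, 0, 0],
   [-54227157075, -243720810900, -139269034800, 0, 0, 0, 0, 0, 0, 0, 0],
   [1302030450, 0, 0, 0, 0, 0, 0, 0, 0, 0, 0]]"

definition minus_rows3 :: "real list list" where
  "minus_rows3 =
  [[-4194304, -60817408, -415498240, -1657274368, -4165206016, -6629097472, -6647971840, -3892314112, -1073741824],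
   [-48513024, -506290176, -2424619008, -6586933248, -9698476032, -8100642816, -3104833536, 0, 0],
   [-23466240, -341591040, -1402894080, -1366364160, -375459840, 0, 0, 0, 0],
   [-83349000, -583443000, -333396000, 0, 0, 0, 0, 0, 0],
   [-61618725, 0, 0, 0, 0, 0, 0, 0, 0]]"


section \<open>Certificates for the signs of F3, F4 and their combination\<close>

definition F3 :: "real \<Rightarrow> real \<Rightarrow> real" where "F3 = eval_rows rows3"
definition F4 :: "real \<Rightarrow> real \<Rightarrow> real" where "F4 = eval_rows rows4"

lemma eval_minus_rows3: "eval_rows minus_rows3 y n = - F3 y n"
  by (simp add: F3_def eval_rows_def minus_rows3_def rows3_def algebra_simps)

lemma eval_rows34: "eval_rows rows34 y n = F4 y n + 63 * (3 * y - 5) * F3 y n"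
  by (simp add: F3_def F4_def eval_rows_def rows34_def rows3_def rows4_def algebra_simps)

lemmas subst_rows_simps = subst_rows_def rows3_def rows4_def rows34_def minus_rows3_def
  list.map homog.simps prod.case fst_conv
  mult_pCons_left smult_pCons add_pCons mult_zero_left mult_zero_right mult_1_left mult_1_right
  add_0_left add_0_right smult_0_right smult_0_left smult_1_left pCons_0_0 one_pCons
  arith_simps rel_simps pos2_pCons nonneg2_simps nonneg1_simps simp_thms

text \<open>The arguments give n = (-29 - 22 t)/(32 (1 + t)), which covers -29/32 \<le> n < -11/16,
  and bounds for y with denominator 1024 (1 + t)^2. As t/(1 + t) is affine in n, these bounds are
  quadratic polynomials in n. Below the first bound F4 is positive, between the two F3 is negative
  (\<open>pos2_1\<close>), above the second the combination is positive (\<open>pos2_2\<close>). The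
  next three triples have the same shape.\<close>

lemma pos2_0: "pos2 (subst_rows rows4 [:-29, -22:] [:32, 32:]
    [:[:0:], [:1202, 800, 194:]:] [:[:1024, 2048, 1024:], [:1024, 2048, 1024:]:])"
  by (simp only: subst_rows_simps)

lemma pos2_1: "pos2 (subst_rows minus_rows3 [:-29, -22:] [:32, 32:]
    [:[:1202, 800, 194:], [:1899, 4522, 2062:]:] [:[:1024, 2048, 1024:], [:1024, 2048, 1024:]:])"
  by (simp only: subst_rows_simps)

lemma pos2_2: "pos2 (subst_rows rows34 [:-29, -22:] [:32, 32:]
    [:[:1899, 4522, 2062:], [:1024, 2048, 1024:]:] [:[:1024, 2048, 1024:]:])"
  by (simp only: subst_rows_simps)

lemma pos2_3: "pos2 (subst_rows rows4 [:-22, -16:] [:32, 32:]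
    [:[:0:], [:196, 185, 90:]:] [:[:1024, 2048, 1024:], [:1024, 2048, 1024:]:])"
  by (simp only: subst_rows_simps)

lemma pos2_4: "pos2 (subst_rows minus_rows3 [:-22, -16:] [:32, 32:]
    [:[:196, 185, 90:], [:2067, 3847, 1615:]:] [:[:1024, 2048, 1024:], [:1024, 2048, 1024:]:])"
  by (simp only: subst_rows_simps)

lemma pos2_5: "pos2 (subst_rows rows34 [:-22, -16:] [:32, 32:]
    [:[:2067, 3847, 1615:], [:1024, 2048, 1024:]:] [:[:1024, 2048, 1024:]:])"
  by (simp only: subst_rows_simps)

lemma pos2_6: "pos2 (subst_rows rows4 [:-16, -12:] [:32, 32:]
    [:[:0:], [:89, 147, 95:]:] [:[:1024, 2048, 1024:], [:1024, 2048, 1024:]:])"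
  by (simp only: subst_rows_simps)

lemma pos2_7: "pos2 (subst_rows minus_rows3 [:-16, -12:] [:32, 32:]
    [:[:89, 147, 95:], [:1616, 2831, 1145:]:] [:[:1024, 2048, 1024:], [:1024, 2048, 1024:]:])"
  by (simp only: subst_rows_simps)

lemma pos2_8: "pos2 (subst_rows rows34 [:-16, -12:] [:32, 32:]
    [:[:1616, 2831, 1145:], [:1024, 2048, 1024:]:] [:[:1024, 2048, 1024:]:])"
  by (simp only: subst_rows_simps)

lemma pos2_9: "pos2 (subst_rows rows4 [:-24, -19:] [:64, 64:]
    [:[:0:], [:99, 208, 287:]:] [:[:1024, 2048, 1024:], [:1024, 2048, 1024:]:])"
  by (simp only: subst_rows_simps)

lemma pos2_10: "pos2 (subst_rows minus_rows3 [:-24, -19:] [:64, 64:]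
    [:[:99, 208, 287:], [:1143, 1969, 727:]:] [:[:1024, 2048, 1024:], [:1024, 2048, 1024:]:])"
  by (simp only: subst_rows_simps)

lemma pos2_11: "pos2 (subst_rows rows34 [:-24, -19:] [:64, 64:]
    [:[:1143, 1969, 727:], [:1024, 2048, 1024:]:] [:[:1024, 2048, 1024:]:])"
  by (simp only: subst_rows_simps)

text \<open>For -31/32 \<le> n < -29/32 the combination is positive for every y \<ge> 0; cutting at
  y = 11/8 yields two substitutions whose coefficients are all nonnegative.\<close>

lemma pos2_12: "pos2 (subst_rows rows34 [:-31, -29:] [:32, 32:]
    [:[:0:], [:11:]:] [:[:8:], [:8:]:])"
  by (simp only: subst_rows_simps)

lemma pos2_13: "pos2 (subst_rows rows34 [:-31, -29:] [:32, 32:]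
    [:[:11:], [:8:]:] [:[:8:]:])"
  by (simp only: subst_rows_simps)

lemma pos2_14: "pos2 (subst_rows rows34 [:-19, -18:] [:64, 64:]
    [:[:0:], [:1:]:] [:[:8:], [:8:]:])"
  by (simp only: subst_rows_simps)

lemma pos2_15: "pos2 (subst_rows rows34 [:-19, -18:] [:64, 64:]
    [:[:1:], [:5:]:] [:[:8:], [:8:]:])"
  by (simp only: subst_rows_simps)

lemma pos2_16: "pos2 (subst_rows rows34 [:-19, -18:] [:64, 64:]
    [:[:5:], [:8:]:] [:[:8:]:])"
  by (simp only: subst_rows_simps)

lemma pos2_17: "pos2 (subst_rows rows34 [:-18, -17:] [:64, 64:]
    [:[:0:], [:3:]:] [:[:8:], [:8:]:])"
  by (simp only: subst_rows_simps)

lemma pos2_18: "pos2 (subst_rows rows34 [:-18, -17:] [:64, 64:]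
    [:[:3:], [:8:]:] [:[:8:]:])"
  by (simp only: subst_rows_simps)

lemma pos2_19: "pos2 (subst_rows rows3 [:-17, 0:] [:64, 64:]
    [:[:0:], [:1:]:] [:[:4:], [:4:]:])"
  by (simp only: subst_rows_simps)

lemma pos2_20: "pos2 (subst_rows rows3 [:-17, 0:] [:64, 64:]
    [:[:1:], [:2:]:] [:[:4:], [:4:]:])"
  by (simp only: subst_rows_simps)

lemma pos2_21: "pos2 (subst_rows rows3 [:-17, 0:] [:64, 64:]
    [:[:2:], [:4:]:] [:[:4:]:])"
  by (simp only: subst_rows_simps)

lemma pos2_22: "pos2 (subst_rows rows3 [:-31, -32:] [:32:]
    [:[:0:], [:3:]:] [:[:2:], [:2:]:])"
  by (simp only: subst_rows_simps)

lemma pos2_23: "pos2 (subst_rows rows3 [:-31, -32:] [:32:]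
    [:[:3:], [:2:]:] [:[:2:]:])"
  by (simp only: subst_rows_simps)

subsection \<open>The Taylor coefficients of the period function\<close>

text \<open>\<open>U_coeff j a b c\<close> is the coefficient of \<open>r\<^sup>2\<^sup>j\<close> in \<open>U'(r)\<close>, and \<open>J_coeff j i n\<close> that of \<open>x\<^sup>2\<^sup>i\<close> in
  \<open>q'(x) e\<^sup>(\<^sup>1\<^sup>-\<^sup>n\<^sup>+\<^sup>2\<^sup>j\<^sup>n\<^sup>)\<^sup>q\<^sup>(\<^sup>x\<^sup>)\<close>, where \<open>U\<close> and \<open>q\<close> are the inverses of \<open>u \<mapsto> u \<surd>Y1(u)\<close> and \<open>q \<mapsto> q \<surd>Y2(q)\<close>;
  the formulas hold for \<open>j \<le> 4\<close> and \<open>i + j \<le> 4\<close>. All \<open>tau k\<close> with \<open>1 \<le> k \<le> j\<close> vanish iff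
  \<open>U_coeff\<close> and \<open>iso_coeff\<close> agree up to index \<open>j\<close>.\<close>

definition U_coeff :: "nat \<Rightarrow> real \<Rightarrow> real \<Rightarrow> real \<Rightarrow> real" where
  "U_coeff j a b c = (if j = 0 then 1
    else if j = 1 then 15/8 * a^2 + 3/2 * b
    else if j = 2 then 1155/128 * a^4 + 315/16 * a^2 * b + 35/4 * a * c + 35/8 * b^2
    else if j = 3 then 51051/1024 * a^6 + 45045/256 * a^4 * b + 3003/32 * a^3 * c + 9009/64 * a^2 * b^2 + 693/8 * a * b * c + 231/16 * b^3 + 63/8 * c^2
    else 9561123/32768 * a^8 + 2909907/2048 * a^6 * b + 415701/512 * a^5 * c + 2078505/1024 * a^4 * b^2 + 109395/64 * a^3 * b * c + 109395/128 * a^2 * b^3 + 19305/64 * a^2 * c^2 + 19305/32 * a * b^2 * c + 6435/128 * b^4 + 1287/16 * b * c^2)"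

definition iso_coeff :: "nat \<Rightarrow> real \<Rightarrow> real" where
  "iso_coeff j n = (if j = 0 then 1
    else if j = 1 then - 16/3 * n^2 - 28/3 * n - 4/3
    else if j = 2 then 128/27 * n^4 + 2752/27 * n^3 + 1112/9 * n^2 + 688/27 * n + 8/27
    else if j = 3 then 284672/6075 * n^6 - 411136/2025 * n^5 - 3492992/2025 * n^4 - 10763104/6075 * n^3 - 873248/2025 * n^2 - 25696/2025 * n + 4448/6075
    else - 4677632/127575 * n^8 - 205856768/127575 * n^7 + 677542912/127575 * n^6 + 3600623104/127575 * n^5 + 670771232/25515 * n^4 + 900155776/127575 * n^3 + 42346432/127575 * n^2 - 3216512/127575 * n - 18272/127575)"

definition J_coeff :: "nat \<Rightarrow> nat \<Rightarrow> real \<Rightarrow> real" where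
  "J_coeff j i n = (if i = 0 then 1
    else if (j, i) = (0, 1) then 1/3 * n^2 + 7/12 * n + 1/12
    else if (j, i) = (0, 2) then 25/54 * n^4 + 67/108 * n^3 - 13/288 * n^2 - 17/432 * n + 1/864
    else if (j, i) = (0, 3) then 9041/12150 * n^6 + 11123/16200 * n^5 - 26051/64800 * n^4 - 44893/777600 * n^3 + 7609/259200 * n^2 - 37/259200 * n - 139/777600
    else if (j, i) = (0, 4) then 1298597/1020600 * n^8 + 127663/204120 * n^7 - 1312223/1166400 * n^6 + 2339903/16329600 * n^5 + 27787157/261273600 * n^4 - 1406329/65318400 * n^3 - 158633/130636800 * n^2 + 19907/65318400 * n - 571/261273600
    else if (j, i) = (1, 1) then 13/3 * n^2 + 19/12 * n + 1/12
    else if (j, i) = (1, 2) then 649/54 * n^4 + 367/108 * n^3 - 101/288 * n^2 - 29/432 * n + 1/864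
    else if (j, i) = (1, 3) then 359501/12150 * n^6 + 26423/16200 * n^5 - 212711/64800 * n^4 - 6553/777600 * n^3 + 18769/259200 * n^2 - 217/259200 * n - 139/777600
    else if (j, i) = (2, 1) then 37/3 * n^2 + 31/12 * n + 1/12
    else if (j, i) = (2, 2) then 3313/54 * n^4 + 1039/108 * n^3 - 253/288 * n^2 - 41/432 * n + 1/864
    else if (j, i) = (3, 1) then 73/3 * n^2 + 43/12 * n + 1/12
    else 0)"

text \<open>The mean value of \<open>sin \<theta> ^ (2 * j) * cos \<theta> ^ (2 * i)\<close> over a
  full turn, see \<open>trig_integral_even\<close>.\<close>

definition wallis :: "nat \<Rightarrow> nat \<Rightarrow> real" where
  "wallis j i = fact (2 * j) * fact (2 * i) / (4 ^ (j + i) * fact j * fact i * fact (j + i))"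

text \<open>U' is evaluated at r = -(\<rho>/4) sin \<theta> e^(n q), so its term of degree 2 j
  contributes 16^(-j) and a factor e^(2 j n q); the latter is already part of
  \<open>J_coeff j\<close>.\<close>

definition tau :: "nat \<Rightarrow> real \<Rightarrow> real \<Rightarrow> real \<Rightarrow> real \<Rightarrow> real" where
  "tau k a b c n = (\<Sum>j\<le>k. U_coeff j a b c / 16 ^ j * J_coeff j (k - j) n * wallis j (k - j))"

section \<open>Common zeros of F3 and F4\<close>

lemma Moebius_parameter:
  fixes n :: real
  assumes "n0 \<le> n" "n < n1"
  obtains t where "0 \<le> t" "n = (n0 + t * n1) / (1 + t)"
proof
  show "0 \<le> (n - n0) / (n1 - n)" using assms by simp
  show "n = (n0 + (n - n0) / (n1 - n) * n1) / (1 + (n - n0) / (n1 - n))"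
    using assms by (simp add: divide_simps) (simp add: algebra_simps)
qed

lemma F3_F4_three_strips:
  assumes "pos2 (subst_rows rows4 N D [:[:0:], A:] [:E, E:])"
    and "pos2 (subst_rows minus_rows3 N D [:A, B:] [:E, E:])"
    and "pos2 (subst_rows rows34 N D [:B, E:] [:E:])"
    and "0 \<le> t" "0 < poly D t" "0 < poly E t" "0 \<le> y"
  shows "F3 y (poly N t / poly D t) \<noteq> 0 \<or> F4 y (poly N t / poly D t) \<noteq> 0"
proof -
  let ?n = "poly N t / poly D t"
  consider "y < poly A t / poly E t" | "poly A t / poly E t \<le> y" "y < poly B t / poly E t"
    | "poly B t / poly E t \<le> y" by linarith
  then show ?thesis
  proof cases
    case 1
    then have "0 < F4 y ?n"
      unfolding F4_def using assms
      by (intro eval_rows_pos_between[where L = 11, OF assms(1)]) (auto simp: rows4_def)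
    then show ?thesis by simp
  next
    case 2
    then have "0 < eval_rows minus_rows3 y ?n"
      using assms
      by (intro eval_rows_pos_between[where L = 9, OF assms(2)]) (auto simp: minus_rows3_def)
    then show ?thesis by (simp add: eval_minus_rows3)
  next
    case 3
    then have "0 < eval_rows rows34 y ?n"
      using assms
      by (intro eval_rows_pos_above[where L = 11, OF assms(3)]) (auto simp: rows34_def)
    then show ?thesis by (auto simp: eval_rows34)
  qed
qed

text \<open>For n \<le> -31/32 and for n \<ge> -17/64 the polynomial F3 is positive; on [-31/32,
  -29/32) and [-19/64, -17/64) the combination is. On the four intervals between them F3 is negative
  for moderate y, and three strips in y are used.\<close>

lemma F3_F4_no_common_zero:
  assumes "0 \<le> y"
  shows "F3 y n \<noteq> 0 \<or> F4 y n \<noteq> 0"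
proof -
  consider (inf) "n \<le> - 31/32"
    | (c0) "-31/32 \<le> n" "n < -29/32"
    | (c1) "-29/32 \<le> n" "n < -11/16"
    | (c2) "-11/16 \<le> n" "n < -1/2"
    | (c3) "-1/2 \<le> n" "n < -3/8"
    | (c4) "-3/8 \<le> n" "n < -19/64"
    | (c5) "-19/64 \<le> n" "n < -9/32"
    | (c6) "-9/32 \<le> n" "n < -17/64"
    | (c7) "-17/64 \<le> n" "n < 0/1"
    | (nonneg) "0 \<le> n" by linarith
  then show ?thesis
  proof cases
    case inf
    \<comment> \<open>An unbounded interval of n is parametrized by a translation, so the
      denominator is constant.\<close>
    define t where "t = - 31/32 - n"
    have t: "0 \<le> t" "n = poly [:-31, -32:] t / poly [:32:] t"
      using inf by (simp_all add: t_def field_simps)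
    consider "y < 3/2" | "3/2 \<le> y" by linarith
    then have "0 < eval_rows rows3 y n"
    proof cases
      case 1
      then show ?thesis
        unfolding t(2) using assms t(1)
        by (intro eval_rows_pos_between[OF pos2_22, where L = 9]) (simp_all add: rows3_def)
    next
      case 2
      then show ?thesis
        unfolding t(2) using assms t(1)
        by (intro eval_rows_pos_above[OF pos2_23, where L = 9]) (simp_all add: rows3_def)
    qed
    then show ?thesis by (auto simp: F3_def)
  next
    case c0
    then obtain t where t0: "0 \<le> t" "n = (-31/32 + t * (-29/32)) / (1 + t)"
      by (rule Moebius_parameter)
    then have t: "0 \<le> t" "n = poly [:-31, -29:] t / poly [:32, 32:] t"
      by (simp_all add: divide_simps add_nonneg_eq_0_iff) (simp_all add: algebra_simps)?
    consider "y < 11/8" | "11/8 \<le> y" by linarith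
    then have "0 < eval_rows rows34 y n"
    proof cases
      case 1
      then show ?thesis
        unfolding t(2) using assms t(1)
        by (intro eval_rows_pos_between[OF pos2_12, where L = 11]) (simp_all add: rows34_def)
    next
      case 2
      then show ?thesis
        unfolding t(2) using assms t(1)
        by (intro eval_rows_pos_above[OF pos2_13, where L = 11]) (simp_all add: rows34_def)
    qed
    then show ?thesis by (auto simp: eval_rows34)
  next
    case c1
    then obtain t where t0: "0 \<le> t" "n = (-29/32 + t * (-11/16)) / (1 + t)"
      by (rule Moebius_parameter)
    then have t: "0 \<le> t" "n = poly [:-29, -22:] t / poly [:32, 32:] t"
      by (simp_all add: divide_simps add_nonneg_eq_0_iff) (simp_all add: algebra_simps)?
    show ?thesis
      unfolding t(2) using assms t(1)
      by (intro F3_F4_three_strips[OF pos2_0 pos2_1 pos2_2]) (simp_all add: add_pos_nonneg)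
  next
    case c2
    then obtain t where t0: "0 \<le> t" "n = (-11/16 + t * (-1/2)) / (1 + t)"
      by (rule Moebius_parameter)
    then have t: "0 \<le> t" "n = poly [:-22, -16:] t / poly [:32, 32:] t"
      by (simp_all add: divide_simps add_nonneg_eq_0_iff) (simp_all add: algebra_simps)?
    show ?thesis
      unfolding t(2) using assms t(1)
      by (intro F3_F4_three_strips[OF pos2_3 pos2_4 pos2_5]) (simp_all add: add_pos_nonneg)
  next
    case c3
    then obtain t where t0: "0 \<le> t" "n = (-1/2 + t * (-3/8)) / (1 + t)"
      by (rule Moebius_parameter)
    then have t: "0 \<le> t" "n = poly [:-16, -12:] t / poly [:32, 32:] t"
      by (simp_all add: divide_simps add_nonneg_eq_0_iff) (simp_all add: algebra_simps)?
    show ?thesis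
      unfolding t(2) using assms t(1)
      by (intro F3_F4_three_strips[OF pos2_6 pos2_7 pos2_8]) (simp_all add: add_pos_nonneg)
  next
    case c4
    then obtain t where t0: "0 \<le> t" "n = (-3/8 + t * (-19/64)) / (1 + t)"
      by (rule Moebius_parameter)
    then have t: "0 \<le> t" "n = poly [:-24, -19:] t / poly [:64, 64:] t"
      by (simp_all add: divide_simps add_nonneg_eq_0_iff) (simp_all add: algebra_simps)?
    show ?thesis
      unfolding t(2) using assms t(1)
      by (intro F3_F4_three_strips[OF pos2_9 pos2_10 pos2_11]) (simp_all add: add_pos_nonneg)
  next
    case c5
    then obtain t where t0: "0 \<le> t" "n = (-19/64 + t * (-9/32)) / (1 + t)"
      by (rule Moebius_parameter)
    then have t: "0 \<le> t" "n = poly [:-19, -18:] t / poly [:64, 64:] t"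
      by (simp_all add: divide_simps add_nonneg_eq_0_iff) (simp_all add: algebra_simps)?
    consider "y < 1/8" | "1/8 \<le> y" "y < 5/8" | "5/8 \<le> y" by linarith
    then have "0 < eval_rows rows34 y n"
    proof cases
      case 1
      then show ?thesis
        unfolding t(2) using assms t(1)
        by (intro eval_rows_pos_between[OF pos2_14, where L = 11]) (simp_all add: rows34_def)
    next
      case 2
      then show ?thesis
        unfolding t(2) using assms t(1)
        by (intro eval_rows_pos_between[OF pos2_15, where L = 11]) (simp_all add: rows34_def)
    next
      case 3
      then show ?thesis
        unfolding t(2) using assms t(1)
        by (intro eval_rows_pos_above[OF pos2_16, where L = 11]) (simp_all add: rows34_def)
    qed
    then show ?thesis by (auto simp: eval_rows34)
  next
    case c6
    then obtain t where t0: "0 \<le> t" "n = (-9/32 + t * (-17/64)) / (1 + t)"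
      by (rule Moebius_parameter)
    then have t: "0 \<le> t" "n = poly [:-18, -17:] t / poly [:64, 64:] t"
      by (simp_all add: divide_simps add_nonneg_eq_0_iff) (simp_all add: algebra_simps)?
    consider "y < 3/8" | "3/8 \<le> y" by linarith
    then have "0 < eval_rows rows34 y n"
    proof cases
      case 1
      then show ?thesis
        unfolding t(2) using assms t(1)
        by (intro eval_rows_pos_between[OF pos2_17, where L = 11]) (simp_all add: rows34_def)
    next
      case 2
      then show ?thesis
        unfolding t(2) using assms t(1)
        by (intro eval_rows_pos_above[OF pos2_18, where L = 11]) (simp_all add: rows34_def)
    qed
    then show ?thesis by (auto simp: eval_rows34)
  next
    case c7
    then obtain t where t0: "0 \<le> t" "n = (-17/64 + t * (0/1)) / (1 + t)"
      by (rule Moebius_parameter)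
    then have t: "0 \<le> t" "n = poly [:-17, 0:] t / poly [:64, 64:] t"
      by (simp_all add: divide_simps add_nonneg_eq_0_iff) (simp_all add: algebra_simps)?
    consider "y < 1/4" | "1/4 \<le> y" "y < 1/2" | "1/2 \<le> y" by linarith
    then have "0 < eval_rows rows3 y n"
    proof cases
      case 1
      then show ?thesis
        unfolding t(2) using assms t(1)
        by (intro eval_rows_pos_between[OF pos2_19, where L = 9]) (simp_all add: rows3_def)
    next
      case 2
      then show ?thesis
        unfolding t(2) using assms t(1)
        by (intro eval_rows_pos_between[OF pos2_20, where L = 9]) (simp_all add: rows3_def)
    next
      case 3
      then show ?thesis
        unfolding t(2) using assms t(1)
        by (intro eval_rows_pos_above[OF pos2_21, where L = 9]) (simp_all add: rows3_def)
    qed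
    then show ?thesis by (auto simp: F3_def)
  next
    case nonneg
    then have "0 < F3 y n"
      using assms unfolding F3_def eval_rows_def rows3_def
      by (simp add: fst_homog_Cons add_pos_nonneg)
    then show ?thesis by simp
  qed
qed

text \<open>In terms of \<open>y = a\<^sup>2\<close>, \<open>w = a c\<close> and \<open>n\<close>, the multiples \<open>a\<^sup>2 U\<^sub>3\<close> and \<open>a\<^sup>2 U\<^sub>4\<close> of the third and
  fourth coefficients are polynomials; the first two conditions determine \<open>b\<close> and \<open>w\<close>.\<close>

lemma
  assumes b: "b = (iso_coeff 1 n - 15/8 * y) * (2/3)"
    and w: "w = (iso_coeff 2 n - 1155/128 * y^2 - 315/16 * y * b - 35/8 * b^2) * (4/35)"
  shows F3_eq: "F3 y n = 4082400 * (51051/1024 * y^4 + 45045/256 * y^3 * b + 3003/32 * y^2 * w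
    + 9009/64 * y^2 * b^2 + 693/8 * y * b * w + 231/16 * y * b^3 + 63/8 * w^2 - y * iso_coeff 3 n)"
    and F4_eq: "F4 y n = 257191200 * (9561123/32768 * y^5 + 2909907/2048 * y^4 * b
    + 415701/512 * y^3 * w + 2078505/1024 * y^3 * b^2 + 109395/64 * y^2 * b * w
    + 109395/128 * y^2 * b^3 + 19305/64 * y * w^2 + 19305/32 * y * b^2 * w
    + 6435/128 * y * b^4 + 1287/16 * b * w^2 - y * iso_coeff 4 n)"
  unfolding w b F3_def F4_def eval_rows_def rows3_def rows4_def iso_coeff_def
  by (simp_all add: fst_homog_Cons) algebra+

lemma F3_U_coeff:
  assumes "U_coeff 1 a b c = iso_coeff 1 n" "U_coeff 2 a b c = iso_coeff 2 n"
  shows "F3 (a^2) n = 4082400 * a^2 * (U_coeff 3 a b c - iso_coeff 3 n)"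
    and "F4 (a^2) n = 257191200 * a^2 * (U_coeff 4 a b c - iso_coeff 4 n)"
proof -
  have "b = (iso_coeff 1 n - 15/8 * a^2) * (2/3)"
    using assms(1) by (simp add: U_coeff_def)
  moreover have "a * c = (iso_coeff 2 n - 1155/128 * (a^2)^2 - 315/16 * a^2 * b - 35/8 * b^2) * (4/35)"
    using assms(2) by (simp add: U_coeff_def algebra_simps)
  ultimately show "F3 (a^2) n = 4082400 * a^2 * (U_coeff 3 a b c - iso_coeff 3 n)"
    "F4 (a^2) n = 257191200 * a^2 * (U_coeff 4 a b c - iso_coeff 4 n)"
    by (subst F3_eq F4_eq; simp add: U_coeff_def; algebra)+
qed

text \<open>F3 and F4 carry the factor a^2 and say nothing at a = 0. There c drops out of the second
  equation, and the first two force (8 n^2 + 29/4 n + 2)^2 + 135/16 n^2 = 0, a sum of squares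
  without real zero.\<close>

lemma U_coeff_neq_iso:
  assumes "U_coeff 1 a b c = iso_coeff 1 n" "U_coeff 2 a b c = iso_coeff 2 n" "U_coeff 3 a b c = iso_coeff 3 n"
  shows "U_coeff 4 a b c \<noteq> iso_coeff 4 n"
proof (cases "a = 0")
  case False
  then show ?thesis
    using F3_F4_no_common_zero[of "a^2" n] F3_U_coeff[OF assms(1,2)] assms(3) by auto
next
  case True
  then have "b = 2/3 * iso_coeff 1 n" "35/8 * b^2 = iso_coeff 2 n"
    using assms(1,2) by (simp_all add: U_coeff_def)
  then have "35/8 * (2/3 * iso_coeff 1 n)^2 = iso_coeff 2 n"
    by metis
  then have "(8 * n^2 + 29/4 * n + 2)^2 + 135/16 * n^2 = 0"
    by (simp add: iso_coeff_def) algebra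
  then have "n = 0" "8 * n^2 + 29/4 * n + 2 = 0"
    using zero_le_power2[of "8 * n^2 + 29/4 * n + 2"] zero_le_power2[of n]
    by (auto simp: add_nonneg_eq_0_iff)
  then show ?thesis by simp
qed

lemma wallis_simps:
  "wallis 0 0 = 1" "wallis 0 1 = 1/2" "wallis 1 0 = 1/2"
  "wallis 0 2 = 3/8" "wallis 1 1 = 1/8" "wallis 2 0 = 3/8"
  "wallis 0 3 = 5/16" "wallis 1 2 = 1/16" "wallis 2 1 = 1/16" "wallis 3 0 = 5/16"
  "wallis 0 4 = 35/128" "wallis 1 3 = 5/128" "wallis 2 2 = 3/128" "wallis 3 1 = 5/128" "wallis 4 0 = 35/128"
  by (simp_all add: wallis_def fact_numeral)

text \<open>As \<open>J_coeff k 0 n\<close> is 1, \<open>tau k\<close> is affine in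
  \<open>U_coeff k\<close> with slope \<open>wallis k 0 / 16 ^ k\<close>; \<open>iso_coeff k\<close>
  is the value of \<open>U_coeff k\<close> at which it vanishes once the lower coefficients equal
  their own \<open>iso_coeff\<close>.\<close>

lemma tau_eqs:
  shows tau_1: "tau 1 a b c n = (U_coeff 1 a b c - iso_coeff 1 n) / 32"
    and tau_2: "U_coeff 1 a b c = iso_coeff 1 n \<Longrightarrow>
      tau 2 a b c n = 3/2048 * (U_coeff 2 a b c - iso_coeff 2 n)"
    and tau_3: "U_coeff 1 a b c = iso_coeff 1 n \<Longrightarrow> U_coeff 2 a b c = iso_coeff 2 n \<Longrightarrow>
      tau 3 a b c n = 5/65536 * (U_coeff 3 a b c - iso_coeff 3 n)"
    and tau_4: "U_coeff 1 a b c = iso_coeff 1 n \<Longrightarrow> U_coeff 2 a b c = iso_coeff 2 n \<Longrightarrow>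
      U_coeff 3 a b c = iso_coeff 3 n \<Longrightarrow>
      tau 4 a b c n = 35/8388608 * (U_coeff 4 a b c - iso_coeff 4 n)"
proof -
  have atMost_sets: "{..1::nat} = {0, 1}" "{..2::nat} = {0, 1, 2}" "{..3::nat} = {0, 1, 2, 3}"
    "{..4::nat} = {0, 1, 2, 3, 4}"
    by auto
  have U0: "U_coeff 0 a b c = 1" by (simp add: U_coeff_def)
  have tau1: "tau 1 a b c n = J_coeff 0 1 n / 2 + U_coeff 1 a b c / 32 * J_coeff 1 0 n"
    by (simp add: tau_def atMost_sets wallis_simps U0 flip: One_nat_def)
  have tau2: "tau 2 a b c n = 3/8 * J_coeff 0 2 n + U_coeff 1 a b c / 128 * J_coeff 1 1 n
      + 3/2048 * U_coeff 2 a b c * J_coeff 2 0 n"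
    by (simp add: tau_def atMost_sets wallis_simps U0 flip: One_nat_def)
  have tau3: "tau 3 a b c n = 5/16 * J_coeff 0 3 n + U_coeff 1 a b c / 256 * J_coeff 1 2 n
      + U_coeff 2 a b c / 4096 * J_coeff 2 1 n + 5/65536 * U_coeff 3 a b c * J_coeff 3 0 n"
    by (simp add: tau_def atMost_sets wallis_simps U0 flip: One_nat_def)
  have tau4: "tau 4 a b c n = 35/128 * J_coeff 0 4 n + 5/2048 * U_coeff 1 a b c * J_coeff 1 3 n
      + 3/32768 * U_coeff 2 a b c * J_coeff 2 2 n + 5/524288 * U_coeff 3 a b c * J_coeff 3 1 n
      + 35/8388608 * U_coeff 4 a b c * J_coeff 4 0 n"
    by (simp add: tau_def atMost_sets wallis_simps U0 flip: One_nat_def)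
  show "tau 1 a b c n = (U_coeff 1 a b c - iso_coeff 1 n) / 32"
    unfolding tau1 by (simp add: J_coeff_def iso_coeff_def)
  show "tau 2 a b c n = 3/2048 * (U_coeff 2 a b c - iso_coeff 2 n)"
    if "U_coeff 1 a b c = iso_coeff 1 n"
    unfolding tau2 that J_coeff_def iso_coeff_def by simp algebra
  show "tau 3 a b c n = 5/65536 * (U_coeff 3 a b c - iso_coeff 3 n)"
    if "U_coeff 1 a b c = iso_coeff 1 n" "U_coeff 2 a b c = iso_coeff 2 n"
    unfolding tau3 that J_coeff_def iso_coeff_def by simp algebra
  show "tau 4 a b c n = 35/8388608 * (U_coeff 4 a b c - iso_coeff 4 n)"
    if "U_coeff 1 a b c = iso_coeff 1 n" "U_coeff 2 a b c = iso_coeff 2 n"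
      "U_coeff 3 a b c = iso_coeff 3 n"
    unfolding tau4 that J_coeff_def iso_coeff_def by simp algebra
qed

unbundle no vec_syntax
unbundle fps_syntax

subsection \<open>Lagrange inversion\<close>

lemma fps_X_times_deriv_nth: "(fps_X * fps_deriv f) $ k = of_nat k * f $ k"
  for f :: "'a::comm_ring_1 fps"
  by (cases k) (simp_all add: fps_X_mult_nth)

text \<open>The coefficient functional \<open>f \<mapsto> (f * inverse S ^ Suc k) $ k\<close> is the residue of \<open>f / F ^ Suc k\<close>, and
  \<open>F ^ i * F' / F ^ Suc k\<close> is an exact derivative unless \<open>i = k\<close>.\<close>

lemma fps_residue_power:
  fixes S :: "'a::field_char_0 fps"
  assumes S0: "S $ 0 \<noteq> 0" and "i \<le> k"
  shows "((fps_X * S) ^ i * fps_deriv (fps_X * S) * inverse S ^ Suc k) $ k = (if i = k then 1 else 0)"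
proof -
  define R where "R = inverse S"
  define d where "d = k - i"
  have k: "k = i + d" using assms(2) by (simp add: d_def)
  have SR: "S * R = 1" using S0 by (simp add: R_def inverse_mult_eq_1')
  then have SRi: "S ^ j * R ^ j = 1" for j
    by (metis power_mult_distrib power_one)
  have "(fps_X * S) ^ i * fps_deriv (fps_X * S) * R ^ Suc k =
      fps_X ^ i * ((S ^ i * R ^ i) * (S * R * R ^ d + fps_X * (fps_deriv S * R ^ Suc d)))"
    by (simp add: k algebra_simps power_add power_mult_distrib)
  also have "\<dots> = fps_X ^ i * (R ^ d + fps_X * (fps_deriv S * R ^ Suc d))"
    by (simp add: SR SRi)
  finally have *: "((fps_X * S) ^ i * fps_deriv (fps_X * S) * R ^ Suc k) $ k =
      (R ^ d + fps_X * (fps_deriv S * R ^ Suc d)) $ d"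
    by (simp add: fps_X_power_mult_nth k)
  have "(R ^ d + fps_X * (fps_deriv S * R ^ Suc d)) $ d = (if d = 0 then 1 else 0)"
  proof (cases "d = 0")
    case False
    have "fps_deriv R = - fps_deriv S * R ^ 2"
      using fps_inverse_deriv[OF S0] by (simp add: R_def)
    then have "fps_deriv (R ^ d) = - (of_nat d * (fps_deriv S * R ^ Suc d))"
      using False by (simp add: fps_deriv_power' power2_eq_square)
        (simp add: power_Suc[symmetric] mult_ac del: power_Suc)
    then have "of_nat d * (fps_X * (fps_deriv S * R ^ Suc d)) = - (fps_X * fps_deriv (R ^ d))"
      by (simp add: mult_ac)
    then have "(of_nat d * (fps_X * (fps_deriv S * R ^ Suc d))) $ d = - (of_nat d * (R ^ d) $ d)"
      by (simp add: fps_X_times_deriv_nth del: power_Suc)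
    moreover have "(of_nat d * (fps_X * (fps_deriv S * R ^ Suc d))) $ d =
        of_nat d * (fps_X * (fps_deriv S * R ^ Suc d)) $ d"
      by (metis fps_mult_left_const_nth fps_of_nat)
    ultimately have "of_nat d * ((R ^ d) $ d + (fps_X * (fps_deriv S * R ^ Suc d)) $ d) = 0"
      by (simp only: distrib_left) simp
    with False show ?thesis
      by (simp del: power_Suc)
  qed simp
  with * show ?thesis by (simp add: R_def k)
qed

text \<open>With F = X S, cutting G after degree k leaves a remainder divisible by F^(k + 1), which
  the residue functional kills; among the powers F^i with i \<le> k,
  \<open>fps_residue_power\<close> selects i = k. The right side H is a free weight: if W inverts F,
  then G is the series of W' (H o W).\<close>

lemma fps_lagrange_inversion:
  fixes G S :: "'a::field_char_0 fps"
  assumes S0: "S $ 0 \<noteq> 0" and H: "(G oo (fps_X * S)) * fps_deriv (fps_X * S) = H"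
  shows "G $ k = (H * inverse S ^ Suc k) $ k"
proof -
  define F where "F = fps_X * S"
  have F0: "F $ 0 = 0" by (simp add: F_def)
  define T where "T = (\<Sum>i\<le>k. fps_const (G $ i) * fps_X ^ i)"
  define Q where "Q = fps_shift (Suc k) G"
  have "G = T + fps_X ^ Suc k * Q"
    by (rule fps_ext)
      (auto simp: T_def Q_def fps_sum_nth fps_X_power_mult_nth fps_mult_left_const_nth
        fps_X_power_nth if_distrib[of "\<lambda>x. _ * x"] sum.delta cong: if_cong simp del: power_Suc)
  then have "G oo F = (T oo F) + F ^ Suc k * (Q oo F)"
    by (metis F0 fps_X_power_compose fps_compose_add_distrib fps_compose_mult_distrib)
  also have "T oo F = (\<Sum>i\<le>k. fps_const (G $ i) * F ^ i)"
    by (simp add: T_def fps_compose_sum_distrib fps_compose_mult_distrib[OF F0] fps_X_power_compose[OF F0])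
  finally have GF: "G oo F = (\<Sum>i\<le>k. fps_const (G $ i) * F ^ i) + F ^ Suc k * (Q oo F)" .
  define Rk where "Rk = inverse S ^ Suc k"
  have "H * Rk = ((\<Sum>i\<le>k. fps_const (G $ i) * F ^ i) + F ^ Suc k * (Q oo F)) * fps_deriv F * Rk"
    unfolding GF[symmetric] using H by (simp only: F_def)
  also have "\<dots> = (\<Sum>i\<le>k. fps_const (G $ i) * (F ^ i * fps_deriv F * Rk)) +
      F ^ Suc k * ((Q oo F) * fps_deriv F * Rk)"
    by (simp only: distrib_right sum_distrib_right mult.assoc)
  also have "F ^ Suc k = fps_X ^ Suc k * S ^ Suc k"
    by (simp only: F_def power_mult_distrib)
  finally have "H * inverse S ^ Suc k =
      (\<Sum>i\<le>k. fps_const (G $ i) * (F ^ i * fps_deriv F * inverse S ^ Suc k)) +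
      fps_X ^ Suc k * (S ^ Suc k * ((Q oo F) * fps_deriv F * inverse S ^ Suc k))"
    by (simp only: Rk_def mult.assoc)
  then have "(H * inverse S ^ Suc k) $ k =
      (\<Sum>i\<le>k. G $ i * (F ^ i * fps_deriv F * inverse S ^ Suc k) $ k)"
    by (simp add: fps_sum_nth fps_X_power_mult_nth del: power_Suc)
  also have "\<dots> = (\<Sum>i\<le>k. G $ i * (if i = k then 1 else 0))"
    unfolding F_def using fps_residue_power[OF S0] by (intro sum.cong) auto
  also have "\<dots> = G $ k"
    by (simp add: if_distrib[of "\<lambda>x. _ * x"] sum.delta cong: if_cong)
  finally show ?thesis by simp
qed

text \<open>V = Y^(-m/2) satisfies 2 Y V' + m Y' V = 0, and the sum is the coefficient of index k of
  X times this left side. When the constant coefficient of Y is 1, it determines V recursively from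
  the coefficients of Y, so that no square root has to be expanded.\<close>

lemma fps_inverse_sqrt_power_recurrence:
  fixes S Y :: "'a::field_char_0 fps"
  assumes S0: "S $ 0 \<noteq> 0" and Y: "S ^ 2 = Y" and V_def: "V = inverse S ^ m"
  shows "(\<Sum>l=0..k. (2 * of_nat (k - l) + of_nat m * of_nat l) * (Y $ l * V $ (k - l))) = 0"
proof -
  define R where "R = inverse S"
  have SR: "S * R = 1" using S0 by (simp add: R_def inverse_mult_eq_1')
  have dV: "fps_deriv V = - (of_nat m * (fps_deriv S * R * V))"
  proof (cases m)
    case (Suc m')
    have "fps_deriv R = - fps_deriv S * R ^ 2"
      using fps_inverse_deriv[OF S0] by (simp add: R_def)
    moreover have "fps_deriv V = of_nat m * fps_deriv R * R ^ m'"
      by (simp add: V_def R_def[symmetric] Suc fps_deriv_power' del: power_Suc)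
    moreover have "V = R * R ^ m'"
      by (simp add: V_def R_def[symmetric] Suc)
    ultimately show ?thesis
      by (simp add: power2_eq_square mult_ac)
  qed (simp add: V_def)
  have dY: "fps_deriv Y = 2 * fps_deriv S * S"
    by (simp add: Y[symmetric] power2_eq_square)
  have "Y * (2 * fps_deriv V) = - (of_nat m * (2 * fps_deriv S * S) * V * (S * R))"
    unfolding dV Y[symmetric] by (simp add: power2_eq_square mult_ac)
  then have "Y * (2 * fps_deriv V) + of_nat m * fps_deriv Y * V = 0"
    by (simp add: SR dY)
  then have "0 = fps_X * (Y * (2 * fps_deriv V) + of_nat m * fps_deriv Y * V)"
    by simp
  also have "\<dots> = fps_const 2 * (Y * (fps_X * fps_deriv V)) + fps_const (of_nat m) * ((fps_X * fps_deriv Y) * V)"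
    by (simp add: algebra_simps fps_of_nat numeral_fps_const)
  finally have "0 = (fps_const 2 * (Y * (fps_X * fps_deriv V)) + fps_const (of_nat m) * ((fps_X * fps_deriv Y) * V)) $ k"
    by simp
  also have "\<dots> = 2 * (\<Sum>l=0..k. Y $ l * (of_nat (k - l) * V $ (k - l))) +
      of_nat m * (\<Sum>l=0..k. of_nat l * Y $ l * V $ (k - l))"
    by (simp only: fps_add_nth fps_mult_left_const_nth fps_mult_nth[of Y "fps_X * fps_deriv V"]
        fps_mult_nth[of "fps_X * fps_deriv Y" V] fps_X_times_deriv_nth)
  also have "\<dots> = (\<Sum>l=0..k. (2 * of_nat (k - l) + of_nat m * of_nat l) * (Y $ l * V $ (k - l)))"
    by (simp add: sum_distrib_left sum.distrib[symmetric] algebra_simps)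
  finally show ?thesis by simp
qed

lemma atLeastAtMost_numeral_sets:
  "{0..0::nat} = {0}" "{0..1::nat} = {0, 1}" "{0..2::nat} = {0, 1, 2}" "{0..3::nat} = {0, 1, 2, 3}"
  "{0..4::nat} = {0, 1, 2, 3, 4}" "{0..5::nat} = {0, 1, 2, 3, 4, 5}"
  "{0..6::nat} = {0, 1, 2, 3, 4, 5, 6}" "{0..7::nat} = {0, 1, 2, 3, 4, 5, 6, 7}"
  "{0..8::nat} = {0, 1, 2, 3, 4, 5, 6, 7, 8}"
  by auto

text \<open>Lagrange inversion needs the coefficient of index k in the power k + 1 of the inverse
  root. The even indices 2, 4, 6, 8 lead to the exponents 3, 5, 7, 9.\<close>

lemma inverse_sqrt_power_3:
  fixes S Y :: "'a::field_char_0 fps"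
  assumes S0: "S $ 0 = 1" and Y: "S ^ 2 = Y"
    and y: "Y $ 1 = y1" "Y $ 2 = y2"
  defines "V \<equiv> inverse S ^ 3"
  shows "V $ 0 = 1"
    and "V $ 1 = - 3/2 * y1"
    and "V $ 2 = 15/8 * y1^2 - 3/2 * y2"
proof -
  have "Y $ 0 = 1"
    using Y S0 by (metis fps_power_zeroth power_one)
  note y = this y
  have rec: "(\<Sum>l=0..k. (2 * of_nat (k - l) + of_nat 3 * of_nat l) * (Y $ l * V $ (k - l))) = 0" for k
    using fps_inverse_sqrt_power_recurrence[of S Y V 3] S0 Y V_def by simp
  show V0: "V $ 0 = 1"
    by (simp add: V_def S0 fps_power_zeroth)
  show V1: "V $ 1 = - 3/2 * y1"
    using rec[of 1] unfolding atLeastAtMost_numeral_sets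
    by (simp add: y V0 flip: One_nat_def) algebra?
  show V2: "V $ 2 = 15/8 * y1^2 - 3/2 * y2"
    using rec[of 2] unfolding atLeastAtMost_numeral_sets
    by (simp add: y V0 V1 flip: One_nat_def) algebra?
qed

lemma inverse_sqrt_power_5:
  fixes S Y :: "'a::field_char_0 fps"
  assumes S0: "S $ 0 = 1" and Y: "S ^ 2 = Y"
    and y: "Y $ 1 = y1" "Y $ 2 = y2" "Y $ 3 = y3" "Y $ 4 = y4"
  defines "V \<equiv> inverse S ^ 5"
  shows "V $ 0 = 1"
    and "V $ 1 = - 5/2 * y1"
    and "V $ 2 = 35/8 * y1^2 - 5/2 * y2"
    and "V $ 3 = - 105/16 * y1^3 + 35/4 * y1 * y2 - 5/2 * y3"
    and "V $ 4 = 1155/128 * y1^4 - 315/16 * y1^2 * y2 + 35/4 * y1 * y3 + 35/8 * y2^2 - 5/2 * y4"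
proof -
  have "Y $ 0 = 1"
    using Y S0 by (metis fps_power_zeroth power_one)
  note y = this y
  have rec: "(\<Sum>l=0..k. (2 * of_nat (k - l) + of_nat 5 * of_nat l) * (Y $ l * V $ (k - l))) = 0" for k
    using fps_inverse_sqrt_power_recurrence[of S Y V 5] S0 Y V_def by simp
  show V0: "V $ 0 = 1"
    by (simp add: V_def S0 fps_power_zeroth)
  show V1: "V $ 1 = - 5/2 * y1"
    using rec[of 1] unfolding atLeastAtMost_numeral_sets
    by (simp add: y V0 flip: One_nat_def) algebra?
  show V2: "V $ 2 = 35/8 * y1^2 - 5/2 * y2"
    using rec[of 2] unfolding atLeastAtMost_numeral_sets
    by (simp add: y V0 V1 flip: One_nat_def) algebra?
  show V3: "V $ 3 = - 105/16 * y1^3 + 35/4 * y1 * y2 - 5/2 * y3"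
    using rec[of 3] unfolding atLeastAtMost_numeral_sets
    by (simp add: y V0 V1 V2 flip: One_nat_def) algebra?
  show V4: "V $ 4 = 1155/128 * y1^4 - 315/16 * y1^2 * y2 + 35/4 * y1 * y3 + 35/8 * y2^2 - 5/2 * y4"
    using rec[of 4] unfolding atLeastAtMost_numeral_sets
    by (simp add: y V0 V1 V2 V3 flip: One_nat_def) algebra?
qed

lemma inverse_sqrt_power_7:
  fixes S Y :: "'a::field_char_0 fps"
  assumes S0: "S $ 0 = 1" and Y: "S ^ 2 = Y"
    and y: "Y $ 1 = y1" "Y $ 2 = y2" "Y $ 3 = y3" "Y $ 4 = y4" "Y $ 5 = y5" "Y $ 6 = y6"
  defines "V \<equiv> inverse S ^ 7"
  shows "V $ 0 = 1"
    and "V $ 1 = - 7/2 * y1"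
    and "V $ 2 = 63/8 * y1^2 - 7/2 * y2"
    and "V $ 3 = - 231/16 * y1^3 + 63/4 * y1 * y2 - 7/2 * y3"
    and "V $ 4 = 3003/128 * y1^4 - 693/16 * y1^2 * y2 + 63/4 * y1 * y3 + 63/8 * y2^2 - 7/2 * y4"
    and "V $ 5 = - 9009/256 * y1^5 + 3003/32 * y1^3 * y2 - 693/16 * y1^2 * y3 - 693/16 * y1 * y2^2 + 63/4 * y1 * y4 + 63/4 * y2 * y3 - 7/2 * y5"
    and "V $ 6 = 51051/1024 * y1^6 - 45045/256 * y1^4 * y2 + 3003/32 * y1^3 * y3 + 9009/64 * y1^2 * y2^2 - 693/16 * y1^2 * y4 - 693/8 * y1 * y2 * y3 + 63/4 * y1 * y5 - 231/16 * y2^3 + 63/4 * y2 * y4 + 63/8 * y3^2 - 7/2 * y6"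
proof -
  have "Y $ 0 = 1"
    using Y S0 by (metis fps_power_zeroth power_one)
  note y = this y
  have rec: "(\<Sum>l=0..k. (2 * of_nat (k - l) + of_nat 7 * of_nat l) * (Y $ l * V $ (k - l))) = 0" for k
    using fps_inverse_sqrt_power_recurrence[of S Y V 7] S0 Y V_def by simp
  show V0: "V $ 0 = 1"
    by (simp add: V_def S0 fps_power_zeroth)
  show V1: "V $ 1 = - 7/2 * y1"
    using rec[of 1] unfolding atLeastAtMost_numeral_sets
    by (simp add: y V0 flip: One_nat_def) algebra?
  show V2: "V $ 2 = 63/8 * y1^2 - 7/2 * y2"
    using rec[of 2] unfolding atLeastAtMost_numeral_sets
    by (simp add: y V0 V1 flip: One_nat_def) algebra?
  show V3: "V $ 3 = - 231/16 * y1^3 + 63/4 * y1 * y2 - 7/2 * y3"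
    using rec[of 3] unfolding atLeastAtMost_numeral_sets
    by (simp add: y V0 V1 V2 flip: One_nat_def) algebra?
  show V4: "V $ 4 = 3003/128 * y1^4 - 693/16 * y1^2 * y2 + 63/4 * y1 * y3 + 63/8 * y2^2 - 7/2 * y4"
    using rec[of 4] unfolding atLeastAtMost_numeral_sets
    by (simp add: y V0 V1 V2 V3 flip: One_nat_def) algebra?
  show V5: "V $ 5 = - 9009/256 * y1^5 + 3003/32 * y1^3 * y2 - 693/16 * y1^2 * y3 - 693/16 * y1 * y2^2 + 63/4 * y1 * y4 + 63/4 * y2 * y3 - 7/2 * y5"
    using rec[of 5] unfolding atLeastAtMost_numeral_sets
    by (simp add: y V0 V1 V2 V3 V4 flip: One_nat_def) algebra?
  show V6: "V $ 6 = 51051/1024 * y1^6 - 45045/256 * y1^4 * y2 + 3003/32 * y1^3 * y3 + 9009/64 * y1^2 * y2^2 - 693/16 * y1^2 * y4 - 693/8 * y1 * y2 * y3 + 63/4 * y1 * y5 - 231/16 * y2^3 + 63/4 * y2 * y4 + 63/8 * y3^2 - 7/2 * y6"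
    using rec[of 6] unfolding atLeastAtMost_numeral_sets
    by (simp add: y V0 V1 V2 V3 V4 V5 flip: One_nat_def) algebra?
qed

lemma inverse_sqrt_power_9:
  fixes S Y :: "'a::field_char_0 fps"
  assumes S0: "S $ 0 = 1" and Y: "S ^ 2 = Y"
    and y: "Y $ 1 = y1" "Y $ 2 = y2" "Y $ 3 = y3" "Y $ 4 = y4" "Y $ 5 = y5" "Y $ 6 = y6" "Y $ 7 = y7" "Y $ 8 = y8"
  defines "V \<equiv> inverse S ^ 9"
  shows "V $ 0 = 1"
    and "V $ 1 = - 9/2 * y1"
    and "V $ 2 = 99/8 * y1^2 - 9/2 * y2"
    and "V $ 3 = - 429/16 * y1^3 + 99/4 * y1 * y2 - 9/2 * y3"
    and "V $ 4 = 6435/128 * y1^4 - 1287/16 * y1^2 * y2 + 99/4 * y1 * y3 + 99/8 * y2^2 - 9/2 * y4"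
    and "V $ 5 = - 21879/256 * y1^5 + 6435/32 * y1^3 * y2 - 1287/16 * y1^2 * y3 - 1287/16 * y1 * y2^2 + 99/4 * y1 * y4 + 99/4 * y2 * y3 - 9/2 * y5"
    and "V $ 6 = 138567/1024 * y1^6 - 109395/256 * y1^4 * y2 + 6435/32 * y1^3 * y3 + 19305/64 * y1^2 * y2^2 - 1287/16 * y1^2 * y4 - 1287/8 * y1 * y2 * y3 + 99/4 * y1 * y5 - 429/16 * y2^3 + 99/4 * y2 * y4 + 99/8 * y3^2 - 9/2 * y6"
    and "V $ 7 = - 415701/2048 * y1^7 + 415701/512 * y1^5 * y2 - 109395/256 * y1^4 * y3 - 109395/128 * y1^3 * y2^2 + 6435/32 * y1^3 * y4 + 19305/32 * y1^2 * y2 * y3 - 1287/16 * y1^2 * y5 + 6435/32 * y1 * y2^3 - 1287/8 * y1 * y2 * y4 - 1287/16 * y1 * y3^2 + 99/4 * y1 * y6 - 1287/16 * y2^2 * y3 + 99/4 * y2 * y5 + 99/4 * y3 * y4 - 9/2 * y7"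
    and "V $ 8 = 9561123/32768 * y1^8 - 2909907/2048 * y1^6 * y2 + 415701/512 * y1^5 * y3 + 2078505/1024 * y1^4 * y2^2 - 109395/256 * y1^4 * y4 - 109395/64 * y1^3 * y2 * y3 + 6435/32 * y1^3 * y5 - 109395/128 * y1^2 * y2^3 + 19305/32 * y1^2 * y2 * y4 + 19305/64 * y1^2 * y3^2 - 1287/16 * y1^2 * y6 + 19305/32 * y1 * y2^2 * y3 - 1287/8 * y1 * y2 * y5 - 1287/8 * y1 * y3 * y4 + 99/4 * y1 * y7 + 6435/128 * y2^4 - 1287/16 * y2^2 * y4 - 1287/16 * y2 * y3^2 + 99/4 * y2 * y6 + 99/4 * y3 * y5 + 99/8 * y4^2 - 9/2 * y8"
proof -
  have "Y $ 0 = 1"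
    using Y S0 by (metis fps_power_zeroth power_one)
  note y = this y
  have rec: "(\<Sum>l=0..k. (2 * of_nat (k - l) + of_nat 9 * of_nat l) * (Y $ l * V $ (k - l))) = 0" for k
    using fps_inverse_sqrt_power_recurrence[of S Y V 9] S0 Y V_def by simp
  show V0: "V $ 0 = 1"
    by (simp add: V_def S0 fps_power_zeroth)
  show V1: "V $ 1 = - 9/2 * y1"
    using rec[of 1] unfolding atLeastAtMost_numeral_sets
    by (simp add: y V0 flip: One_nat_def) algebra?
  show V2: "V $ 2 = 99/8 * y1^2 - 9/2 * y2"
    using rec[of 2] unfolding atLeastAtMost_numeral_sets
    by (simp add: y V0 V1 flip: One_nat_def) algebra?
  show V3: "V $ 3 = - 429/16 * y1^3 + 99/4 * y1 * y2 - 9/2 * y3"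
    using rec[of 3] unfolding atLeastAtMost_numeral_sets
    by (simp add: y V0 V1 V2 flip: One_nat_def) algebra?
  show V4: "V $ 4 = 6435/128 * y1^4 - 1287/16 * y1^2 * y2 + 99/4 * y1 * y3 + 99/8 * y2^2 - 9/2 * y4"
    using rec[of 4] unfolding atLeastAtMost_numeral_sets
    by (simp add: y V0 V1 V2 V3 flip: One_nat_def) algebra?
  show V5: "V $ 5 = - 21879/256 * y1^5 + 6435/32 * y1^3 * y2 - 1287/16 * y1^2 * y3 - 1287/16 * y1 * y2^2 + 99/4 * y1 * y4 + 99/4 * y2 * y3 - 9/2 * y5"
    using rec[of 5] unfolding atLeastAtMost_numeral_sets
    by (simp add: y V0 V1 V2 V3 V4 flip: One_nat_def) algebra?
  show V6: "V $ 6 = 138567/1024 * y1^6 - 109395/256 * y1^4 * y2 + 6435/32 * y1^3 * y3 + 19305/64 * y1^2 * y2^2 - 1287/16 * y1^2 * y4 - 1287/8 * y1 * y2 * y3 + 99/4 * y1 * y5 - 429/16 * y2^3 + 99/4 * y2 * y4 + 99/8 * y3^2 - 9/2 * y6"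
    using rec[of 6] unfolding atLeastAtMost_numeral_sets
    by (simp add: y V0 V1 V2 V3 V4 V5 flip: One_nat_def) algebra?
  show V7: "V $ 7 = - 415701/2048 * y1^7 + 415701/512 * y1^5 * y2 - 109395/256 * y1^4 * y3 - 109395/128 * y1^3 * y2^2 + 6435/32 * y1^3 * y4 + 19305/32 * y1^2 * y2 * y3 - 1287/16 * y1^2 * y5 + 6435/32 * y1 * y2^3 - 1287/8 * y1 * y2 * y4 - 1287/16 * y1 * y3^2 + 99/4 * y1 * y6 - 1287/16 * y2^2 * y3 + 99/4 * y2 * y5 + 99/4 * y3 * y4 - 9/2 * y7"
    using rec[of 7] unfolding atLeastAtMost_numeral_sets
    by (simp add: y V0 V1 V2 V3 V4 V5 V6 flip: One_nat_def) algebra?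
  show V8: "V $ 8 = 9561123/32768 * y1^8 - 2909907/2048 * y1^6 * y2 + 415701/512 * y1^5 * y3 + 2078505/1024 * y1^4 * y2^2 - 109395/256 * y1^4 * y4 - 109395/64 * y1^3 * y2 * y3 + 6435/32 * y1^3 * y5 - 109395/128 * y1^2 * y2^3 + 19305/32 * y1^2 * y2 * y4 + 19305/64 * y1^2 * y3^2 - 1287/16 * y1^2 * y6 + 19305/32 * y1 * y2^2 * y3 - 1287/8 * y1 * y2 * y5 - 1287/8 * y1 * y3 * y4 + 99/4 * y1 * y7 + 6435/128 * y2^4 - 1287/16 * y2^2 * y4 - 1287/16 * y2 * y3^2 + 99/4 * y2 * y6 + 99/4 * y3 * y5 + 99/8 * y4^2 - 9/2 * y8"
    using rec[of 8] unfolding atLeastAtMost_numeral_sets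
    by (simp add: y V0 V1 V2 V3 V4 V5 V6 V7 flip: One_nat_def) algebra?
qed

text \<open>Lagrange inversion with weight 1: G is the expansion of U', and its coefficients are
  those of powers of Y1^(-1/2).\<close>

lemma U_coeff_fps:
  fixes G S :: "complex fps" and a b c :: real
  assumes S0: "S $ 0 = 1"
    and Y: "S ^ 2 = 1 - fps_const (of_real a) * fps_X - fps_const (of_real b) * fps_X ^ 2
      - fps_const (of_real c) * fps_X ^ 3"
    and G: "(G oo (fps_X * S)) * fps_deriv (fps_X * S) = 1" and "j \<le> 4"
  shows "G $ (2 * j) = of_real (U_coeff j a b c)"
proof -
  have G: "G $ k = (inverse S ^ Suc k) $ k" for k
    using fps_lagrange_inversion[OF _ G, of k] S0 by simp
  have y: "(S ^ 2) $ 1 = - of_real a" "(S ^ 2) $ 2 = - of_real b" "(S ^ 2) $ 3 = - of_real c"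
    "(S ^ 2) $ 4 = 0" "(S ^ 2) $ 5 = 0" "(S ^ 2) $ 6 = 0" "(S ^ 2) $ 7 = 0" "(S ^ 2) $ 8 = 0"
    unfolding Y by (simp_all add: fps_X_power_nth fps_mult_left_const_nth fps_X_nth del: One_nat_def)
  consider "j = 0" | "j = 1" | "j = 2" | "j = 3" | "j = 4"
    using \<open>j \<le> 4\<close> by linarith
  then show ?thesis
  proof cases
    case 1
    then show ?thesis using G[of 0] S0 by (simp add: U_coeff_def)
  next
    case 2
    then show ?thesis
      using G[of 2] inverse_sqrt_power_3(3)[OF S0 refl y(1-2)]
      by (simp add: U_coeff_def) algebra?
  next
    case 3
    then show ?thesis
      using G[of 4] inverse_sqrt_power_5(5)[OF S0 refl y(1-4)]
      by (simp add: U_coeff_def) algebra?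
  next
    case 4
    then show ?thesis
      using G[of 6] inverse_sqrt_power_7(7)[OF S0 refl y(1-6)]
      by (simp add: U_coeff_def) algebra?
  next
    case 5
    then show ?thesis
      using G[of 8] inverse_sqrt_power_9(9)[OF S0 refl y(1-8)]
      by (simp add: U_coeff_def) algebra?
  qed
qed

text \<open>Lagrange inversion with weight e^(\<alpha> q) for \<alpha> = 1 - n + 2 j n: G expands
  q'(x) e^(\<alpha> q(x)). Its coefficients are polynomials in n because those of Y2 are.\<close>

lemma J_coeff_fps:
  fixes G S :: "complex fps" and n :: real
  assumes S0: "S $ 0 = 1"
    and Y: "\<And>l. (S ^ 2) $ l = of_real (2 * ((1 - 2 * n) ^ Suc l - (- 2 * n) ^ Suc l) / fact (l + 2))"
    and G: "(G oo (fps_X * S)) * fps_deriv (fps_X * S) = fps_exp (of_real (1 - n + 2 * real j * n))"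
    and "j + i \<le> 4"
  shows "G $ (2 * i) = of_real (J_coeff j i n)"
proof -
  define \<alpha> where "\<alpha> = complex_of_real (1 - n + 2 * real j * n)"
  have G: "G $ k = (\<Sum>l=0..k. \<alpha> ^ l / fact l * (inverse S ^ Suc k) $ (k - l))" for k
    using fps_lagrange_inversion[OF _ G, of k] S0 by (simp add: fps_mult_nth \<alpha>_def)
  define N where "N = complex_of_real n"
  have Yz: "(S ^ 2) $ l = 2 * ((1 - 2 * N) ^ Suc l - (- 2 * N) ^ Suc l) / fact (l + 2)" for l
    by (simp add: Y N_def del: power_Suc)
  have z1: "(S ^ 2) $ 1 = - 4/3 * N + 1/3"
    unfolding Yz by (simp add: fact_numeral) algebra
  have z2: "(S ^ 2) $ 2 = N^2 - 1/2 * N + 1/12"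
    unfolding Yz by (simp add: fact_numeral) algebra
  have z3: "(S ^ 2) $ 3 = - 8/15 * N^3 + 2/5 * N^2 - 2/15 * N + 1/60"
    unfolding Yz by (simp add: fact_numeral) algebra
  have z4: "(S ^ 2) $ 4 = 2/9 * N^4 - 2/9 * N^3 + 1/9 * N^2 - 1/36 * N + 1/360"
    unfolding Yz by (simp add: fact_numeral) algebra
  have z5: "(S ^ 2) $ 5 = - 8/105 * N^5 + 2/21 * N^4 - 4/63 * N^3 + 1/42 * N^2 - 1/210 * N + 1/2520"
    unfolding Yz by (simp add: fact_numeral) algebra
  have z6: "(S ^ 2) $ 6 = 1/45 * N^6 - 1/30 * N^5 + 1/36 * N^4 - 1/72 * N^3 + 1/240 * N^2 - 1/1440 * N + 1/20160"
    unfolding Yz by (simp add: fact_numeral) algebra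
  have z7: "(S ^ 2) $ 7 = - 16/2835 * N^7 + 4/405 * N^6 - 4/405 * N^5 + 1/162 * N^4 - 1/405 * N^3 + 1/1620 * N^2 - 1/11340 * N + 1/181440"
    unfolding Yz by (simp add: fact_numeral) algebra
  have z8: "(S ^ 2) $ 8 = 2/1575 * N^8 - 4/1575 * N^7 + 2/675 * N^6 - 1/450 * N^5 + 1/900 * N^4 - 1/2700 * N^3 + 1/12600 * N^2 - 1/100800 * N + 1/1814400"
    unfolding Yz by (simp add: fact_numeral) algebra
  have \<alpha>: "\<alpha> = 1 - N + 2 * of_nat j * N"
    by (simp add: \<alpha>_def N_def)
  note V3 = inverse_sqrt_power_3[OF S0 refl z1 z2]
  note V5 = inverse_sqrt_power_5[OF S0 refl z1 z2 z3 z4]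
  note V7 = inverse_sqrt_power_7[OF S0 refl z1 z2 z3 z4 z5 z6]
  note V9 = inverse_sqrt_power_9[OF S0 refl z1 z2 z3 z4 z5 z6 z7 z8]
  have G2: "G $ 2 = (inverse S ^ 3) $ 2 + \<alpha> * (inverse S ^ 3) $ 1 + 1/2 * \<alpha> ^ 2 * (inverse S ^ 3) $ 0"
    unfolding G[of 2] atLeastAtMost_numeral_sets
    by (simp add: fact_numeral flip: One_nat_def)
  have G4: "G $ 4 = (inverse S ^ 5) $ 4 + \<alpha> * (inverse S ^ 5) $ 3 + 1/2 * \<alpha> ^ 2 * (inverse S ^ 5) $ 2 + 1/6 * \<alpha> ^ 3 * (inverse S ^ 5) $ 1 + 1/24 * \<alpha> ^ 4 * (inverse S ^ 5) $ 0"
    unfolding G[of 4] atLeastAtMost_numeral_sets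
    by (simp add: fact_numeral flip: One_nat_def)
  have G6: "G $ 6 = (inverse S ^ 7) $ 6 + \<alpha> * (inverse S ^ 7) $ 5 + 1/2 * \<alpha> ^ 2 * (inverse S ^ 7) $ 4 + 1/6 * \<alpha> ^ 3 * (inverse S ^ 7) $ 3 + 1/24 * \<alpha> ^ 4 * (inverse S ^ 7) $ 2 + 1/120 * \<alpha> ^ 5 * (inverse S ^ 7) $ 1 + 1/720 * \<alpha> ^ 6 * (inverse S ^ 7) $ 0"
    unfolding G[of 6] atLeastAtMost_numeral_sets
    by (simp add: fact_numeral flip: One_nat_def)
  have G8: "G $ 8 = (inverse S ^ 9) $ 8 + \<alpha> * (inverse S ^ 9) $ 7 + 1/2 * \<alpha> ^ 2 * (inverse S ^ 9) $ 6 + 1/6 * \<alpha> ^ 3 * (inverse S ^ 9) $ 5 + 1/24 * \<alpha> ^ 4 * (inverse S ^ 9) $ 4 + 1/120 * \<alpha> ^ 5 * (inverse S ^ 9) $ 3 + 1/720 * \<alpha> ^ 6 * (inverse S ^ 9) $ 2 + 1/5040 * \<alpha> ^ 7 * (inverse S ^ 9) $ 1 + 1/40320 * \<alpha> ^ 8 * (inverse S ^ 9) $ 0"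
    unfolding G[of 8] atLeastAtMost_numeral_sets
    by (simp add: fact_numeral flip: One_nat_def)
  consider (zero) "i = 0"
    | (c01) "j = 0" "i = 1"
    | (c02) "j = 0" "i = 2"
    | (c03) "j = 0" "i = 3"
    | (c04) "j = 0" "i = 4"
    | (c11) "j = 1" "i = 1"
    | (c12) "j = 1" "i = 2"
    | (c13) "j = 1" "i = 3"
    | (c21) "j = 2" "i = 1"
    | (c22) "j = 2" "i = 2"
    | (c31) "j = 3" "i = 1"
  proof -
    have "j = 0 \<or> j = 1 \<or> j = 2 \<or> j = 3 \<or> j = 4" "i = 0 \<or> i = 1 \<or> i = 2 \<or> i = 3 \<or> i = 4"
      using \<open>j + i \<le> 4\<close> by linarith+
    then show ?thesis
      using that \<open>j + i \<le> 4\<close> by (elim disjE) simp_all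
  qed
  then show ?thesis
  proof cases
    case zero
    then show ?thesis using G[of 0] S0 by (simp add: J_coeff_def)
  next
    case c01
    then have \<alpha>: "\<alpha> = 1 - N" by (simp add: \<alpha>)
    have J: "of_real (J_coeff 0 1 n) = 1/3 * N^2 + 7/12 * N + 1/12"
      by (simp add: J_coeff_def N_def)
    have "G $ 2 = of_real (J_coeff 0 1 n)"
      unfolding G2 V3 \<alpha> J by algebra
    then show ?thesis by (simp add: c01)
  next
    case c02
    then have \<alpha>: "\<alpha> = 1 - N" by (simp add: \<alpha>)
    have J: "of_real (J_coeff 0 2 n) = 25/54 * N^4 + 67/108 * N^3 - 13/288 * N^2 - 17/432 * N + 1/864"
      by (simp add: J_coeff_def N_def)
    have "G $ 4 = of_real (J_coeff 0 2 n)"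
      unfolding G4 V5 \<alpha> J by algebra
    then show ?thesis by (simp add: c02)
  next
    case c03
    then have \<alpha>: "\<alpha> = 1 - N" by (simp add: \<alpha>)
    have J: "of_real (J_coeff 0 3 n) = 9041/12150 * N^6 + 11123/16200 * N^5 - 26051/64800 * N^4 - 44893/777600 * N^3 + 7609/259200 * N^2 - 37/259200 * N - 139/777600"
      by (simp add: J_coeff_def N_def)
    have "G $ 6 = of_real (J_coeff 0 3 n)"
      unfolding G6 V7 \<alpha> J by algebra
    then show ?thesis by (simp add: c03)
  next
    case c04
    then have \<alpha>: "\<alpha> = 1 - N" by (simp add: \<alpha>)
    have J: "of_real (J_coeff 0 4 n) = 1298597/1020600 * N^8 + 127663/204120 * N^7 - 1312223/1166400 * N^6 + 2339903/16329600 * N^5 + 27787157/261273600 * N^4 - 1406329/65318400 * N^3 - 158633/130636800 * N^2 + 19907/65318400 * N - 571/261273600"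
      by (simp add: J_coeff_def N_def)
    have "G $ 8 = of_real (J_coeff 0 4 n)"
      unfolding G8 V9 \<alpha> J by algebra
    then show ?thesis by (simp add: c04)
  next
    case c11
    then have \<alpha>: "\<alpha> = 1 + N" by (simp add: \<alpha>)
    have J: "of_real (J_coeff 1 1 n) = 13/3 * N^2 + 19/12 * N + 1/12"
      by (simp add: J_coeff_def N_def)
    have "G $ 2 = of_real (J_coeff 1 1 n)"
      unfolding G2 V3 \<alpha> J by algebra
    then show ?thesis by (simp add: c11)
  next
    case c12
    then have \<alpha>: "\<alpha> = 1 + N" by (simp add: \<alpha>)
    have J: "of_real (J_coeff 1 2 n) = 649/54 * N^4 + 367/108 * N^3 - 101/288 * N^2 - 29/432 * N + 1/864"
      by (simp add: J_coeff_def N_def)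
    have "G $ 4 = of_real (J_coeff 1 2 n)"
      unfolding G4 V5 \<alpha> J by algebra
    then show ?thesis by (simp add: c12)
  next
    case c13
    then have \<alpha>: "\<alpha> = 1 + N" by (simp add: \<alpha>)
    have J: "of_real (J_coeff 1 3 n) = 359501/12150 * N^6 + 26423/16200 * N^5 - 212711/64800 * N^4 - 6553/777600 * N^3 + 18769/259200 * N^2 - 217/259200 * N - 139/777600"
      by (simp add: J_coeff_def N_def)
    have "G $ 6 = of_real (J_coeff 1 3 n)"
      unfolding G6 V7 \<alpha> J by algebra
    then show ?thesis by (simp add: c13)
  next
    case c21
    then have \<alpha>: "\<alpha> = 1 + 3 * N" by (simp add: \<alpha>)
    have J: "of_real (J_coeff 2 1 n) = 37/3 * N^2 + 31/12 * N + 1/12"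
      by (simp add: J_coeff_def N_def)
    have "G $ 2 = of_real (J_coeff 2 1 n)"
      unfolding G2 V3 \<alpha> J by algebra
    then show ?thesis by (simp add: c21)
  next
    case c22
    then have \<alpha>: "\<alpha> = 1 + 3 * N" by (simp add: \<alpha>)
    have J: "of_real (J_coeff 2 2 n) = 3313/54 * N^4 + 1039/108 * N^3 - 253/288 * N^2 - 41/432 * N + 1/864"
      by (simp add: J_coeff_def N_def)
    have "G $ 4 = of_real (J_coeff 2 2 n)"
      unfolding G4 V5 \<alpha> J by algebra
    then show ?thesis by (simp add: c22)
  next
    case c31
    then have \<alpha>: "\<alpha> = 1 + 5 * N" by (simp add: \<alpha>)
    have J: "of_real (J_coeff 3 1 n) = 73/3 * N^2 + 43/12 * N + 1/12"
      by (simp add: J_coeff_def N_def)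
    have "G $ 2 = of_real (J_coeff 3 1 n)"
      unfolding G2 V3 \<alpha> J by algebra
    then show ?thesis by (simp add: c31)
  qed
qed

subsection \<open>Wallis integrals\<close>

definition trig_integral :: "nat \<Rightarrow> nat \<Rightarrow> real" where
  "trig_integral s i = integral {0..2 * pi} (\<lambda>\<theta>. sin \<theta> ^ s * cos \<theta> ^ i)"

lemma integrable_trig [simp]: "(\<lambda>\<theta>. sin \<theta> ^ s * cos \<theta> ^ i) integrable_on {0..2 * pi :: real}"
  by (intro integrable_continuous_real continuous_intros)

text \<open>The derivative of \<open>sin \<theta> ^ (s + 1) * cos \<theta> ^ (i + 1)\<close>
  integrates to 0 over a period.\<close>

lemma trig_integral_rec: "real (i + s + 2) * trig_integral (s + 2) i = real (s + 1) * trig_integral s i"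
proof -
  have "((\<lambda>\<theta>. real (s + 1) * (sin \<theta> ^ s * cos \<theta> ^ i) - real (i + s + 2) * (sin \<theta> ^ (s + 2) * cos \<theta> ^ i))
      has_integral sin (2 * pi) ^ (s + 1) * cos (2 * pi) ^ (i + 1) - sin 0 ^ (s + 1) * cos 0 ^ (i + 1)) {0..2 * pi}"
  proof (rule fundamental_theorem_of_calculus)
    fix \<theta> :: real
    have "((\<lambda>\<theta>. sin \<theta> ^ (s + 1) * cos \<theta> ^ (i + 1)) has_real_derivative
        real (s + 1) * (sin \<theta> ^ s * (cos \<theta> ^ i * (cos \<theta>)\<^sup>2)) - real (i + 1) * (sin \<theta> ^ (s + 2) * cos \<theta> ^ i)) (at \<theta>)"
      by (rule derivative_eq_intros refl | simp)+ (simp add: algebra_simps power2_eq_square)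
    also have "real (s + 1) * (sin \<theta> ^ s * (cos \<theta> ^ i * (cos \<theta>)\<^sup>2)) - real (i + 1) * (sin \<theta> ^ (s + 2) * cos \<theta> ^ i)
        = real (s + 1) * (sin \<theta> ^ s * cos \<theta> ^ i) - real (i + s + 2) * (sin \<theta> ^ (s + 2) * cos \<theta> ^ i)"
      by (simp add: cos_squared_eq power_add algebra_simps) (simp add: power2_eq_square)
    finally show "((\<lambda>\<theta>. sin \<theta> ^ (s + 1) * cos \<theta> ^ (i + 1)) has_vector_derivative
        real (s + 1) * (sin \<theta> ^ s * cos \<theta> ^ i) - real (i + s + 2) * (sin \<theta> ^ (s + 2) * cos \<theta> ^ i))
        (at \<theta> within {0..2 * pi})"
      by (simp add: has_real_derivative_iff_has_vector_derivative has_vector_derivative_at_within)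
  qed simp
  moreover have "((\<lambda>\<theta>. real (s + 1) * (sin \<theta> ^ s * cos \<theta> ^ i) - real (i + s + 2) * (sin \<theta> ^ (s + 2) * cos \<theta> ^ i))
      has_integral real (s + 1) * trig_integral s i - real (i + s + 2) * trig_integral (s + 2) i) {0..2 * pi}"
    unfolding trig_integral_def
    by (intro has_integral_diff has_integral_mult_right integrable_integral integrable_trig)
  ultimately show ?thesis
    by (auto dest: has_integral_unique)
qed

lemma trig_integral_Suc_Suc_cos: "trig_integral s (i + 2) = trig_integral s i - trig_integral (s + 2) i"
proof -
  have "(\<lambda>\<theta>. sin \<theta> ^ s * cos \<theta> ^ (i + 2)) = (\<lambda>\<theta>::real. sin \<theta> ^ s * cos \<theta> ^ i - sin \<theta> ^ (s + 2) * cos \<theta> ^ i)"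
    by (simp add: fun_eq_iff power_add cos_squared_eq algebra_simps del: add_2_eq_Suc')
  then show ?thesis
    by (simp add: trig_integral_def integral_diff del: power_Suc add_2_eq_Suc')
qed

lemma trig_integral_odd: "odd s \<Longrightarrow> trig_integral s i = 0"
proof (induction s rule: nat_induct2)
  case 1
  have "((\<lambda>\<theta>. sin \<theta> * cos \<theta> ^ i) has_integral
      - (cos (2 * pi) ^ (i + 1)) / real (i + 1) - - (cos 0 ^ (i + 1)) / real (i + 1)) {0..2 * pi}"
  proof (rule fundamental_theorem_of_calculus)
    fix \<theta> :: real
    have "((\<lambda>\<theta>. - (cos \<theta> ^ (i + 1)) / real (i + 1)) has_real_derivative sin \<theta> * cos \<theta> ^ i) (at \<theta>)"
      by (rule derivative_eq_intros refl | simp)+ 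
    then show "((\<lambda>\<theta>. - (cos \<theta> ^ (i + 1)) / real (i + 1)) has_vector_derivative sin \<theta> * cos \<theta> ^ i)
        (at \<theta> within {0..2 * pi})"
      by (simp add: has_real_derivative_iff_has_vector_derivative has_vector_derivative_at_within)
  qed simp
  from integral_unique[OF this] show ?case
    by (simp add: trig_integral_def)
next
  case (step s)
  then have "real (i + s + 2) * trig_integral (s + 2) i = 0"
    by (simp only: trig_integral_rec) simp
  then show ?case by simp
qed simp

lemma wallis_Suc:
  "wallis (Suc j) i = wallis j i * (2 * j + 1) / (2 * (i + j + 1))"
  "wallis j (Suc i) = wallis j i * (2 * i + 1) / (2 * (i + j + 1))"
proof -
  have *: "fact (2 * Suc k) = 2 * (real k + 1) * (real (2 * k + 1) * fact (2 * k))"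
    "fact (Suc k) = (real k + 1) * fact k" for k
    by (simp_all add: algebra_simps)
  have **: "fact (Suc j + i) = real (i + j + 1) * fact (j + i)" "fact (j + Suc i) = real (i + j + 1) * fact (j + i)"
    "(4::real) ^ (Suc j + i) = 4 * 4 ^ (j + i)" "(4::real) ^ (j + Suc i) = 4 * 4 ^ (j + i)"
    by (simp_all add: algebra_simps)
  have aux: "2 * x * (k * A) * B / (4 * C * (x * D) * E * (y * F)) = A * B / (C * D * E * F) * k / (2 * y)"
    "B * (2 * x * (k * A)) / (4 * C * E * (x * D) * (y * F)) = B * A / (C * E * D * F) * k / (2 * y)"
    if "x \<noteq> 0" "y \<noteq> 0" for x y k A B C D E F :: real
    using that by (simp_all add: mult_ac)
  have "real (i + j + 1) \<noteq> 0" "real i + 1 \<noteq> 0" "real j + 1 \<noteq> 0" by linarith+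
  then show "wallis (Suc j) i = wallis j i * (2 * j + 1) / (2 * (i + j + 1))"
    "wallis j (Suc i) = wallis j i * (2 * i + 1) / (2 * (i + j + 1))"
    unfolding wallis_def * ** of_nat_mult of_nat_numeral by - (intro aux; assumption)+
qed

lemma trig_integral_even: "trig_integral (2 * j) (2 * i) = 2 * pi * wallis j i"
proof (induction i arbitrary: j)
  case 0
  show ?case
  proof (induction j)
    case 0
    show ?case by (simp add: trig_integral_def wallis_def)
  next
    case (Suc j)
    then show ?case
      using trig_integral_rec[of 0 "2 * j"] by (simp add: wallis_Suc field_simps)
  qed
next
  case (Suc i)
  have "real i + real j + 1 \<noteq> 0" by linarith
  then show ?case
    using trig_integral_Suc_Suc_cos[of "2 * j" "2 * i"] Suc[of j] Suc[of "Suc j"]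
    by (simp add: wallis_Suc) (simp add: field_simps)
qed

subsection \<open>Holomorphic functions depending continuously on a parameter\<close>

text \<open>The class of functions in which the period is constructed: it is closed under products,
  composition, differentiation in the first variable and integration over a further
  parameter.\<close>

definition jhol :: "(complex \<Rightarrow> 'p::metric_space \<Rightarrow> complex) \<Rightarrow> real \<Rightarrow> 'p set \<Rightarrow> bool" where
  "jhol f r N \<longleftrightarrow> continuous_on (ball 0 r \<times> N) (\<lambda>z. f (fst z) (snd z)) \<and>
     (\<forall>\<mu>\<in>N. (\<lambda>w. f w \<mu>) holomorphic_on ball 0 r)"

lemma jholI:
  assumes "continuous_on (ball 0 r \<times> N) (\<lambda>z. f (fst z) (snd z))"
    "\<And>\<mu>. \<mu> \<in> N \<Longrightarrow> (\<lambda>w. f w \<mu>) holomorphic_on ball 0 r"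
  shows "jhol f r N"
  unfolding jhol_def by (intro conjI ballI assms)

lemma jhol_continuous: "jhol f r N \<Longrightarrow> continuous_on (ball 0 r \<times> N) (\<lambda>z. f (fst z) (snd z))"
  by (simp add: jhol_def)

lemma jhol_holomorphic: "jhol f r N \<Longrightarrow> \<mu> \<in> N \<Longrightarrow> (\<lambda>w. f w \<mu>) holomorphic_on ball 0 r"
  by (simp add: jhol_def)

lemma jhol_subset:
  assumes "jhol f r N" "r' \<le> r" "N' \<subseteq> N"
  shows "jhol f r' N'"
proof (rule jholI)
  have "ball 0 r' \<times> N' \<subseteq> ball (0::complex) r \<times> N"
    using assms(2,3) subset_ball[OF assms(2)] by blast
  then show "continuous_on (ball 0 r' \<times> N') (\<lambda>z. f (fst z) (snd z))"
    by (rule continuous_on_subset[OF jhol_continuous[OF assms(1)]])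
  show "(\<lambda>w. f w \<mu>) holomorphic_on ball 0 r'" if "\<mu> \<in> N'" for \<mu>
    using assms(3) that by (intro holomorphic_on_subset[OF jhol_holomorphic[OF assms(1)] subset_ball[OF assms(2)]]) blast
qed

lemma jhol_compose:
  assumes "jhol f r N" "jhol g s N" "\<And>w \<mu>. w \<in> ball 0 s \<Longrightarrow> \<mu> \<in> N \<Longrightarrow> g w \<mu> \<in> ball 0 r"
  shows "jhol (\<lambda>w \<mu>. f (g w \<mu>) \<mu>) s N"
proof (rule jholI)
  have "continuous_on (ball 0 s \<times> N) (\<lambda>z. (\<lambda>z. f (fst z) (snd z)) (g (fst z) (snd z), snd z))"
    by (rule continuous_on_compose2[OF jhol_continuous[OF assms(1)]])
      (use assms(3) in \<open>auto intro!: continuous_intros jhol_continuous[OF assms(2)]\<close>)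
  then show "continuous_on (ball 0 s \<times> N) (\<lambda>z. f (g (fst z) (snd z)) (snd z))"
    by simp
next
  fix \<mu> assume \<mu>: "\<mu> \<in> N"
  have "(\<lambda>w. f w \<mu>) \<circ> (\<lambda>w. g w \<mu>) holomorphic_on ball 0 s"
    by (rule holomorphic_on_compose_gen[OF jhol_holomorphic[OF assms(2) \<mu>] jhol_holomorphic[OF assms(1) \<mu>]])
      (use assms(3) \<mu> in blast)
  then show "(\<lambda>w. f (g w \<mu>) \<mu>) holomorphic_on ball 0 s"
    by (simp add: o_def)
qed

lemma jhol_mult: "jhol f r N \<Longrightarrow> jhol g r N \<Longrightarrow> jhol (\<lambda>w \<mu>. f w \<mu> * g w \<mu>) r N"
  by (rule jholI) (auto intro!: continuous_intros holomorphic_intros dest: jhol_continuous jhol_holomorphic)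

text \<open>On a compact disc f(., \<mu>) is uniformly close to f(., \<mu>0) when \<mu> is near
  \<mu>0. Cauchy's inequality for the difference makes the derivatives close, and the derivative at
  \<mu>0 is itself continuous in w.\<close>

lemma jhol_deriv:
  fixes f :: "complex \<Rightarrow> 'p::metric_space \<Rightarrow> complex"
  assumes f: "jhol f r N"
  shows "jhol (\<lambda>w \<mu>. deriv (\<lambda>w. f w \<mu>) w) r N"
proof (rule jholI)
  show "(\<lambda>w. deriv (\<lambda>w. f w \<mu>) w) holomorphic_on ball 0 r" if "\<mu> \<in> N" for \<mu>
    using jhol_holomorphic[OF f that] by (rule holomorphic_deriv) auto
  show "continuous_on (ball 0 r \<times> N) (\<lambda>z. deriv (\<lambda>w. f w (snd z)) (fst z))"
    unfolding continuous_on_eq_continuous_within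
  proof
    fix z0 :: "complex \<times> 'p" assume z0: "z0 \<in> ball 0 r \<times> N"
    obtain w0 \<mu>0 where z0_eq: "z0 = (w0, \<mu>0)" by fastforce
    \<comment> \<open>A quarter of the distance to the boundary leaves room for a disc of radius s
      about each point within s of w0, all inside the compact disc of radius 2 s.\<close>
    define s where "s = (r - norm w0) / 4"
    have w0: "norm w0 < r" and \<mu>0: "\<mu>0 \<in> N" using z0 by (auto simp: z0_eq)
    then have s: "0 < s" "norm w0 + 3 * s < r" by (auto simp: s_def field_simps)
    have sub: "cball w s \<subseteq> cball w0 (2 * s)" if "w \<in> ball w0 s" for w
    proof
      fix x assume "x \<in> cball w s"
      then show "x \<in> cball w0 (2 * s)"
        using that dist_triangle[of w0 x w] by simp
    qed
    have sub2: "cball w0 (2 * s) \<subseteq> ball 0 r"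
      using s by (intro cball_subset_ball_iff[THEN iffD2]) (auto simp: dist_norm)
    show "continuous (at z0 within ball 0 r \<times> N) (\<lambda>z. deriv (\<lambda>w. f w (snd z)) (fst z))"
      unfolding continuous_within_eps_delta
    proof (intro allI impI)
      fix e :: real assume "0 < e"
      \<comment> \<open>Cauchy's inequality on a circle of radius s divides the uniform bound by s,
        which leaves e / 4.\<close>
      define c where "c = e * s / 4"
      have "0 < c" using \<open>0 < e\<close> s by (simp add: c_def)
      have cont: "continuous_on (N \<times> cball w0 (2 * s)) (\<lambda>z. f (snd z) (fst z))"
        by (rule continuous_on_compose2[OF jhol_continuous[OF f], of _ "\<lambda>z. (snd z, fst z)", simplified])
          (use sub2 in \<open>auto intro!: continuous_intros\<close>)
      obtain X where X: "\<mu>0 \<in> X" "open X"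
        "\<forall>\<mu>\<in>X \<inter> N. \<forall>t\<in>cball w0 (2 * s). dist (f t \<mu>) (f t \<mu>0) \<le> c"
        using continuous_on_prod_compactE[OF cont compact_cball \<mu>0 \<open>0 < c\<close>]
        unfolding fst_conv snd_conv by metis
      obtain d1 where d1: "0 < d1" "ball \<mu>0 d1 \<subseteq> X"
        using X(1,2) open_contains_ball by blast
      have "continuous_on (ball 0 r) (\<lambda>w. deriv (\<lambda>w. f w \<mu>0) w)"
        by (intro holomorphic_on_imp_continuous_on holomorphic_deriv[OF jhol_holomorphic[OF f \<mu>0]]) auto
      then obtain d2 where d2: "0 < d2"
        "\<And>w. w \<in> ball 0 r \<Longrightarrow> dist w w0 < d2 \<Longrightarrow> dist (deriv (\<lambda>w. f w \<mu>0) w) (deriv (\<lambda>w. f w \<mu>0) w0) < e / 2"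
        using w0 \<open>0 < e\<close> unfolding continuous_on_iff by (metis half_gt_zero mem_ball_0)
      have "dist (deriv (\<lambda>w. f w \<mu>) w) (deriv (\<lambda>w. f w \<mu>0) w0) < e"
        if wr: "w \<in> ball 0 r" and \<mu>: "\<mu> \<in> N" and d: "dist (w, \<mu>) z0 < Min {d1, d2, s}" for w \<mu>
      proof -
        have dw: "dist w w0 < d2" "dist w w0 < s" "dist \<mu> \<mu>0 < d1"
          using d dist_fst_le[of "(w, \<mu>)" z0] dist_snd_le[of "(w, \<mu>)" z0] by (auto simp: z0_eq)
        then have "w \<in> ball w0 s" "\<mu> \<in> X" using d1 by (auto simp: dist_commute)
        note sw = sub[OF this(1)]
        have hol: "(\<lambda>t. f t \<mu> - f t \<mu>0) holomorphic_on cball w s"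
          using sw sub2 by (intro holomorphic_intros holomorphic_on_subset[OF jhol_holomorphic[OF f]] \<mu> \<mu>0) auto
        have "cmod ((deriv ^^ 1) (\<lambda>t. f t \<mu> - f t \<mu>0) w) \<le> fact 1 * c / s ^ 1"
        proof (rule Cauchy_inequality)
          show "(\<lambda>t. f t \<mu> - f t \<mu>0) holomorphic_on ball w s"
            using hol ball_subset_cball holomorphic_on_subset by blast
          show "continuous_on (cball w s) (\<lambda>t. f t \<mu> - f t \<mu>0)"
            using hol by (rule holomorphic_on_imp_continuous_on)
          show "cmod (f t \<mu> - f t \<mu>0) \<le> c" if "cmod (w - t) = s" for t
            using X(3) \<open>\<mu> \<in> X\<close> \<mu> sw that by (auto simp: dist_norm)
        qed (use s in auto)
        moreover have "deriv (\<lambda>t. f t \<mu> - f t \<mu>0) w = deriv (\<lambda>w. f w \<mu>) w - deriv (\<lambda>w. f w \<mu>0) w"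
          using wr \<mu> \<mu>0 by (intro deriv_diff) (auto intro!: holomorphic_on_imp_differentiable_at[OF jhol_holomorphic[OF f]])
        ultimately have "dist (deriv (\<lambda>w. f w \<mu>) w) (deriv (\<lambda>w. f w \<mu>0) w) \<le> e / 4"
          using s by (simp add: c_def dist_norm)
        with d2(2)[OF wr dw(1)] show ?thesis
          using \<open>0 < e\<close> dist_triangle[of "deriv (\<lambda>w. f w \<mu>) w" "deriv (\<lambda>w. f w \<mu>0) w0" "deriv (\<lambda>w. f w \<mu>0) w"]
          by linarith
      qed
      moreover have "0 < Min {d1, d2, s}" using d1 d2 s by simp
      ultimately show "\<exists>d>0. \<forall>z\<in>ball 0 r \<times> N. dist z z0 < d \<longrightarrow>
          dist (deriv (\<lambda>w. f w (snd z)) (fst z)) (deriv (\<lambda>w. f w (snd z0)) (fst z0)) < e"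
        by (intro exI[of _ "Min {d1, d2, s}"] conjI ballI impI) (metis SigmaE fst_conv snd_conv z0_eq)+
    qed
  qed
qed

lemma jhol_higher_deriv: "jhol f r N \<Longrightarrow> jhol (\<lambda>w \<mu>. (deriv ^^ k) (\<lambda>w. f w \<mu>) w) r N"
proof (induction k)
  case (Suc k)
  from jhol_deriv[OF Suc.IH[OF Suc.prems]] show ?case
    by simp
qed simp

lemma jhol_integral:
  fixes f :: "complex \<Rightarrow> 'p::metric_space \<times> real \<Rightarrow> complex"
  assumes f: "jhol f r (N \<times> {a..b})"
  shows "jhol (\<lambda>w \<mu>. integral {a..b} (\<lambda>\<theta>. f w (\<mu>, \<theta>))) r N"
proof (rule jholI)
  have "continuous_on ((ball 0 r \<times> N) \<times> cbox a b) (\<lambda>(z, \<theta>). f (fst z) (snd z, \<theta>))"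
    unfolding split_beta
    by (rule continuous_on_compose2[OF jhol_continuous[OF f], of _ "\<lambda>z. (fst (fst z), (snd (fst z), snd z))", simplified])
      (auto intro!: continuous_intros)
  from integral_continuous_on_param[OF this]
  show "continuous_on (ball 0 r \<times> N) (\<lambda>z. integral {a..b} (\<lambda>\<theta>. f (fst z) (snd z, \<theta>)))"
    by simp
next
  fix \<mu> assume \<mu>: "\<mu> \<in> N"
  have "(\<lambda>w. integral (cbox a b) (\<lambda>\<theta>. f w (\<mu>, \<theta>))) holomorphic_on ball 0 r"
  proof (rule leibniz_rule_holomorphic)
    fix w :: complex and \<theta> assume "w \<in> ball 0 r" "\<theta> \<in> cbox a b"
    then show "((\<lambda>w. f w (\<mu>, \<theta>)) has_field_derivative deriv (\<lambda>w. f w (\<mu>, \<theta>)) w) (at w within ball 0 r)"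
      using \<mu> by (intro DERIV_subset[OF holomorphic_derivI[OF jhol_holomorphic[OF f]]]) auto
  next
    fix w :: complex assume w: "w \<in> ball 0 r"
    have "continuous_on (cbox a b) (\<lambda>\<theta>. f w (\<mu>, \<theta>))"
      by (rule continuous_on_compose2[OF jhol_continuous[OF f], of _ "\<lambda>\<theta>. (w, (\<mu>, \<theta>))", simplified])
        (use w \<mu> in \<open>auto intro!: continuous_intros\<close>)
    then show "(\<lambda>\<theta>. f w (\<mu>, \<theta>)) integrable_on cbox a b"
      by (rule integrable_continuous)
  next
    show "continuous_on (ball 0 r \<times> cbox a b) (\<lambda>(w, \<theta>). deriv (\<lambda>w. f w (\<mu>, \<theta>)) w)"
      unfolding split_beta
      by (rule continuous_on_compose2[OF jhol_continuous[OF jhol_deriv[OF f]], of _ "\<lambda>z. (fst z, (\<mu>, snd z))", simplified])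
        (use \<mu> in \<open>auto intro!: continuous_intros\<close>)
  qed (rule convex_ball)
  then show "(\<lambda>w. integral {a..b} (\<lambda>\<theta>. f w (\<mu>, \<theta>))) holomorphic_on ball 0 r"
    by simp
qed

text \<open>Cauchy's inequality on the circle of radius s bounds the derivative by a multiple of
  s^(m - k), which tends to 0 with s.\<close>

lemma higher_deriv_zero_if_small:
  fixes G :: "complex \<Rightarrow> complex"
  assumes "G holomorphic_on ball 0 r" "0 < r" "\<And>w. w \<in> ball 0 r \<Longrightarrow> norm (G w) \<le> C * norm w ^ m" "k < m"
  shows "(deriv ^^ k) G 0 = 0"
proof -
  have "norm ((deriv ^^ k) G 0) \<le> fact k * (C * s ^ m) / s ^ k" if s: "0 < s" "s < r" for s
  proof (rule Cauchy_inequality)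
    have sub: "cball 0 s \<subseteq> ball (0::complex) r" using s by auto
    show "G holomorphic_on ball 0 s"
      using sub ball_subset_cball by (intro holomorphic_on_subset[OF assms(1)]) blast
    show "continuous_on (cball 0 s) G"
      using sub by (intro holomorphic_on_imp_continuous_on holomorphic_on_subset[OF assms(1)])
    show "cmod (G x) \<le> C * s ^ m" if "cmod (0 - x) = s" for x
      using assms(3)[of x] that s by simp
  qed (use s in auto)
  then have "norm ((deriv ^^ k) G 0) \<le> fact k * C * s ^ (m - k)" if "0 < s" "s < r" for s
    using that \<open>k < m\<close> by (simp add: power_diff field_simps)
  then have "eventually (\<lambda>s. norm ((deriv ^^ k) G 0) \<le> fact k * C * s ^ (m - k)) (at_right 0)"
    using \<open>0 < r\<close> eventually_at_right_field by blast
  moreover have "((\<lambda>s. fact k * C * s ^ (m - k)) \<longlongrightarrow> fact k * C * 0 ^ (m - k)) (at_right (0::real))"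
    by (intro tendsto_intros)
  ultimately have "norm ((deriv ^^ k) G 0) \<le> fact k * C * 0 ^ (m - k)"
    by (intro tendsto_lowerbound[OF _ _ trivial_limit_at_right_real])
  then show ?thesis using \<open>k < m\<close> by (simp add: power_0_left)
qed

text \<open>Splitting off m terms leaves w^m times a convergent series, which is bounded near 0. For
  m = 0 the statement is local boundedness, and it is also used in that form.\<close>

lemma has_fps_expansion_Taylor_bound:
  fixes f :: "complex \<Rightarrow> complex"
  assumes "f has_fps_expansion F"
  obtains C r where "0 < r" "0 \<le> C"
    "\<And>w. norm w < r \<Longrightarrow> norm (f w - (\<Sum>i<m. fps_nth F i * w ^ i)) \<le> C * norm w ^ m"
proof -
  define Q where "Q = fps_shift m F"
  have rad: "fps_conv_radius F > 0" and evF: "eventually (\<lambda>w. eval_fps F w = f w) (nhds 0)"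
    using assms by (auto simp: has_fps_expansion_def)
  have "fps_conv_radius Q > 0" using rad by (simp add: Q_def)
  then have Q: "eval_fps Q has_fps_expansion Q" by (rule eval_fps_has_fps_expansion)
  have F: "F = (\<Sum>i<m. fps_const (fps_nth F i) * fps_X ^ i) + fps_X ^ m * Q"
    by (rule fps_ext)
      (auto simp: Q_def fps_sum_nth fps_X_power_mult_nth fps_mult_left_const_nth
        fps_X_power_nth if_distrib[of "\<lambda>x. _ * x"] sum.delta cong: if_cong)
  have "(\<lambda>w. (\<Sum>i<m. fps_nth F i * w ^ i) + w ^ m * eval_fps Q w) has_fps_expansion
      (\<Sum>i<m. fps_const (fps_nth F i) * fps_X ^ i) + fps_X ^ m * Q"
    by (intro fps_expansion_intros Q)
  then have "eventually (\<lambda>w. eval_fps F w = (\<Sum>i<m. fps_nth F i * w ^ i) + w ^ m * eval_fps Q w) (nhds 0)"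
    unfolding F[symmetric] by (auto simp: has_fps_expansion_def)
  moreover have "isCont (eval_fps Q) 0"
    using has_fps_expansion_imp_continuous[OF Q] by simp
  then have "eventually (\<lambda>w. norm (eval_fps Q w) < norm (eval_fps Q 0) + 1) (at 0)"
    unfolding isCont_def by (intro order_tendstoD(2)[OF tendsto_norm]) auto
  then have "eventually (\<lambda>w. norm (eval_fps Q w) < norm (eval_fps Q 0) + 1) (nhds 0)"
    by (auto simp: eventually_at_filter elim: eventually_mono)
  ultimately have "eventually (\<lambda>w. norm (f w - (\<Sum>i<m. fps_nth F i * w ^ i)) \<le> (norm (eval_fps Q 0) + 1) * norm w ^ m) (nhds 0)"
    using evF
  proof eventually_elim
    case (elim w)
    then have "f w - (\<Sum>i<m. fps_nth F i * w ^ i) = w ^ m * eval_fps Q w" by simp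
    then show ?case using elim(2)
      by (simp add: norm_mult norm_power mult.commute mult_left_mono)
  qed
  then obtain r where "0 < r"
    "\<And>w. dist w 0 < r \<Longrightarrow> norm (f w - (\<Sum>i<m. fps_nth F i * w ^ i)) \<le> (norm (eval_fps Q 0) + 1) * norm w ^ m"
    unfolding eventually_nhds_metric by blast
  then show ?thesis
    using that[of r "norm (eval_fps Q 0) + 1"] by simp
qed

section \<open>Inverse functions depending on a parameter\<close>

lemma jhol_close_nbhd:
  fixes f :: "complex \<Rightarrow> 'p::metric_space \<Rightarrow> complex"
  assumes f: "jhol f R N0" "open N0" "\<mu>0 \<in> N0" "0 < R" "norm (f 0 \<mu>0 - c) < e"
  obtains r N where "0 < r" "r \<le> R" "open N" "\<mu>0 \<in> N" "N \<subseteq> N0"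
    "\<And>w \<mu>. w \<in> ball 0 r \<Longrightarrow> \<mu> \<in> N \<Longrightarrow> norm (f w \<mu> - c) < e"
proof -
  have "open (ball (0::complex) R \<times> N0)" using f(2) by (intro open_Times) auto
  moreover have "continuous_on (ball 0 R \<times> N0) (\<lambda>z. norm (f (fst z) (snd z) - c))"
    by (intro continuous_intros jhol_continuous[OF f(1)])
  ultimately have "open ((\<lambda>z. norm (f (fst z) (snd z) - c)) -` {..<e} \<inter> (ball 0 R \<times> N0))"
    by (intro continuous_on_open_vimage[THEN iffD1, rule_format]) auto
  moreover have "(0, \<mu>0) \<in> (\<lambda>z. norm (f (fst z) (snd z) - c)) -` {..<e} \<inter> (ball 0 R \<times> N0)"
    using f by simp
  ultimately obtain A B where AB: "open A" "open B" "(0, \<mu>0) \<in> A \<times> B"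
    "A \<times> B \<subseteq> (\<lambda>z. norm (f (fst z) (snd z) - c)) -` {..<e} \<inter> (ball 0 R \<times> N0)"
    by (rule open_prod_elim)
  obtain r where r: "0 < r" "ball 0 r \<subseteq> A" using AB(1,3) by (auto simp: open_contains_ball)
  show ?thesis
  proof (rule that[of "min r R" "B \<inter> N0"])
    fix w :: complex and \<mu> assume "w \<in> ball 0 (min r R)" "\<mu> \<in> B \<inter> N0"
    then have "(w, \<mu>) \<in> A \<times> B" using r(2) by auto
    then show "norm (f w \<mu> - c) < e" using AB(4) by auto
  qed (use r f AB in auto)
qed

text \<open>Where the derivative of F is within 1/2 of 1, w - F w is a contraction with constant
  1/2. Hence F is injective, shrinks distances at most by the factor 2, and attains every small
  value by Banach's fixed point theorem, with radii common to all parameters in N.\<close>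

lemma jhol_inverse:
  fixes F :: "complex \<Rightarrow> 'p::metric_space \<Rightarrow> complex"
  assumes F: "jhol F R N0" and N0: "open N0" "\<mu>0 \<in> N0" and R: "0 < R"
    and F0: "\<And>\<mu>. \<mu> \<in> N0 \<Longrightarrow> F 0 \<mu> = 0" and dF: "deriv (\<lambda>w. F w \<mu>0) 0 = 1"
  obtains r \<delta> N W where "0 < r" "r \<le> R" "0 < \<delta>" "open N" "\<mu>0 \<in> N" "N \<subseteq> N0" "jhol W \<delta> N"
    "\<And>\<mu> x. \<mu> \<in> N \<Longrightarrow> x \<in> ball 0 \<delta> \<Longrightarrow> W x \<mu> \<in> ball 0 r"
    "\<And>\<mu> x. \<mu> \<in> N \<Longrightarrow> x \<in> ball 0 \<delta> \<Longrightarrow> F (W x \<mu>) \<mu> = x"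
    "\<And>\<mu>. \<mu> \<in> N \<Longrightarrow> inj_on (\<lambda>w. F w \<mu>) (ball 0 r)"
proof -
  obtain r N where r: "0 < r" "r \<le> R" and N: "open N" "\<mu>0 \<in> N" "N \<subseteq> N0"
    and d: "\<And>w \<mu>. w \<in> ball 0 r \<Longrightarrow> \<mu> \<in> N \<Longrightarrow> norm (deriv (\<lambda>w. F w \<mu>) w - 1) < 1/2"
    by (rule jhol_close_nbhd[OF jhol_deriv[OF F] N0 R, of 1 "1/2"]) (use dF in auto)
  have Fr: "jhol F r N" by (rule jhol_subset[OF F r(2) N(3)])
  have contract: "norm ((w - F w \<mu>) - (w' - F w' \<mu>)) \<le> 1/2 * norm (w - w')"
    if "\<mu> \<in> N" "w \<in> ball 0 r" "w' \<in> ball 0 r" for \<mu> w w'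
  proof (rule field_differentiable_bound[OF convex_ball _ _ that(2,3)])
    fix z :: complex assume z: "z \<in> ball 0 r"
    show "((\<lambda>w. w - F w \<mu>) has_field_derivative 1 - deriv (\<lambda>w. F w \<mu>) z) (at z within ball 0 r)"
      using z by (intro derivative_intros DERIV_subset[OF holomorphic_derivI[OF jhol_holomorphic[OF Fr that(1)]]]) auto
    show "norm (1 - deriv (\<lambda>w. F w \<mu>) z) \<le> 1/2"
      using d[OF z that(1)] by (simp add: norm_minus_commute)
  qed
  have expand: "norm (w - w') \<le> 2 * norm (F w \<mu> - F w' \<mu>)"
    if "\<mu> \<in> N" "w \<in> ball 0 r" "w' \<in> ball 0 r" for \<mu> w w'
  proof -
    have "norm (w - w') \<le> norm ((w - F w \<mu>) - (w' - F w' \<mu>)) + norm (F w \<mu> - F w' \<mu>)"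
      by (rule order_trans[OF _ norm_triangle_ineq]) (simp add: algebra_simps)
    with contract[OF that] show ?thesis by simp
  qed
  have inj: "inj_on (\<lambda>w. F w \<mu>) (ball 0 r)" if "\<mu> \<in> N" for \<mu>
  proof (rule inj_onI)
    fix w w' assume "w \<in> ball 0 r" "w' \<in> ball 0 r" "F w \<mu> = F w' \<mu>"
    then show "w = w'" using expand[OF that, of w w'] by simp
  qed
  \<comment> \<open>The radius r / 4 makes w \<mapsto> x + (w - F w) a self-map of the closed disc
    of radius r / 2, since the contraction contributes at most r / 4.\<close>
  have ex: "\<exists>w\<in>ball 0 r. F w \<mu> = x" if \<mu>: "\<mu> \<in> N" and x: "norm x < r / 4" for \<mu> x
  proof -
    have sub: "cball (0::complex) (r / 2) \<subseteq> ball 0 r" using r by auto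
    have "\<exists>!w. w \<in> cball 0 (r / 2) \<and> x + (w - F w \<mu>) = w"
    proof (rule Banach_fix[where c = "1/2"])
      show "(\<lambda>w. x + (w - F w \<mu>)) ` cball 0 (r / 2) \<subseteq> cball 0 (r / 2)"
      proof clarify
        fix w :: complex assume w: "w \<in> cball 0 (r / 2)"
        have "norm (w - F w \<mu>) \<le> 1/2 * norm w"
          using contract[OF \<mu>, of w 0] w sub r F0 \<mu> N(3) by auto
        then have "norm (x + (w - F w \<mu>)) \<le> r / 4 + 1/2 * (r / 2)"
          using w x by (intro order_trans[OF norm_triangle_ineq] add_mono) auto
        then show "x + (w - F w \<mu>) \<in> cball 0 (r / 2)" by simp
      qed
      show "dist (x + (w - F w \<mu>)) (x + (w' - F w' \<mu>)) \<le> 1/2 * dist w w'"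
        if "w \<in> cball 0 (r / 2)" "w' \<in> cball 0 (r / 2)" for w w'
      proof -
        have "w \<in> ball 0 r" "w' \<in> ball 0 r" using that sub by blast+
        from contract[OF \<mu> this] show ?thesis by (simp add: dist_norm)
      qed
    qed (use r in \<open>simp_all add: complete_eq_closed\<close>)
    then obtain w where "w \<in> cball 0 (r / 2)" "x + (w - F w \<mu>) = w" by blast
    then show ?thesis using sub by (intro bexI[of _ w]) (auto simp: algebra_simps)
  qed
  define W where "W x \<mu> = (SOME w. w \<in> ball 0 r \<and> F w \<mu> = x)" for x \<mu>
  have W: "W x \<mu> \<in> ball 0 r" "F (W x \<mu>) \<mu> = x" if "\<mu> \<in> N" "x \<in> ball 0 (r / 4)" for x \<mu>
  proof -
    have "\<exists>w. w \<in> ball 0 r \<and> F w \<mu> = x" using ex[OF that(1), of x] that(2) by auto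
    from someI_ex[OF this] show "W x \<mu> \<in> ball 0 r" "F (W x \<mu>) \<mu> = x"
      unfolding W_def by blast+
  qed
  \<comment> \<open>By \<open>expand\<close>, the distance of \<open>W x \<mu>\<close> from w0 =
    \<open>W x0 \<mu>1\<close> is at most twice the distance of x from F w0 \<mu>, and that tends to
    0 because F w0 is continuous in the parameter.\<close>
  have cont: "continuous_on (ball 0 (r / 4) \<times> N) (\<lambda>z. W (fst z) (snd z))"
    unfolding continuous_on_def
  proof
    fix z0 assume "z0 \<in> ball (0::complex) (r / 4) \<times> N"
    then obtain x0 \<mu>1 where z0: "z0 = (x0, \<mu>1)" "x0 \<in> ball 0 (r / 4)" "\<mu>1 \<in> N" by auto
    let ?F = "at z0 within ball 0 (r / 4) \<times> N"
    define w0 where "w0 = W x0 \<mu>1"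
    have w0: "w0 \<in> ball 0 r" "F w0 \<mu>1 = x0" using W[OF z0(3,2)] by (auto simp: w0_def)
    have "continuous_on (ball 0 (r / 4) \<times> N) (\<lambda>z. F w0 (snd z))"
      by (rule continuous_on_compose2[OF jhol_continuous[OF Fr], of _ "\<lambda>z. (w0, snd z)", simplified])
        (use w0 in \<open>auto intro!: continuous_intros\<close>)
    then have "((\<lambda>z. F w0 (snd z)) \<longlongrightarrow> F w0 \<mu>1) ?F"
      using z0 unfolding continuous_on_def by force
    moreover have "((\<lambda>z. fst z) \<longlongrightarrow> x0) ?F"
      using tendsto_fst[OF tendsto_ident_at, of z0 "ball 0 (r / 4) \<times> N"] by (simp add: z0)
    ultimately have "((\<lambda>z. 2 * norm (fst z - F w0 (snd z))) \<longlongrightarrow> 2 * norm (x0 - F w0 \<mu>1)) ?F"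
      by (intro tendsto_intros)
    then have lim: "((\<lambda>z. 2 * norm (fst z - F w0 (snd z))) \<longlongrightarrow> 0) ?F" by (simp add: w0)
    have "((\<lambda>z. W (fst z) (snd z) - w0) \<longlongrightarrow> 0) ?F"
    proof (rule Lim_null_comparison[OF _ lim])
      show "eventually (\<lambda>z. norm (W (fst z) (snd z) - w0) \<le> 2 * norm (fst z - F w0 (snd z))) ?F"
        unfolding eventually_at_filter
      proof (intro always_eventually allI impI)
        fix z :: "complex \<times> 'p" assume "z \<in> ball 0 (r / 4) \<times> N"
        then have z: "snd z \<in> N" "fst z \<in> ball 0 (r / 4)" by auto
        then show "norm (W (fst z) (snd z) - w0) \<le> 2 * norm (fst z - F w0 (snd z))"
          using expand[OF z(1) W(1)[OF z] w0(1)] W(2)[OF z] by simp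
      qed
    qed
    then show "((\<lambda>z. W (fst z) (snd z)) \<longlongrightarrow> W (fst z0) (snd z0)) ?F"
      by (simp add: z0 w0_def[symmetric] LIM_zero_iff)
  qed
  have "jhol W (r / 4) N"
  proof (rule jholI[OF cont])
    fix \<mu> assume \<mu>: "\<mu> \<in> N"
    show "(\<lambda>x. W x \<mu>) holomorphic_on ball 0 (r / 4)"
      unfolding holomorphic_on_open[OF open_ball]
    proof (intro ballI exI)
      fix x :: complex assume x: "x \<in> ball 0 (r / 4)"
      have "continuous_on (ball 0 (r / 4)) (\<lambda>x. W x \<mu>)"
        by (rule continuous_on_compose2[OF cont, of _ "\<lambda>x. (x, \<mu>)", simplified])
          (use \<mu> in \<open>auto intro!: continuous_intros\<close>)
      then have "isCont (\<lambda>x. W x \<mu>) x"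
        using x continuous_on_eq_continuous_at open_ball by blast
      moreover have "((\<lambda>w. F w \<mu>) has_field_derivative deriv (\<lambda>w. F w \<mu>) (W x \<mu>)) (at (W x \<mu>))"
        using W(1)[OF \<mu> x] by (intro holomorphic_derivI[OF jhol_holomorphic[OF Fr \<mu>]]) auto
      moreover have "deriv (\<lambda>w. F w \<mu>) (W x \<mu>) \<noteq> 0"
        using d[OF W(1)[OF \<mu> x] \<mu>] by auto
      ultimately show "((\<lambda>x. W x \<mu>) has_field_derivative inverse (deriv (\<lambda>w. F w \<mu>) (W x \<mu>))) (at x)"
        using W(2)[OF \<mu>] x by (intro has_field_derivative_inverse_basic[where t = "ball 0 (r / 4)"]) auto
    qed
  qed
  then show ?thesis
    by (intro that[of r "r / 4" N W] r N W inj) (use r in simp_all)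
qed

text \<open>The normalization Y = 1 at 0 gives w sqrt(Y w) the derivative 1 there, and staying
  within distance 1 of the value 1 keeps Y off the cut of \<open>csqrt\<close>.\<close>

lemma sqrt_branch_inverse:
  fixes Y :: "complex \<Rightarrow> 'p::metric_space \<Rightarrow> complex"
  assumes Y: "\<And>r. jhol Y r UNIV" and Y0: "\<And>\<mu>. Y 0 \<mu> = 1"
  obtains r \<delta> N W where "0 < r" "0 < \<delta>" "open N" "\<mu>0 \<in> N" "jhol W \<delta> N"
    "\<And>\<mu> x. \<mu> \<in> N \<Longrightarrow> x \<in> ball 0 \<delta> \<Longrightarrow> W x \<mu> \<in> ball 0 r"
    "\<And>\<mu> x. \<mu> \<in> N \<Longrightarrow> x \<in> ball 0 \<delta> \<Longrightarrow> W x \<mu> * csqrt (Y (W x \<mu>) \<mu>) = x"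
    "\<And>\<mu> w. \<mu> \<in> N \<Longrightarrow> w \<in> ball 0 r \<Longrightarrow> 0 < Re (Y w \<mu>)"
    "\<And>\<mu>. \<mu> \<in> N \<Longrightarrow> inj_on (\<lambda>w. w * csqrt (Y w \<mu>)) (ball 0 r)"
proof -
  obtain R N0 where R: "0 < R" and N0: "open N0" "\<mu>0 \<in> N0"
    and d: "\<And>w \<mu>. w \<in> ball 0 R \<Longrightarrow> \<mu> \<in> N0 \<Longrightarrow> norm (Y w \<mu> - 1) < 1"
    by (rule jhol_close_nbhd[OF Y[of 1] open_UNIV UNIV_I zero_less_one, of \<mu>0 1 1]) (auto simp: Y0)
  have Re: "0 < Re (Y w \<mu>)" if "w \<in> ball 0 R" "\<mu> \<in> N0" for w \<mu>
    using d[OF that] abs_Re_le_cmod[of "Y w \<mu> - 1"] by auto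
  then have slit: "Y w \<mu> \<notin> \<real>\<^sub>\<le>\<^sub>0" if "w \<in> ball 0 R" "\<mu> \<in> N0" for w \<mu>
    using that by (fastforce simp: complex_nonpos_Reals_iff)
  have YR: "jhol Y R N0" by (rule jhol_subset[OF Y]) auto
  have S: "jhol (\<lambda>w \<mu>. csqrt (Y w \<mu>)) R N0"
  proof (rule jholI)
    show "continuous_on (ball 0 R \<times> N0) (\<lambda>z. csqrt (Y (fst z) (snd z)))"
      by (rule continuous_on_compose2[OF continuous_on_csqrt jhol_continuous[OF YR]]) (use slit in auto)
    show "(\<lambda>w. csqrt (Y w \<mu>)) holomorphic_on ball 0 R" if "\<mu> \<in> N0" for \<mu>
      using slit that by (intro holomorphic_intros jhol_holomorphic[OF YR]) auto
  qed
  have F: "jhol (\<lambda>w \<mu>. w * csqrt (Y w \<mu>)) R N0"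
    by (rule jhol_mult[OF _ S]) (rule jholI; intro continuous_intros holomorphic_intros)
  have "((\<lambda>w. w * csqrt (Y w \<mu>0)) has_field_derivative 1) (at 0)"
  proof -
    have "((\<lambda>w. csqrt (Y w \<mu>0)) has_field_derivative deriv (\<lambda>w. csqrt (Y w \<mu>0)) 0) (at 0)"
      by (rule holomorphic_derivI[OF jhol_holomorphic[OF S N0(2)]]) (use R in auto)
    from DERIV_mult[OF DERIV_ident this] show ?thesis by (simp add: Y0)
  qed
  then have dF: "deriv (\<lambda>w. w * csqrt (Y w \<mu>0)) 0 = 1" by (rule DERIV_imp_deriv)
  show ?thesis
  proof (rule jhol_inverse[OF F N0 R _ dF])
    fix r \<delta> N W
    assume *: "0 < r" "r \<le> R" "0 < \<delta>" "open N" "\<mu>0 \<in> N" "N \<subseteq> N0" "jhol W \<delta> N"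
      "\<And>\<mu> x. \<mu> \<in> N \<Longrightarrow> x \<in> ball 0 \<delta> \<Longrightarrow> W x \<mu> \<in> ball 0 r"
      "\<And>\<mu> x. \<mu> \<in> N \<Longrightarrow> x \<in> ball 0 \<delta> \<Longrightarrow> W x \<mu> * csqrt (Y (W x \<mu>) \<mu>) = x"
      "\<And>\<mu>. \<mu> \<in> N \<Longrightarrow> inj_on (\<lambda>w. w * csqrt (Y w \<mu>)) (ball 0 r)"
    then show ?thesis
      using that[of r \<delta> N W] Re[OF subsetD[OF subset_ball[OF *(2)]] subsetD[OF *(6)]] by blast
  qed simp
qed

text \<open>As W inverts F w = w sqrt(Y w), the function W' (h o W), composed with F and multiplied
  by F', equals h near 0. On power series this is the hypothesis of
  \<open>fps_lagrange_inversion\<close>, with S the series of sqrt Y.\<close>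

lemma sqrt_branch_inverse_fps:
  fixes Y W h :: "complex \<Rightarrow> complex"
  assumes Y: "Y holomorphic_on ball 0 r" "Y 0 = 1" and r: "0 < r"
    and W: "W holomorphic_on ball 0 \<delta>" "0 < \<delta>" "\<And>x. x \<in> ball 0 \<delta> \<Longrightarrow> W x \<in> ball 0 r"
      "\<And>x. x \<in> ball 0 \<delta> \<Longrightarrow> W x * csqrt (Y (W x)) = x"
    and Re: "\<And>w. w \<in> ball 0 r \<Longrightarrow> 0 < Re (Y w)"
    and inj: "inj_on (\<lambda>w. w * csqrt (Y w)) (ball 0 r)"
    and h: "h holomorphic_on ball 0 r"
  obtains G S where "(\<lambda>x. deriv W x * h (W x)) has_fps_expansion G" "fps_nth S 0 = 1"
    "Y has_fps_expansion S ^ 2"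
    "(G oo (fps_X * S)) * fps_deriv (fps_X * S) = fps_expansion h 0"
proof -
  define s where "s = (\<lambda>w. csqrt (Y w))"
  define F where "F = (\<lambda>w. w * s w)"
  have slit: "Y w \<notin> \<real>\<^sub>\<le>\<^sub>0" if "w \<in> ball 0 r" for w
    using Re[OF that] by (auto simp: complex_nonpos_Reals_iff)
  have s: "s holomorphic_on ball 0 r"
    unfolding s_def using slit by (intro holomorphic_intros Y) auto
  have Fh: "F holomorphic_on ball 0 r"
    unfolding F_def by (intro holomorphic_intros s)
  define S where "S = fps_expansion s 0"
  define g where "g = (\<lambda>x. deriv W x * h (W x))"
  define G where "G = fps_expansion g 0"
  have "(h \<circ> W) holomorphic_on ball 0 \<delta>"
    by (rule holomorphic_on_compose_gen[OF W(1) h]) (use W(3) in blast)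
  then have g: "g holomorphic_on ball 0 \<delta>"
    unfolding g_def o_def by (intro holomorphic_intros holomorphic_deriv W(1)) auto
  have S: "s has_fps_expansion S"
    unfolding S_def by (rule has_fps_expansion_fps_expansion[OF open_ball _ s]) (use r in auto)
  have G: "g has_fps_expansion G"
    unfolding G_def by (rule has_fps_expansion_fps_expansion[OF open_ball _ g]) (use W(2) in auto)
  have F: "F has_fps_expansion fps_X * S"
    unfolding F_def by (intro fps_expansion_intros S)
  have "(\<lambda>w. s w ^ 2) has_fps_expansion S ^ 2"
    by (intro fps_expansion_intros S)
  then have YS: "Y has_fps_expansion S ^ 2"
    by (simp add: s_def)
  have S0: "fps_nth S 0 = 1"
    using has_fps_expansion_imp_0_eq_fps_nth_0[OF S] Y(2) by (simp add: s_def)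
  have exp: "(\<lambda>w. (g \<circ> F) w * deriv F w) has_fps_expansion (G oo (fps_X * S)) * fps_deriv (fps_X * S)"
    by (intro fps_expansion_intros G F) simp
  have ev: "eventually (\<lambda>w. (g \<circ> F) w * deriv F w = h w) (nhds 0)"
  proof -
    have "isCont F 0"
      using Fh r by (metis centre_in_ball continuous_on_eq_continuous_at holomorphic_on_imp_continuous_on open_ball)
    moreover have F0: "F 0 = 0" by (simp add: F_def)
    ultimately have "(F \<longlongrightarrow> 0) (at 0)"
      by (simp add: isCont_def)
    then have "eventually (\<lambda>w. F w \<in> ball 0 \<delta>) (at 0)"
      using W(2) by (intro topological_tendstoD) auto
    then have "eventually (\<lambda>w. F w \<in> ball 0 \<delta>) (nhds 0)"
      using W(2) F0 by (simp add: eventually_nhds_conv_at)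
    moreover have "eventually (\<lambda>w. w \<in> ball 0 r) (nhds 0)"
      using r by (intro eventually_nhds_in_open) auto
    ultimately show ?thesis
    proof eventually_elim
      case (elim w)
      have WF: "W (F w) = w"
        using inj_onD[OF inj, of "W (F w)" w] W(3,4)[OF elim(1)] elim(2) by (simp add: F_def s_def)
      have W': "(W has_field_derivative deriv W (F w)) (at (F w))"
        by (rule holomorphic_derivI[OF W(1) _ elim(1)]) simp
      have F': "(F has_field_derivative deriv F (W (F w))) (at (W (F w)))"
        by (rule holomorphic_derivI[OF Fh]) (use WF elim(2) in auto)
      have "((\<lambda>x. F (W x)) has_field_derivative deriv F (W (F w)) * deriv W (F w)) (at (F w))"
        by (rule DERIV_chain2[OF F' W'])
      moreover have "((\<lambda>x. F (W x)) has_field_derivative 1) (at (F w))"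
        by (rule has_field_derivative_transform_within_open[OF DERIV_ident open_ball elim(1)])
          (use W(4) in \<open>simp add: F_def s_def\<close>)
      ultimately have "deriv F w * deriv W (F w) = 1"
        using DERIV_unique WF by fastforce
      then show ?case by (simp add: g_def WF mult_ac)
    qed
  qed
  have "h has_fps_expansion (G oo (fps_X * S)) * fps_deriv (fps_X * S)"
    by (rule has_fps_expansion_cong[THEN iffD1, OF ev refl exp])
  then have "(G oo (fps_X * S)) * fps_deriv (fps_X * S) = fps_expansion h 0"
    by (simp add: fps_expansion_eqI)
  with G S0 YS show ?thesis using that unfolding g_def by blast
qed

text \<open>The conjugate of w has the same real image as w, so injectivity identifies the
  two.\<close>

lemma real_inverse_branch:
  assumes "inj_on (\<lambda>w. w * csqrt (Y w)) (ball 0 r)" "w \<in> ball 0 r" "0 < Re (Y w)"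
    and "w * csqrt (Y w) \<in> \<real>" "Y (cnj w) = cnj (Y w)"
  shows "w \<in> \<real>"
proof -
  have "Y w \<notin> \<real>\<^sub>\<le>\<^sub>0" using assms(3) by (auto simp: complex_nonpos_Reals_iff)
  then have "cnj w * csqrt (Y (cnj w)) = cnj (w * csqrt (Y w))"
    by (simp add: assms(5) cnj_csqrt)
  also have "\<dots> = w * csqrt (Y w)"
    using assms(4) Reals_cnj_iff by blast
  finally have "cnj w = w"
    using inj_onD[OF assms(1), of "cnj w" w] assms(2) by simp
  then show ?thesis by (simp add: Reals_cnj_iff)
qed

subsection \<open>The two square-root branches\<close>

type_synonym coeffs = "real \<times> real \<times> real \<times> real"

text \<open>The entire function (e^z - 1 - z) / z^2. Writing Y2 with it avoids divisions by q and by
  the exponents 1 - 2 n and -2 n, so one formula covers q = 0, n = 0 and n = 1/2.\<close>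

definition exp_rem :: "complex \<Rightarrow> complex" where
  "exp_rem = eval_fps (fps_shift 2 (fps_exp 1))"

lemma exp_rem_fps: "exp_rem has_fps_expansion fps_shift 2 (fps_exp 1)"
  unfolding exp_rem_def by (rule eval_fps_has_fps_expansion) simp

lemma exp_rem_holomorphic: "exp_rem holomorphic_on A"
  unfolding exp_rem_def by (rule holomorphic_on_eval_fps) (simp add: eball_def)

lemma exp_rem_eq: "z ^ 2 * exp_rem z = exp z - 1 - z"
proof -
  have "(\<lambda>k. fps_nth (fps_shift 2 (fps_exp 1)) k * z ^ k) sums exp_rem z"
    unfolding exp_rem_def by (rule sums_eval_fps) simp
  from sums_mult[OF this, of "z ^ 2"]
  have "(\<lambda>k. z ^ (k + 2) /\<^sub>R fact (k + 2)) sums (z ^ 2 * exp_rem z)"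
    by (rule sums_cong[THEN iffD1, rotated])
      (simp add: power_add scaleR_conv_of_real divide_inverse mult_ac del: fact_Suc add_2_eq_Suc')
  moreover have "(\<lambda>k. z ^ (k + 2) /\<^sub>R fact (k + 2)) sums (exp z - (\<Sum>k<2. z ^ k /\<^sub>R fact k))"
    by (rule sums_split_initial_segment[OF exp_converges])
  ultimately show ?thesis
    by (simp add: sums_iff numeral_2_eq_2)
qed

lemma exp_rem_0: "exp_rem 0 = 1/2"
  unfolding exp_rem_def by (simp add: eval_fps_at_0 fact_numeral)

lemma continuous_on_exp_rem [continuous_intros]:
  "continuous_on A f \<Longrightarrow> continuous_on A (\<lambda>x. exp_rem (f x))"
  by (rule continuous_on_compose2[OF holomorphic_on_imp_continuous_on[OF exp_rem_holomorphic, of UNIV]]) auto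

lemma exp_rem_cnj: "exp_rem (cnj z) = cnj (exp_rem z)"
proof (cases "z = 0")
  case False
  have "exp_rem z = (exp z - 1 - z) / z ^ 2" "exp_rem (cnj z) = (exp (cnj z) - 1 - cnj z) / cnj z ^ 2"
    using exp_rem_eq[of z] exp_rem_eq[of "cnj z"] False by (simp_all add: field_simps)
  then show ?thesis by (simp add: exp_cnj)
qed (simp add: exp_rem_0)

definition Y1 :: "complex \<Rightarrow> coeffs \<Rightarrow> complex" where
  "Y1 w \<mu> = 1 - of_real (fst \<mu>) * w - of_real (fst (snd \<mu>)) * w ^ 2 - of_real (fst (snd (snd \<mu>))) * w ^ 3"

definition nu :: "coeffs \<Rightarrow> real" where "nu \<mu> = snd (snd (snd \<mu>))"

definition Y2 :: "complex \<Rightarrow> coeffs \<Rightarrow> complex" where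
  "Y2 w \<mu> = 2 * (of_real (1 - 2 * nu \<mu>) * exp_rem (of_real (1 - 2 * nu \<mu>) * w)
     - of_real (- 2 * nu \<mu>) * exp_rem (of_real (- 2 * nu \<mu>) * w))"

lemma continuous_on_nu [continuous_intros]:
  "continuous_on A f \<Longrightarrow> continuous_on A (\<lambda>x. nu (f x))"
  unfolding nu_def by (intro continuous_intros)

lemma jhol_Y1: "jhol Y1 r N"
  unfolding Y1_def by (rule jholI) (intro continuous_intros holomorphic_intros)+

lemma jhol_Y2: "jhol Y2 r N"
proof (rule jholI)
  show "continuous_on (ball 0 r \<times> N) (\<lambda>z. Y2 (fst z) (snd z))"
    unfolding Y2_def by (intro continuous_intros)
  have "(\<lambda>w. exp_rem (c * w)) holomorphic_on ball 0 r" for c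
    using holomorphic_on_compose[of "\<lambda>w. c * w" "ball 0 r" exp_rem]
    by (simp add: o_def exp_rem_holomorphic holomorphic_intros)
  then show "(\<lambda>w. Y2 w \<mu>) holomorphic_on ball 0 r" for \<mu>
    unfolding Y2_def by (intro holomorphic_intros)
qed

lemma Y1_0: "Y1 0 \<mu> = 1" and Y2_0: "Y2 0 \<mu> = 1"
  by (simp_all add: Y1_def Y2_def exp_rem_0 field_simps)

lemma Y1_cnj: "Y1 (cnj w) \<mu> = cnj (Y1 w \<mu>)" and Y2_cnj: "Y2 (cnj w) \<mu> = cnj (Y2 w \<mu>)"
  by (simp_all add: Y1_def Y2_def flip: exp_rem_cnj)

lemma exp_rem_scaled_deriv:
  "((\<lambda>w. s * (w ^ 2 * exp_rem (s * w))) has_field_derivative exp (s * w) - 1) (at w)"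
proof (cases "s = 0")
  case False
  have "(\<lambda>w. s * (w ^ 2 * exp_rem (s * w))) = (\<lambda>w. (exp (s * w) - 1 - s * w) / s)"
    using False by (simp add: fun_eq_iff exp_rem_eq[symmetric] power2_eq_square)
  then show ?thesis
    by (auto intro!: derivative_eq_intros simp: False field_simps)
qed simp

lemma Y2_deriv:
  "((\<lambda>w. w ^ 2 * Y2 w \<mu>) has_field_derivative 2 * ((exp w - 1) * exp (of_real (- 2 * nu \<mu>) * w))) (at w)"
proof -
  have "((\<lambda>w. 2 * (of_real (1 - 2 * nu \<mu>) * (w ^ 2 * exp_rem (of_real (1 - 2 * nu \<mu>) * w))
      - of_real (- 2 * nu \<mu>) * (w ^ 2 * exp_rem (of_real (- 2 * nu \<mu>) * w)))) has_field_derivative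
      2 * ((exp (of_real (1 - 2 * nu \<mu>) * w) - 1) - (exp (of_real (- 2 * nu \<mu>) * w) - 1))) (at w)"
    by (intro DERIV_cmult DERIV_diff exp_rem_scaled_deriv)
  moreover have "exp (of_real (1 - 2 * nu \<mu>) * w) = exp w * exp (of_real (- 2 * nu \<mu>) * w)"
    by (simp add: algebra_simps flip: exp_add)
  moreover have "(\<lambda>w. w ^ 2 * Y2 w \<mu>) = (\<lambda>w. 2 * (of_real (1 - 2 * nu \<mu>) * (w ^ 2 * exp_rem (of_real (1 - 2 * nu \<mu>) * w))
      - of_real (- 2 * nu \<mu>) * (w ^ 2 * exp_rem (of_real (- 2 * nu \<mu>) * w))))"
    unfolding Y2_def by (simp only: algebra_simps)
  ultimately show ?thesis
    by (simp only:) (erule DERIV_cong, simp only: algebra_simps, simp)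
qed

lemma Y1_deriv:
  "((\<lambda>w. w ^ 2 * Y1 w (a, b, c, n)) has_field_derivative
     2 * (w - 3/2 * of_real a * w ^ 2 - 2 * of_real b * w ^ 3 - 5/2 * of_real c * w ^ 4)) (at w)"
  unfolding Y1_def by (auto intro!: derivative_eq_intros) (simp add: algebra_simps power2_eq_square power3_eq_cube power4_eq_xxxx)

lemma Y1_fps: "(\<lambda>w. Y1 w (a, b, c, n)) has_fps_expansion
    1 - fps_const (of_real a) * fps_X - fps_const (of_real b) * fps_X ^ 2 - fps_const (of_real c) * fps_X ^ 3"
  unfolding Y1_def fst_conv snd_conv by (intro fps_expansion_intros)

lemma Y2_fps:
  assumes "(\<lambda>w. Y2 w (a, b, c, n)) has_fps_expansion F"
  shows "fps_nth F l = of_real (2 * ((1 - 2 * n) ^ Suc l - (- 2 * n) ^ Suc l) / fact (l + 2))"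
proof -
  have comp: "(\<lambda>w. exp_rem (s * w)) has_fps_expansion (fps_shift 2 (fps_exp 1) oo (fps_const s * fps_X))" for s
  proof -
    have "(exp_rem \<circ> (\<lambda>w. s * w)) has_fps_expansion (fps_shift 2 (fps_exp 1) oo (fps_const s * fps_X))"
      by (intro has_fps_expansion_compose exp_rem_fps fps_expansion_intros) simp
    then show ?thesis by (simp add: o_def)
  qed
  have "(\<lambda>w. Y2 w (a, b, c, n)) has_fps_expansion
      fps_const 2 * (fps_const (of_real (1 - 2 * n)) * (fps_shift 2 (fps_exp 1) oo (fps_const (of_real (1 - 2 * n)) * fps_X))
      - fps_const (of_real (- 2 * n)) * (fps_shift 2 (fps_exp 1) oo (fps_const (of_real (- 2 * n)) * fps_X)))"
    unfolding Y2_def nu_def snd_conv by (intro fps_expansion_intros comp)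
  from fps_expansion_unique_complex[OF assms this] show ?thesis
    by (simp only: fps_compose_linear fps_mult_left_const_nth fps_sub_nth fps_nth_Abs_fps fps_shift_nth fps_exp_nth)
      (simp add: right_diff_distrib diff_divide_distrib add_divide_distrib del: fact_Suc)
qed

text \<open>The local data near a parameter: q and U invert q sqrt(Y2(q)) and u sqrt(Y1(u)) on the
  disc of radius \<delta>, uniformly for parameters in N, and \<epsilon> limits the real v for which
  q returns v from v sqrt(Y2(v)). The bounds 1/2 make the derivatives positive on the real axis;
  \<open>exp_close\<close> gives |e^(n q)| < 2, which keeps the argument of U' inside the
  disc.\<close>

locale branches =
  fixes N :: "coeffs set" and \<delta> \<epsilon> :: real and q U :: "complex \<Rightarrow> coeffs \<Rightarrow> complex"
  assumes N_open: "open N" and \<delta>_pos: "0 < \<delta>" and \<epsilon>_pos: "0 < \<epsilon>"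
    and q_jhol: "jhol q \<delta> N" and U_jhol: "jhol U \<delta> N"
    and q_deriv_close: "\<And>x \<mu>. x \<in> ball 0 \<delta> \<Longrightarrow> \<mu> \<in> N \<Longrightarrow> norm (deriv (\<lambda>x. q x \<mu>) x - 1) < 1/2"
    and U_deriv_close: "\<And>x \<mu>. x \<in> ball 0 \<delta> \<Longrightarrow> \<mu> \<in> N \<Longrightarrow> norm (deriv (\<lambda>x. U x \<mu>) x - 1) < 1/2"
    and exp_close: "\<And>x \<mu>. x \<in> ball 0 \<delta> \<Longrightarrow> \<mu> \<in> N \<Longrightarrow> norm (exp (of_real (nu \<mu>) * q x \<mu>) - 1) < 1"
    and q_eq: "\<And>x \<mu>. x \<in> ball 0 \<delta> \<Longrightarrow> \<mu> \<in> N \<Longrightarrow> q x \<mu> ^ 2 * Y2 (q x \<mu>) \<mu> = x ^ 2"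
    and U_eq: "\<And>x \<mu>. x \<in> ball 0 \<delta> \<Longrightarrow> \<mu> \<in> N \<Longrightarrow> U x \<mu> ^ 2 * Y1 (U x \<mu>) \<mu> = x ^ 2"
    and q_real: "\<And>x \<mu>. x \<in> ball 0 \<delta> \<Longrightarrow> x \<in> \<real> \<Longrightarrow> \<mu> \<in> N \<Longrightarrow> q x \<mu> \<in> \<real>"
    and U_real: "\<And>x \<mu>. x \<in> ball 0 \<delta> \<Longrightarrow> x \<in> \<real> \<Longrightarrow> \<mu> \<in> N \<Longrightarrow> U x \<mu> \<in> \<real>"
    and U_0: "\<And>\<mu>. \<mu> \<in> N \<Longrightarrow> U 0 \<mu> = 0"
    and Y2_pos: "\<And>v \<mu>. \<bar>v\<bar> < \<epsilon> \<Longrightarrow> \<mu> \<in> N \<Longrightarrow> 0 < Re (Y2 (of_real v) \<mu>)"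
    and q_dom: "\<And>v \<mu>. \<bar>v\<bar> < \<epsilon> \<Longrightarrow> \<mu> \<in> N \<Longrightarrow> \<bar>v * sqrt (Re (Y2 (of_real v) \<mu>))\<bar> < \<delta>"
    and q_inverse: "\<And>v \<mu>. \<bar>v\<bar> < \<epsilon> \<Longrightarrow> \<mu> \<in> N \<Longrightarrow> q (of_real (v * sqrt (Re (Y2 (of_real v) \<mu>)))) \<mu> = of_real v"
    and q_fps: "\<And>a b c n j. (a, b, c, n) \<in> N \<Longrightarrow>
      \<exists>G. (\<lambda>x. deriv (\<lambda>x. q x (a, b, c, n)) x * exp (of_real (1 - n + 2 * real j * n) * q x (a, b, c, n)))
        has_fps_expansion G \<and> (\<forall>i. j + i \<le> 4 \<longrightarrow> fps_nth G (2 * i) = of_real (J_coeff j i n))"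
    and U_fps: "\<And>a b c n. (a, b, c, n) \<in> N \<Longrightarrow>
      \<exists>G. (\<lambda>r. deriv (\<lambda>r. U r (a, b, c, n)) r) has_fps_expansion G \<and>
        (\<forall>j\<le>4. fps_nth G (2 * j) = of_real (U_coeff j a b c))"

lemma branches_exist:
  fixes \<mu>0 :: coeffs
  obtains N \<delta> \<epsilon> q U where "branches N \<delta> \<epsilon> q U" "\<mu>0 \<in> N"
proof -
  obtain r1 d1 N1 U where U: "0 < r1" "0 < d1" "open N1" "\<mu>0 \<in> N1" "jhol U d1 N1"
    "\<And>\<mu> x. \<mu> \<in> N1 \<Longrightarrow> x \<in> ball 0 d1 \<Longrightarrow> U x \<mu> \<in> ball 0 r1"
    "\<And>\<mu> x. \<mu> \<in> N1 \<Longrightarrow> x \<in> ball 0 d1 \<Longrightarrow> U x \<mu> * csqrt (Y1 (U x \<mu>) \<mu>) = x"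
    "\<And>\<mu> w. \<mu> \<in> N1 \<Longrightarrow> w \<in> ball 0 r1 \<Longrightarrow> 0 < Re (Y1 w \<mu>)"
    "\<And>\<mu>. \<mu> \<in> N1 \<Longrightarrow> inj_on (\<lambda>w. w * csqrt (Y1 w \<mu>)) (ball 0 r1)"
    by (rule sqrt_branch_inverse[OF jhol_Y1 Y1_0, of \<mu>0]) blast
  obtain r2 d2 N2 q where q: "0 < r2" "0 < d2" "open N2" "\<mu>0 \<in> N2" "jhol q d2 N2"
    "\<And>\<mu> x. \<mu> \<in> N2 \<Longrightarrow> x \<in> ball 0 d2 \<Longrightarrow> q x \<mu> \<in> ball 0 r2"
    "\<And>\<mu> x. \<mu> \<in> N2 \<Longrightarrow> x \<in> ball 0 d2 \<Longrightarrow> q x \<mu> * csqrt (Y2 (q x \<mu>) \<mu>) = x"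
    "\<And>\<mu> w. \<mu> \<in> N2 \<Longrightarrow> w \<in> ball 0 r2 \<Longrightarrow> 0 < Re (Y2 w \<mu>)"
    "\<And>\<mu>. \<mu> \<in> N2 \<Longrightarrow> inj_on (\<lambda>w. w * csqrt (Y2 w \<mu>)) (ball 0 r2)"
    by (rule sqrt_branch_inverse[OF jhol_Y2 Y2_0, of \<mu>0]) blast
  have U0: "U 0 \<mu> = 0" if "\<mu> \<in> N1" for \<mu>
    using U(7)[OF that, of 0] U(8)[OF that U(6)[OF that, of 0]] U(2) by auto
  have q0: "q 0 \<mu> = 0" if "\<mu> \<in> N2" for \<mu>
    using q(7)[OF that, of 0] q(8)[OF that q(6)[OF that, of 0]] q(2) by auto
  have q_fps: "\<exists>G. (\<lambda>x. deriv (\<lambda>x. q x (a, b, c, n)) x * exp (of_real (1 - n + 2 * real j * n) * q x (a, b, c, n)))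
        has_fps_expansion G \<and> (\<forall>i. j + i \<le> 4 \<longrightarrow> fps_nth G (2 * i) = of_real (J_coeff j i n))"
    if N: "(a, b, c, n) \<in> N2" for a b c n j
  proof -
    let ?h = "\<lambda>w. exp (complex_of_real (1 - n + 2 * real j * n) * w)"
    have "?h holomorphic_on ball 0 r2" by (intro holomorphic_intros)
    from sqrt_branch_inverse_fps[OF jhol_holomorphic[OF jhol_Y2[of r2 UNIV] UNIV_I, where \<mu> = "(a, b, c, n)"] Y2_0 q(1)
        jhol_holomorphic[OF q(5) N] q(2) q(6)[OF N] q(7)[OF N] q(8)[OF N] q(9)[OF N] this]
    obtain G S where GS: "(\<lambda>x. deriv (\<lambda>x. q x (a, b, c, n)) x * ?h (q x (a, b, c, n))) has_fps_expansion G"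
      "fps_nth S 0 = 1" "(\<lambda>w. Y2 w (a, b, c, n)) has_fps_expansion S ^ 2"
      "(G oo (fps_X * S)) * fps_deriv (fps_X * S) = fps_expansion ?h 0"
      by blast
    have "?h has_fps_expansion fps_exp (of_real (1 - n + 2 * real j * n))"
      by (rule has_fps_expansion_exp)
    then have h: "fps_expansion ?h 0 = fps_exp (of_real (1 - n + 2 * real j * n))"
      by (rule fps_expansion_eqI)
    have "fps_nth G (2 * i) = of_real (J_coeff j i n)" if "j + i \<le> 4" for i
      by (rule J_coeff_fps[OF GS(2) Y2_fps[OF GS(3)] _ that]) (simp only: GS(4) h)
    then show ?thesis by (intro exI[of _ G] conjI GS(1) allI impI)
  qed
  have U_fps: "\<exists>G. (\<lambda>r. deriv (\<lambda>r. U r (a, b, c, n)) r) has_fps_expansion G \<and>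
        (\<forall>j\<le>4. fps_nth G (2 * j) = of_real (U_coeff j a b c))"
    if N: "(a, b, c, n) \<in> N1" for a b c n
  proof -
    have "(\<lambda>w. 1 :: complex) holomorphic_on ball 0 r1" by (intro holomorphic_intros)
    from sqrt_branch_inverse_fps[OF jhol_holomorphic[OF jhol_Y1[of r1 UNIV] UNIV_I, where \<mu> = "(a, b, c, n)"] Y1_0 U(1)
        jhol_holomorphic[OF U(5) N] U(2) U(6)[OF N] U(7)[OF N] U(8)[OF N] U(9)[OF N] this]
    obtain G S where GS: "(\<lambda>x. deriv (\<lambda>x. U x (a, b, c, n)) x * 1) has_fps_expansion G"
      "fps_nth S 0 = 1" "(\<lambda>w. Y1 w (a, b, c, n)) has_fps_expansion S ^ 2"
      "(G oo (fps_X * S)) * fps_deriv (fps_X * S) = fps_expansion (\<lambda>w. 1) 0"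
      by blast
    have h: "fps_expansion (\<lambda>w. 1 :: complex) 0 = 1"
      by (rule fps_expansion_eqI) (rule has_fps_expansion_1)
    have "fps_nth G (2 * j) = of_real (U_coeff j a b c)" if "j \<le> 4" for j
      by (rule U_coeff_fps[OF GS(2) fps_expansion_unique_complex[OF GS(3) Y1_fps] _ that]) (simp only: GS(4) h)
    moreover have "(\<lambda>x. deriv (\<lambda>x. U x (a, b, c, n)) x) has_fps_expansion G"
      using GS(1) by (simp only: mult_1_right)
    ultimately show ?thesis by (intro exI[of _ G] conjI allI impI)
  qed
  \<comment> \<open>The derivative at 0 is the coefficient of index 0, known from
    \<open>J_coeff 0 0 n = 1\<close>, since the exponential factor is 1 there.\<close>
  have dq: "deriv (\<lambda>x. q x \<mu>0) 0 = 1"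
  proof -
    obtain a b c n where \<mu>: "\<mu>0 = (a, b, c, n)" by (cases \<mu>0)
    from q_fps[of a b c n 0] q(4) obtain G where
      "(\<lambda>x. deriv (\<lambda>x. q x \<mu>0) x * exp (of_real (1 - n) * q x \<mu>0)) has_fps_expansion G" "fps_nth G 0 = 1"
      by (auto simp: \<mu> J_coeff_def)
    from has_fps_expansion_imp_0_eq_fps_nth_0[OF this(1)] this(2) q0[OF q(4)] show ?thesis by simp
  qed
  have dU: "deriv (\<lambda>x. U x \<mu>0) 0 = 1"
  proof -
    obtain a b c n where \<mu>: "\<mu>0 = (a, b, c, n)" by (cases \<mu>0)
    from U_fps[of a b c n] U(4) obtain G where
      "(\<lambda>x. deriv (\<lambda>x. U x \<mu>0) x) has_fps_expansion G" "fps_nth G 0 = 1"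
      by (fastforce simp: \<mu> U_coeff_def dest: spec[of _ 0])
    from has_fps_expansion_imp_0_eq_fps_nth_0[OF this(1)] this(2) show ?thesis by simp
  qed
  have ej: "jhol (\<lambda>x \<mu>. exp (of_real (nu \<mu>) * q x \<mu>)) d2 N2"
    by (rule jholI) (intro continuous_intros holomorphic_intros jhol_continuous[OF q(5)] jhol_holomorphic[OF q(5)]; assumption)+
  obtain e1 M1 where M1: "0 < e1" "e1 \<le> d2" "open M1" "\<mu>0 \<in> M1" "M1 \<subseteq> N2"
    "\<And>w \<mu>. w \<in> ball 0 e1 \<Longrightarrow> \<mu> \<in> M1 \<Longrightarrow> norm (deriv (\<lambda>x. q x \<mu>) w - 1) < 1/2"
    by (rule jhol_close_nbhd[OF jhol_deriv[OF q(5)] q(3,4,2), of 1 "1/2"]) (use dq in auto)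
  obtain e2 M2 where M2: "0 < e2" "e2 \<le> d1" "open M2" "\<mu>0 \<in> M2" "M2 \<subseteq> N1"
    "\<And>w \<mu>. w \<in> ball 0 e2 \<Longrightarrow> \<mu> \<in> M2 \<Longrightarrow> norm (deriv (\<lambda>x. U x \<mu>) w - 1) < 1/2"
    by (rule jhol_close_nbhd[OF jhol_deriv[OF U(5)] U(3,4,2), of 1 "1/2"]) (use dU in auto)
  obtain e3 M3 where M3: "0 < e3" "e3 \<le> d2" "open M3" "\<mu>0 \<in> M3" "M3 \<subseteq> N2"
    "\<And>w \<mu>. w \<in> ball 0 e3 \<Longrightarrow> \<mu> \<in> M3 \<Longrightarrow> norm (exp (of_real (nu \<mu>) * q w \<mu>) - 1) < 1"
    by (rule jhol_close_nbhd[OF ej q(3,4,2), of 1 1]) (use q0 q(4) in auto)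
  obtain e4 M4 where M4: "0 < e4" "open M4" "\<mu>0 \<in> M4"
    "\<And>w \<mu>. w \<in> ball 0 e4 \<Longrightarrow> \<mu> \<in> M4 \<Longrightarrow> norm (Y2 w \<mu> - 1) < 1"
    by (rule jhol_close_nbhd[OF jhol_Y2[of 1 UNIV] open_UNIV UNIV_I zero_less_one, of \<mu>0 1 1]) (auto simp: Y2_0)
  define N where "N = M1 \<inter> M2 \<inter> M3 \<inter> M4"
  define \<delta> where "\<delta> = min e1 (min e2 e3)"
  \<comment> \<open>Closeness of Y2 to 1 gives sqrt(Y2) < 2, so |v| < \<delta> / 2 ensures |v
    sqrt(Y2(v))| < \<delta>.\<close>
  define \<epsilon> where "\<epsilon> = min (\<delta> / 2) (min e4 r2)"
  have \<delta>: "0 < \<delta>" "\<delta> \<le> e1" "\<delta> \<le> e2" "\<delta> \<le> e3" "\<delta> \<le> d1" "\<delta> \<le> d2"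
    using M1(1,2) M2(1,2) M3(1,2) by (auto simp: \<delta>_def)
  have \<epsilon>: "0 < \<epsilon>" "\<epsilon> \<le> \<delta> / 2" "\<epsilon> \<le> e4" "\<epsilon> \<le> r2"
    using \<delta>(1) M4(1) q(1) by (auto simp: \<epsilon>_def)
  have sub: "\<mu> \<in> M1" "\<mu> \<in> M2" "\<mu> \<in> M3" "\<mu> \<in> M4" "\<mu> \<in> N1" "\<mu> \<in> N2" if "\<mu> \<in> N" for \<mu>
    using that M1(5) M2(5) by (auto simp: N_def)
  have csq: "csqrt z ^ 2 = z" for z by simp
  have "branches N \<delta> \<epsilon> q U"
  proof
    show "open N" unfolding N_def by (intro open_Int M1 M2 M3 M4)
    show "0 < \<delta>" "0 < \<epsilon>" by fact+
    show "jhol q \<delta> N" "jhol U \<delta> N"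
      using sub by (auto intro!: jhol_subset[OF q(5) \<delta>(6)] jhol_subset[OF U(5) \<delta>(5)])
    fix x :: complex and \<mu> :: coeffs assume x: "x \<in> ball 0 \<delta>" and \<mu>: "\<mu> \<in> N"
    have xb: "x \<in> ball 0 e1" "x \<in> ball 0 e2" "x \<in> ball 0 e3" "x \<in> ball 0 d1" "x \<in> ball 0 d2"
      using x \<delta> by auto
    note s = sub[OF \<mu>]
    show "norm (deriv (\<lambda>x. q x \<mu>) x - 1) < 1/2" "norm (deriv (\<lambda>x. U x \<mu>) x - 1) < 1/2"
      "norm (exp (of_real (nu \<mu>) * q x \<mu>) - 1) < 1"
      using M1(6) M2(6) M3(6) xb s by blast+
    have "(q x \<mu> * csqrt (Y2 (q x \<mu>) \<mu>)) ^ 2 = x ^ 2" "(U x \<mu> * csqrt (Y1 (U x \<mu>) \<mu>)) ^ 2 = x ^ 2"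
      using q(7)[OF s(6) xb(5)] U(7)[OF s(5) xb(4)] by simp_all
    then show "q x \<mu> ^ 2 * Y2 (q x \<mu>) \<mu> = x ^ 2" "U x \<mu> ^ 2 * Y1 (U x \<mu>) \<mu> = x ^ 2"
      by (simp_all only: power_mult_distrib csq)
    show "q x \<mu> \<in> \<real>" if "x \<in> \<real>"
      using real_inverse_branch[OF q(9)[OF s(6)] q(6)[OF s(6) xb(5)] q(8)[OF s(6) q(6)[OF s(6) xb(5)]] _ Y2_cnj]
        q(7)[OF s(6) xb(5)] that by simp
    show "U x \<mu> \<in> \<real>" if "x \<in> \<real>"
      using real_inverse_branch[OF U(9)[OF s(5)] U(6)[OF s(5) xb(4)] U(8)[OF s(5) U(6)[OF s(5) xb(4)]] _ Y1_cnj]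
        U(7)[OF s(5) xb(4)] that by simp
  next
    fix \<mu> :: coeffs assume \<mu>: "\<mu> \<in> N"
    show "U 0 \<mu> = 0" using U0 sub[OF \<mu>] by auto
  next
    fix v :: real and \<mu> :: coeffs assume v: "\<bar>v\<bar> < \<epsilon>" and \<mu>: "\<mu> \<in> N"
    note s = sub[OF \<mu>]
    define y where "y = Re (Y2 (of_real v) \<mu>)"
    have vb: "complex_of_real v \<in> ball 0 r2" "complex_of_real v \<in> ball 0 e4" using v \<epsilon> by auto
    have y: "0 < y" using q(8)[OF s(6) vb(1)] by (simp only: y_def)
    then show "0 < Re (Y2 (of_real v) \<mu>)" by (simp only: y_def)
    have "Im (Y2 (of_real v) \<mu>) = 0"
      using arg_cong[OF Y2_cnj[of "of_real v" \<mu>], of Im] by simp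
    then have Yv: "Y2 (of_real v) \<mu> = of_real y"
      by (intro complex_eqI) (simp_all add: y_def)
    have "norm (complex_of_real y - 1) < 1" using M4(4)[OF vb(2) s(4)] by (simp only: Yv)
    then have "y < 4" using abs_Re_le_cmod[of "complex_of_real y - 1"] by auto
    then have "sqrt y < 2" using real_sqrt_less_iff[of y 4] by simp
    then have "\<bar>v\<bar> * sqrt y \<le> \<bar>v\<bar> * 2" by (intro mult_left_mono) auto
    with v \<epsilon>(2) y have dom: "\<bar>v * sqrt y\<bar> < \<delta>" by (simp add: abs_mult)
    then show "\<bar>v * sqrt (Re (Y2 (of_real v) \<mu>))\<bar> < \<delta>" by (simp only: y_def)
    have "csqrt (Y2 (of_real v) \<mu>) = of_real (sqrt y)"
      unfolding Yv using y by (intro of_real_sqrt[symmetric]) simp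
    then have F: "of_real v * csqrt (Y2 (of_real v) \<mu>) = complex_of_real (v * sqrt y)"
      by (simp only: of_real_mult)
    have xb: "complex_of_real (v * sqrt y) \<in> ball 0 d2"
      using dom \<delta>(6) by (simp only: mem_ball_0 norm_of_real)
    have "q (of_real (v * sqrt y)) \<mu> = of_real v"
      by (rule inj_onD[OF q(9)[OF s(6)] _ q(6)[OF s(6) xb] vb(1)]) (simp only: q(7)[OF s(6) xb] F)
    then show "q (of_real (v * sqrt (Re (Y2 (of_real v) \<mu>)))) \<mu> = of_real v"
      by (simp only: y_def)
  next
    fix a b c n :: real and j :: nat
    assume "(a, b, c, n) \<in> N"
    note s = sub(5,6)[OF this]
    show "\<exists>G. (\<lambda>x. deriv (\<lambda>x. q x (a, b, c, n)) x * exp (of_real (1 - n + 2 * real j * n) * q x (a, b, c, n)))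
        has_fps_expansion G \<and> (\<forall>i. j + i \<le> 4 \<longrightarrow> fps_nth G (2 * i) = of_real (J_coeff j i n))"
      by (rule q_fps[OF s(2)])
    show "\<exists>G. (\<lambda>r. deriv (\<lambda>r. U r (a, b, c, n)) r) has_fps_expansion G \<and>
        (\<forall>j\<le>4. fps_nth G (2 * j) = of_real (U_coeff j a b c))"
      by (rule U_fps[OF s(1)])
  qed
  moreover have "\<mu>0 \<in> N" using M1 M2 M3 M4 by (simp add: N_def)
  ultimately show ?thesis by (rule that)
qed

subsection \<open>The period as an integral over the angle\<close>

lemma jhol_param_fst: "jhol f r N \<Longrightarrow> jhol (\<lambda>w p. f w (fst p)) r (N \<times> A)"
proof (rule jholI)
  assume f: "jhol f r N"
  show "continuous_on (ball 0 r \<times> (N \<times> A)) (\<lambda>z. f (fst z) (fst (snd z)))"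
    by (rule continuous_on_compose2[OF jhol_continuous[OF f], of _ "\<lambda>z. (fst z, fst (snd z))", simplified])
      (auto intro!: continuous_intros)
  show "(\<lambda>w. f w (fst p)) holomorphic_on ball 0 r" if "p \<in> N \<times> A" for p
    using that by (intro jhol_holomorphic[OF f]) auto
qed

lemma jhol_exp_mult:
  assumes "jhol f r N" "continuous_on N c"
  shows "jhol (\<lambda>w p. exp (of_real (c p) * f w p)) r N"
proof (rule jholI)
  have "continuous_on (ball 0 r \<times> N) (\<lambda>z. c (snd z))"
    by (rule continuous_on_compose2[OF assms(2) continuous_on_snd[OF continuous_on_id]]) auto
  then show "continuous_on (ball 0 r \<times> N) (\<lambda>z. exp (of_real (c (snd z)) * f (fst z) (snd z)))"
    by (intro continuous_intros jhol_continuous[OF assms(1)])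
  show "(\<lambda>w. exp (of_real (c p) * f w p)) holomorphic_on ball 0 r" if "p \<in> N" for p
    by (intro holomorphic_intros jhol_holomorphic[OF assms(1) that])
qed

lemma integral_shift_period:
  fixes g :: "real \<Rightarrow> complex"
  assumes cont: "continuous_on UNIV g" and per: "\<And>\<theta>. g (\<theta> + 2 * pi) = g \<theta>"
  shows "integral {0..2 * pi} (\<lambda>\<theta>. g (\<theta> + pi)) = integral {0..2 * pi} g"
proof -
  have int: "g integrable_on {a..b}" for a b
    by (rule integrable_continuous_real[OF continuous_on_subset[OF cont]]) simp
  have shift: "integral {a..b} (\<lambda>\<theta>. g (\<theta> + c)) = integral {a + c..b + c} g" for a b c
    using integral_shift[OF continuous_on_subset[OF cont], of a c b] by (simp add: o_def)
  have "integral {0..2 * pi} (\<lambda>\<theta>. g (\<theta> + pi)) = integral {pi..3 * pi} g"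
    using shift[of 0 "2 * pi" pi] by simp
  also have "\<dots> = integral {pi..2 * pi} g + integral {2 * pi..3 * pi} g"
    by (rule Henstock_Kurzweil_Integration.integral_combine[symmetric]) (use int in auto)
  also have "integral {2 * pi..3 * pi} g = integral {0..pi} g"
    using shift[of 0 pi "2 * pi"] by (simp add: per)
  also have "integral {pi..2 * pi} g + integral {0..pi} g = integral {0..2 * pi} g"
    using Henstock_Kurzweil_Integration.integral_combine[of 0 pi "2 * pi" g] int by (simp add: add.commute)
  finally show ?thesis .
qed

context branches
begin

text \<open>This is dt/d\<theta> along the orbit: q'(x) e^((1 - n) q) U'(r) with x = \<rho> cos
  \<theta> and r = -(\<rho>/4) sin \<theta> e^(n q). It is the quotient of dq/d\<theta> = -\<rho>
  sin \<theta> q'(x) and dq/dt = 4 e^(-q) r / U'(r), whose zeros cancel.\<close>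

definition kern :: "complex \<Rightarrow> coeffs \<times> real \<Rightarrow> complex" where
  "kern \<rho> p = deriv (\<lambda>x. q x (fst p)) (\<rho> * of_real (cos (snd p))) *
     exp (of_real (1 - nu (fst p)) * q (\<rho> * of_real (cos (snd p))) (fst p)) *
     deriv (\<lambda>r. U r (fst p)) (- (\<rho> / 4 * of_real (sin (snd p))) * exp (of_real (nu (fst p)) * q (\<rho> * of_real (cos (snd p))) (fst p)))"

lemma cos_mult_mem: "\<rho> \<in> ball 0 r \<Longrightarrow> \<rho> * of_real (cos \<theta>) \<in> ball (0::complex) r"
  using abs_cos_le_one[of \<theta>] mult_left_mono[of "\<bar>cos \<theta>\<bar>" 1 "norm \<rho>"] by (simp add: norm_mult)

lemma radius_bound:
  assumes "\<rho> \<in> ball 0 \<delta>" "\<mu> \<in> N"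
  shows "norm (- (\<rho> / 4 * of_real (sin \<theta>)) * exp (of_real (nu \<mu>) * q (\<rho> * of_real (cos \<theta>)) \<mu>)) \<le> norm \<rho> / 2"
proof -
  have "norm (exp (of_real (nu \<mu>) * q (\<rho> * of_real (cos \<theta>)) \<mu>)) \<le> 2"
    using exp_close[OF cos_mult_mem[OF assms(1)] assms(2), of \<theta>]
      norm_triangle_ineq2[of "exp (of_real (nu \<mu>) * q (\<rho> * of_real (cos \<theta>)) \<mu>)" 1] by simp
  moreover have "norm (- (\<rho> / 4 * of_real (sin \<theta>))) \<le> norm \<rho> / 4"
    using mult_left_mono[OF abs_sin_le_one[of \<theta>], of "norm \<rho> / 4"] by (simp add: norm_mult norm_divide)
  ultimately show ?thesis
    unfolding norm_mult[of "- (\<rho> / 4 * of_real (sin \<theta>))"]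
    using mult_mono[of "norm (- (\<rho> / 4 * of_real (sin \<theta>)))" "norm \<rho> / 4"
      "norm (exp (of_real (nu \<mu>) * q (\<rho> * of_real (cos \<theta>)) \<mu>))" 2] by simp
qed

lemma radius_mem:
  assumes "\<rho> \<in> ball 0 \<delta>" "\<mu> \<in> N"
  shows "- (\<rho> / 4 * of_real (sin \<theta>)) * exp (of_real (nu \<mu>) * q (\<rho> * of_real (cos \<theta>)) \<mu>) \<in> ball 0 \<delta>"
proof -
  have "norm \<rho> / 2 < \<delta>" using assms(1) \<delta>_pos by auto
  with radius_bound[OF assms, of \<theta>] show ?thesis
    unfolding mem_ball_0 by linarith
qed

lemma kern_jhol: "jhol kern \<delta> (N \<times> A)"
proof -
  have c: "jhol (\<lambda>\<rho> p. \<rho> * of_real (cos (snd p))) \<delta> (N \<times> A)"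
    by (rule jholI) (intro continuous_intros holomorphic_intros)+
  have s: "jhol (\<lambda>\<rho> p. - (\<rho> / 4 * of_real (sin (snd p)))) \<delta> (N \<times> A)"
    by (rule jholI) (intro continuous_intros holomorphic_intros; simp)+
  have qc: "jhol (\<lambda>\<rho> p. q (\<rho> * of_real (cos (snd p))) (fst p)) \<delta> (N \<times> A)"
    by (rule jhol_compose[OF jhol_param_fst[OF q_jhol] c]) (rule cos_mult_mem)
  have dqc: "jhol (\<lambda>\<rho> p. deriv (\<lambda>x. q x (fst p)) (\<rho> * of_real (cos (snd p)))) \<delta> (N \<times> A)"
    by (rule jhol_compose[OF jhol_param_fst[OF jhol_deriv[OF q_jhol]] c]) (rule cos_mult_mem)
  have cn: "continuous_on (N \<times> A) (\<lambda>p. nu (fst p))" "continuous_on (N \<times> A) (\<lambda>p. 1 - nu (fst p))"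
    by (intro continuous_intros)+
  have r: "jhol (\<lambda>\<rho> p. - (\<rho> / 4 * of_real (sin (snd p))) * exp (of_real (nu (fst p)) * q (\<rho> * of_real (cos (snd p))) (fst p))) \<delta> (N \<times> A)"
    by (rule jhol_mult[OF s jhol_exp_mult[OF qc cn(1)]])
  have "jhol (\<lambda>\<rho> p. deriv (\<lambda>r. U r (fst p)) (- (\<rho> / 4 * of_real (sin (snd p))) * exp (of_real (nu (fst p)) * q (\<rho> * of_real (cos (snd p))) (fst p)))) \<delta> (N \<times> A)"
    by (rule jhol_compose[OF jhol_param_fst[OF jhol_deriv[OF U_jhol]] r]) (rule radius_mem; auto)
  then show ?thesis
    unfolding kern_def by (intro jhol_mult[OF jhol_mult[OF dqc jhol_exp_mult[OF qc cn(2)]]])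
qed

lemma kern_continuous:
  assumes "\<rho> \<in> ball 0 \<delta>" "\<mu> \<in> N"
  shows "continuous_on A (\<lambda>\<theta>. kern \<rho> (\<mu>, \<theta>))"
  by (rule continuous_on_compose2[OF jhol_continuous[OF kern_jhol[of A]], of _ "\<lambda>\<theta>. (\<rho>, (\<mu>, \<theta>))", simplified])
    (use assms in \<open>auto intro!: continuous_intros\<close>)

definition T :: "complex \<Rightarrow> coeffs \<Rightarrow> complex" where
  "T \<rho> \<mu> = integral {0..2 * pi} (\<lambda>\<theta>. kern \<rho> (\<mu>, \<theta>))"

lemma T_jhol: "jhol T \<delta> N"
  unfolding T_def by (rule jhol_integral[OF kern_jhol])

text \<open>Replacing \<theta> by \<theta> + \<pi> in the kernel amounts to changing the sign of
  \<rho>.\<close>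

lemma T_even:
  assumes "\<rho> \<in> ball 0 \<delta>" "\<mu> \<in> N"
  shows "T (- \<rho>) \<mu> = T \<rho> \<mu>"
proof -
  have "(\<lambda>\<theta>. kern (- \<rho>) (\<mu>, \<theta>)) = (\<lambda>\<theta>. kern \<rho> (\<mu>, \<theta> + pi))"
    by (simp add: kern_def fun_eq_iff)
  moreover have "kern \<rho> (\<mu>, \<theta> + 2 * pi) = kern \<rho> (\<mu>, \<theta>)" for \<theta>
    by (simp add: kern_def)
  ultimately show ?thesis
    unfolding T_def using integral_shift_period[OF kern_continuous[OF assms]] by simp
qed

text \<open>U' is expanded in r and, for each power of r, the accompanying exponential in x = \<rho>
  cos \<theta>. The remainder is bounded uniformly in \<theta>, ready for integration; nine terms in
  each variable reach the degree 8 needed for \<open>tau 4\<close>.\<close>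

lemma kern_Taylor:
  assumes \<mu>: "(a, b, c, n) \<in> N"
  obtains u A C r where "0 < r" "r \<le> \<delta>" "\<And>j. j \<le> 4 \<Longrightarrow> u (2 * j) = of_real (U_coeff j a b c)"
    "\<And>j i. j + i \<le> 4 \<Longrightarrow> A (2 * j) (2 * i) = of_real (J_coeff j i n)"
    "\<And>\<rho> \<theta>. \<rho> \<in> ball 0 r \<Longrightarrow> norm (kern \<rho> ((a, b, c, n), \<theta>) -
      (\<Sum>j<9. \<Sum>i<9. u j * A j i * (- 1 / 4) ^ j * \<rho> ^ (j + i) * of_real (sin \<theta> ^ j * cos \<theta> ^ i))) \<le> C * norm \<rho> ^ 9"
proof -
  let ?\<mu> = "(a, b, c, n)"
  define Af where "Af j x = deriv (\<lambda>x. q x ?\<mu>) x * exp (of_real (1 - n + real j * n) * q x ?\<mu>)" for j :: nat and x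
  have Afh: "Af j holomorphic_on ball 0 \<delta>" for j
    unfolding Af_def by (intro holomorphic_intros holomorphic_deriv jhol_holomorphic[OF q_jhol \<mu>]) auto
  define GA where "GA j = fps_expansion (Af j) 0" for j
  have GA: "Af j has_fps_expansion GA j" for j
    unfolding GA_def by (rule has_fps_expansion_fps_expansion[OF open_ball _ Afh]) (use \<delta>_pos in auto)
  have GA_even: "fps_nth (GA (2 * j)) (2 * i) = of_real (J_coeff j i n)" if "j + i \<le> 4" for j i
  proof -
    obtain G where G: "(\<lambda>x. deriv (\<lambda>x. q x ?\<mu>) x * exp (of_real (1 - n + 2 * real j * n) * q x ?\<mu>)) has_fps_expansion G"
      "\<forall>i. j + i \<le> 4 \<longrightarrow> fps_nth G (2 * i) = of_real (J_coeff j i n)"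
      using q_fps[OF \<mu>, of j] by blast
    have "Af (2 * j) has_fps_expansion G"
      using G(1) unfolding Af_def[abs_def] by (simp add: mult.assoc)
    then have "GA (2 * j) = G" using GA fps_expansion_unique_complex by blast
    then show ?thesis using G(2) that by blast
  qed
  obtain GU where GU: "(\<lambda>r. deriv (\<lambda>r. U r ?\<mu>) r) has_fps_expansion GU"
    "\<forall>j\<le>4. fps_nth GU (2 * j) = of_real (U_coeff j a b c)"
    using U_fps[OF \<mu>] by blast
  obtain CU rU where CU: "0 < rU" "0 \<le> CU"
    "\<And>w. norm w < rU \<Longrightarrow> norm (deriv (\<lambda>r. U r ?\<mu>) w - (\<Sum>j<9. fps_nth GU j * w ^ j)) \<le> CU * norm w ^ 9"
    using has_fps_expansion_Taylor_bound[OF GU(1), of 9] by blast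
  obtain K rK where K: "0 < rK" "0 \<le> K" "\<And>w. norm w < rK \<Longrightarrow> norm (Af 0 w) \<le> K"
    using has_fps_expansion_Taylor_bound[OF GA[of 0], of 0]
    unfolding lessThan_0 sum.empty diff_zero power_0 mult_1_right by metis
  \<comment> \<open>Induction on the number of series yields one radius and one constant valid for
    all nine of them.\<close>
  have "\<exists>C r. 0 < r \<and> 0 \<le> C \<and> (\<forall>j<m. \<forall>w. norm w < r \<longrightarrow>
      norm (Af j w - (\<Sum>i<9. fps_nth (GA j) i * w ^ i)) \<le> C * norm w ^ 9)" for m
  proof (induction m)
    case (Suc m)
    then obtain C r where 1: "0 < r" "0 \<le> C" "\<forall>j<m. \<forall>w. norm w < r \<longrightarrow>
      norm (Af j w - (\<Sum>i<9. fps_nth (GA j) i * w ^ i)) \<le> C * norm w ^ 9" by blast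
    obtain C' r' where 2: "0 < r'" "0 \<le> C'" "\<And>w. norm w < r' \<Longrightarrow>
      norm (Af m w - (\<Sum>i<9. fps_nth (GA m) i * w ^ i)) \<le> C' * norm w ^ 9"
      using has_fps_expansion_Taylor_bound[OF GA[of m], of 9] by blast
    show ?case
    proof (rule exI[of _ "C + C'"], rule exI[of _ "min r r'"], intro conjI allI impI)
      fix j and w :: complex assume j: "j < Suc m" and w: "norm w < min r r'"
      have "norm (Af j w - (\<Sum>i<9. fps_nth (GA j) i * w ^ i)) \<le> C * norm w ^ 9 \<or>
        norm (Af j w - (\<Sum>i<9. fps_nth (GA j) i * w ^ i)) \<le> C' * norm w ^ 9"
        using 1(3) 2(3)[of w] j w by (cases "j = m") auto
      moreover have "C * norm w ^ 9 \<le> (C + C') * norm w ^ 9" "C' * norm w ^ 9 \<le> (C + C') * norm w ^ 9"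
        using 1(2) 2(2) by (intro mult_right_mono; simp)+
      ultimately show "norm (Af j w - (\<Sum>i<9. fps_nth (GA j) i * w ^ i)) \<le> (C + C') * norm w ^ 9"
        by linarith
    qed (use 1 2 in auto)
  qed (auto intro: exI[of _ 1])
  from this[of 9] obtain CA rA where CA: "0 < rA" "0 \<le> CA"
    "\<And>j w. j < 9 \<Longrightarrow> norm w < rA \<Longrightarrow> norm (Af j w - (\<Sum>i<9. fps_nth (GA j) i * w ^ i)) \<le> CA * norm w ^ 9"
    by blast
  define C where "C = K * CU + (\<Sum>j<9. norm (fps_nth GU j) * CA)"
  define r where "r = Min {\<delta>, 1, rU, rK, rA}"
  have r: "0 < r" "r \<le> \<delta>" "r \<le> 1" "r \<le> rU" "r \<le> rK" "r \<le> rA"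
    using \<delta>_pos CU K CA by (auto simp: r_def)
  have bound: "norm (kern \<rho> (?\<mu>, \<theta>) -
      (\<Sum>j<9. \<Sum>i<9. fps_nth GU j * fps_nth (GA j) i * (- 1 / 4) ^ j * \<rho> ^ (j + i) * of_real (sin \<theta> ^ j * cos \<theta> ^ i))) \<le> C * norm \<rho> ^ 9"
    if \<rho>: "\<rho> \<in> ball 0 r" for \<rho> \<theta>
  proof -
    have \<rho>\<delta>: "\<rho> \<in> ball 0 \<delta>" "norm \<rho> \<le> 1" using \<rho> r by auto
    define x where "x = \<rho> * complex_of_real (cos \<theta>)"
    define y where "y = - (\<rho> / 4 * complex_of_real (sin \<theta>))"
    define w where "w = y * exp (of_real n * q x ?\<mu>)"
    have x: "norm x \<le> norm \<rho>"
      using mult_left_mono[OF abs_cos_le_one[of \<theta>], of "norm \<rho>"] by (simp add: x_def norm_mult)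
    have y: "norm y \<le> 1"
      using mult_mono[OF \<rho>\<delta>(2) abs_sin_le_one[of \<theta>]] by (simp add: y_def norm_mult norm_divide)
    have w: "norm w \<le> norm \<rho>"
    proof -
      have "norm w \<le> norm \<rho> / 2"
        using radius_bound[OF \<rho>\<delta>(1) \<mu>, of \<theta>] by (simp add: w_def y_def x_def nu_def)
      then show ?thesis using norm_ge_zero[of \<rho>] by linarith
    qed
    have kern: "kern \<rho> (?\<mu>, \<theta>) = Af 0 x * deriv (\<lambda>r. U r ?\<mu>) w"
      by (simp add: kern_def Af_def x_def y_def w_def nu_def)
    \<comment> \<open>The j-th power of r carries e^(j n q), which merges with e^((1 - n) q); so
      every power of U' has its own analytic factor \<open>Af j\<close>.\<close>
    have pow: "Af 0 x * w ^ j = y ^ j * Af j x" for j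
      by (simp add: w_def Af_def power_mult_distrib exp_of_nat_mult[symmetric] algebra_simps exp_add exp_diff)
    have sums: "(\<Sum>j<9. \<Sum>i<9. fps_nth GU j * fps_nth (GA j) i * (- 1 / 4) ^ j * \<rho> ^ (j + i) * of_real (sin \<theta> ^ j * cos \<theta> ^ i))
        = (\<Sum>j<9. fps_nth GU j * y ^ j * (\<Sum>i<9. fps_nth (GA j) i * x ^ i))"
    proof (intro sum.cong refl)
      fix j
      have yj: "y ^ j = (- 1 / 4) ^ j * \<rho> ^ j * of_real (sin \<theta> ^ j)"
        by (simp add: y_def power_mult_distrib[symmetric] mult_ac)
      show "(\<Sum>i<9. fps_nth GU j * fps_nth (GA j) i * (- 1 / 4) ^ j * \<rho> ^ (j + i) * of_real (sin \<theta> ^ j * cos \<theta> ^ i))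
        = fps_nth GU j * y ^ j * (\<Sum>i<9. fps_nth (GA j) i * x ^ i)"
        unfolding sum_distrib_left yj
        by (intro sum.cong refl) (simp add: x_def power_mult_distrib power_add mult_ac)
    qed
    have Af0: "Af 0 x * (\<Sum>j<9. fps_nth GU j * w ^ j) = (\<Sum>j<9. fps_nth GU j * y ^ j * Af j x)"
      unfolding sum_distrib_left
      by (intro sum.cong refl) (simp only: mult.left_commute[of "Af 0 x"] pow mult.assoc)
    have "kern \<rho> (?\<mu>, \<theta>) -
      (\<Sum>j<9. \<Sum>i<9. fps_nth GU j * fps_nth (GA j) i * (- 1 / 4) ^ j * \<rho> ^ (j + i) * of_real (sin \<theta> ^ j * cos \<theta> ^ i))
      = Af 0 x * (deriv (\<lambda>r. U r ?\<mu>) w - (\<Sum>j<9. fps_nth GU j * w ^ j)) +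
        (\<Sum>j<9. fps_nth GU j * y ^ j * (Af j x - (\<Sum>i<9. fps_nth (GA j) i * x ^ i)))"
      unfolding kern sums right_diff_distrib Af0 sum_subtractf by simp
    also have "norm \<dots> \<le> K * (CU * norm \<rho> ^ 9) + (\<Sum>j<9. norm (fps_nth GU j) * (CA * norm \<rho> ^ 9))"
    proof (intro order_trans[OF norm_triangle_ineq] add_mono order_trans[OF norm_sum] sum_mono)
      have "norm (deriv (\<lambda>r. U r ?\<mu>) w - (\<Sum>j<9. fps_nth GU j * w ^ j)) \<le> CU * norm w ^ 9"
        using w \<rho> r by (intro CU(3)) auto
      also have "\<dots> \<le> CU * norm \<rho> ^ 9"
        using w CU(2) by (intro mult_left_mono power_mono) auto
      finally show "norm (Af 0 x * (deriv (\<lambda>r. U r ?\<mu>) w - (\<Sum>j<9. fps_nth GU j * w ^ j))) \<le> K * (CU * norm \<rho> ^ 9)"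
        unfolding norm_mult using K x \<rho> r by (intro mult_mono K(3)) auto
      fix j :: nat assume "j \<in> {..<9}"
      then have "norm (Af j x - (\<Sum>i<9. fps_nth (GA j) i * x ^ i)) \<le> CA * norm x ^ 9"
        using x \<rho> r by (intro CA(3)) auto
      also have "\<dots> \<le> CA * norm \<rho> ^ 9"
        using x CA(2) by (intro mult_left_mono power_mono) auto
      finally have 1: "norm (Af j x - (\<Sum>i<9. fps_nth (GA j) i * x ^ i)) \<le> CA * norm \<rho> ^ 9" .
      have "norm (y ^ j) \<le> 1" using y by (simp add: norm_power power_le_one)
      then have "norm (y ^ j) * norm (Af j x - (\<Sum>i<9. fps_nth (GA j) i * x ^ i)) \<le> 1 * (CA * norm \<rho> ^ 9)"
        using 1 by (intro mult_mono) auto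
      then show "norm (fps_nth GU j * y ^ j * (Af j x - (\<Sum>i<9. fps_nth (GA j) i * x ^ i))) \<le> norm (fps_nth GU j) * (CA * norm \<rho> ^ 9)"
        unfolding norm_mult mult.assoc by (intro mult_left_mono) auto
    qed
    also have "\<dots> = C * norm \<rho> ^ 9"
      by (simp add: C_def algebra_simps sum_distrib_left)
    finally show ?thesis .
  qed
  show ?thesis
    by (rule that[of r "fps_nth GU" "\<lambda>j. fps_nth (GA j)" C]) (use r GU(2) GA_even bound in auto)
qed

end

lemma sum_antidiagonal_even:
  fixes c :: "nat \<Rightarrow> nat \<Rightarrow> 'a::comm_monoid_add"
  assumes "2 * k < m" "\<And>j i. odd j \<Longrightarrow> c j i = 0"
  shows "(\<Sum>j<m. \<Sum>i<m. if j + i = 2 * k then c j i else 0) = (\<Sum>j\<le>k. c (2 * j) (2 * (k - j)))"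
proof -
  have "(\<Sum>j<m. \<Sum>i<m. if j + i = 2 * k then c j i else 0) = (\<Sum>j<m. if j \<le> 2 * k then c j (2 * k - j) else 0)"
  proof (intro sum.cong refl)
    fix j assume "j \<in> {..<m}"
    show "(\<Sum>i<m. if j + i = 2 * k then c j i else 0) = (if j \<le> 2 * k then c j (2 * k - j) else 0)"
    proof (cases "j \<le> 2 * k")
      case True
      then have "(\<Sum>i<m. if j + i = 2 * k then c j i else 0) = (\<Sum>i<m. if i = 2 * k - j then c j i else 0)"
        by (intro sum.cong) auto
      also have "\<dots> = c j (2 * k - j)"
        using assms(1) by (subst sum.delta) auto
      finally show ?thesis using True by simp
    qed auto
  qed
  also have "\<dots> = (\<Sum>j\<in>(\<lambda>j. 2 * j) ` {..k}. c j (2 * k - j))"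
  proof (rule sum.mono_neutral_cong_right)
    show "\<forall>j\<in>{..<m} - (\<lambda>j. 2 * j) ` {..k}. (if j \<le> 2 * k then c j (2 * k - j) else 0) = 0"
    proof
      fix j assume j: "j \<in> {..<m} - (\<lambda>j. 2 * j) ` {..k}"
      show "(if j \<le> 2 * k then c j (2 * k - j) else 0) = 0"
      proof (cases "odd j")
        case False
        then obtain i where "j = 2 * i" by (auto elim: evenE)
        with j show ?thesis by auto
      qed (simp add: assms(2))
    qed
  qed (use assms(1) in auto)
  also have "\<dots> = (\<Sum>j\<le>k. c (2 * j) (2 * (k - j)))"
    by (subst sum.reindex) (auto simp: inj_on_def diff_mult_distrib2)
  finally show ?thesis .
qed

context branches
begin

text \<open>Integration in \<theta> turns the expansion of the kernel into a polynomial in \<rho>,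
  with an error of order \<rho>^9 that does not affect derivatives up to order 8. Odd powers of the
  sine integrate to 0, and the remaining terms of degree 2 k add up to \<open>tau k\<close>.\<close>

lemma T_deriv_even:
  assumes \<mu>: "(a, b, c, n) \<in> N" and k: "k \<le> 4"
  shows "(deriv ^^ (2 * k)) (\<lambda>\<rho>. T \<rho> (a, b, c, n)) 0 = of_real (fact (2 * k) * (2 * pi * tau k a b c n))"
proof -
  let ?\<mu> = "(a, b, c, n)"
  obtain u A C r where r: "0 < r" "r \<le> \<delta>" and u: "\<And>j. j \<le> 4 \<Longrightarrow> u (2 * j) = of_real (U_coeff j a b c)"
    and A: "\<And>j i. j + i \<le> 4 \<Longrightarrow> A (2 * j) (2 * i) = of_real (J_coeff j i n)"
    and bound: "\<And>\<rho> \<theta>. \<rho> \<in> ball 0 r \<Longrightarrow> norm (kern \<rho> (?\<mu>, \<theta>) -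
      (\<Sum>j<9. \<Sum>i<9. u j * A j i * (- 1 / 4) ^ j * \<rho> ^ (j + i) * of_real (sin \<theta> ^ j * cos \<theta> ^ i))) \<le> C * norm \<rho> ^ 9"
    by (rule kern_Taylor[OF \<mu>], rule that, assumption+)
  define d where "d j i = u j * A j i * (- 1 / 4) ^ j * of_real (trig_integral j i)" for j i
  define p where "p \<rho> = (\<Sum>j<9. \<Sum>i<9. d j i * \<rho> ^ (j + i))" for \<rho>
  have "complex_of_real (r / 2) \<in> ball 0 r" using r by simp
  then have "0 \<le> C * norm (complex_of_real (r / 2)) ^ 9"
    by (rule order_trans[OF norm_ge_zero bound[of _ 0]])
  then have C: "0 \<le> C" using r by (simp add: zero_le_mult_iff)
  have T_hol: "(\<lambda>\<rho>. T \<rho> ?\<mu>) holomorphic_on ball 0 \<delta>" by (rule jhol_holomorphic[OF T_jhol \<mu>])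
  have close: "norm (T \<rho> ?\<mu> - p \<rho>) \<le> (C * (2 * pi)) * norm \<rho> ^ 9" if \<rho>: "\<rho> \<in> ball 0 r" for \<rho>
  proof -
    have \<rho>\<delta>: "\<rho> \<in> ball 0 \<delta>" using \<rho> r by auto
    have trig: "((\<lambda>\<theta>. complex_of_real (sin \<theta> ^ j * cos \<theta> ^ i)) has_integral of_real (trig_integral j i)) {0..2 * pi}" for j i
      using has_integral_linear[OF integrable_integral[OF integrable_trig[of j i]] bounded_linear_of_real]
      by (simp add: o_def trig_integral_def)
    have "((\<lambda>\<theta>. kern \<rho> (?\<mu>, \<theta>) -
      (\<Sum>j<9. \<Sum>i<9. u j * A j i * (- 1 / 4) ^ j * \<rho> ^ (j + i) * of_real (sin \<theta> ^ j * cos \<theta> ^ i)))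
      has_integral T \<rho> ?\<mu> - (\<Sum>j<9. \<Sum>i<9. u j * A j i * (- 1 / 4) ^ j * \<rho> ^ (j + i) * of_real (trig_integral j i))) {0..2 * pi}"
      unfolding T_def
      by (intro has_integral_diff has_integral_sum has_integral_mult_right trig integrable_integral
          integrable_continuous_real kern_continuous[OF \<rho>\<delta> \<mu>] finite_lessThan)
    then have int: "((\<lambda>\<theta>. kern \<rho> (?\<mu>, \<theta>) -
      (\<Sum>j<9. \<Sum>i<9. u j * A j i * (- 1 / 4) ^ j * \<rho> ^ (j + i) * of_real (sin \<theta> ^ j * cos \<theta> ^ i)))
      has_integral T \<rho> ?\<mu> - p \<rho>) (cbox 0 (2 * pi))"
      by (simp add: p_def d_def mult_ac)
    have "norm (T \<rho> ?\<mu> - p \<rho>) \<le> C * norm \<rho> ^ 9 * Henstock_Kurzweil_Integration.content (cbox 0 (2 * pi))"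
      by (rule has_integral_bound[OF _ int]) (use bound[OF \<rho>] C in auto)
    then show ?thesis by (simp add: mult_ac)
  qed
  define FP where "FP = (\<Sum>j<9. \<Sum>i<9. fps_const (d j i) * fps_X ^ (j + i))"
  have p_fps: "p has_fps_expansion FP"
    unfolding p_def[abs_def] FP_def by (intro fps_expansion_intros)
  have p_hol: "p holomorphic_on ball 0 r"
    unfolding p_def[abs_def] by (intro holomorphic_intros)
  have T_hol_r: "(\<lambda>\<rho>. T \<rho> ?\<mu>) holomorphic_on ball 0 r"
    by (rule holomorphic_on_subset[OF T_hol subset_ball[OF r(2)]])
  have "(deriv ^^ (2 * k)) (\<lambda>\<rho>. T \<rho> ?\<mu> - p \<rho>) 0 = 0"
    by (rule higher_deriv_zero_if_small[OF holomorphic_on_diff[OF T_hol_r p_hol] r(1) close]) (use k in auto)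
  then have "(deriv ^^ (2 * k)) (\<lambda>\<rho>. T \<rho> ?\<mu>) 0 = (deriv ^^ (2 * k)) p 0"
    using higher_deriv_diff[OF T_hol_r p_hol open_ball, of 0 "2 * k"] r(1) by simp
  also have "(deriv ^^ (2 * k)) p 0 = fact (2 * k) * fps_nth FP (2 * k)"
    using fps_nth_fps_expansion[OF p_fps, of "2 * k"] by simp
  also have "fps_nth FP (2 * k) = (\<Sum>j<9. \<Sum>i<9. if j + i = 2 * k then d j i else 0)"
    unfolding FP_def fps_sum_nth fps_mult_left_const_nth fps_X_power_nth
    by (intro sum.cong refl) auto
  also have "\<dots> = (\<Sum>j\<le>k. d (2 * j) (2 * (k - j)))"
    by (rule sum_antidiagonal_even) (use k in \<open>auto simp: d_def trig_integral_odd\<close>)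
  also have "\<dots> = (\<Sum>j\<le>k. of_real (2 * pi * (U_coeff j a b c / 16 ^ j * J_coeff j (k - j) n * wallis j (k - j))))"
  proof (intro sum.cong refl)
    fix j assume "j \<in> {..k}"
    then have "j \<le> 4" "j + (k - j) \<le> 4" using k by auto
    then show "d (2 * j) (2 * (k - j)) = of_real (2 * pi * (U_coeff j a b c / 16 ^ j * J_coeff j (k - j) n * wallis j (k - j)))"
      by (simp add: d_def u A trig_integral_even power_mult power_divide power2_eq_square power_minus)
  qed
  also have "\<dots> = of_real (2 * pi * tau k a b c n)"
    by (simp add: tau_def sum_distrib_left)
  finally show ?thesis by simp
qed

end

subsection \<open>Uniqueness of solutions and of periods\<close>

definition lipschitz_on_balls :: "('a::real_normed_vector \<Rightarrow> 'b::real_normed_vector) \<Rightarrow> bool" where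
  "lipschitz_on_balls f \<longleftrightarrow>
     (\<forall>K. \<exists>L\<ge>0. \<forall>z w. norm z \<le> K \<longrightarrow> norm w \<le> K \<longrightarrow> norm (f z - f w) \<le> L * norm (z - w))"

lemma lipschitz_on_ballsE:
  assumes "lipschitz_on_balls f"
  obtains L where "0 \<le> L" "\<And>z w. norm z \<le> K \<Longrightarrow> norm w \<le> K \<Longrightarrow> norm (f z - f w) \<le> L * norm (z - w)"
proof -
  obtain L where "0 \<le> L" "\<forall>z w. norm z \<le> K \<longrightarrow> norm w \<le> K \<longrightarrow> norm (f z - f w) \<le> L * norm (z - w)"
    using assms unfolding lipschitz_on_balls_def by blast
  then show thesis by (intro that) blast+
qed

lemma lipschitz_on_balls_const: "lipschitz_on_balls (\<lambda>z. c)"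
  unfolding lipschitz_on_balls_def by (auto intro: exI[of _ 0])

lemma lipschitz_on_balls_bounded_linear: "bounded_linear f \<Longrightarrow> lipschitz_on_balls f"
  unfolding lipschitz_on_balls_def
proof
  fix K assume "bounded_linear f"
  then interpret bounded_linear f .
  obtain B where "0 \<le> B" "\<And>x. norm (f x) \<le> norm x * B" using nonneg_bounded by blast
  then show "\<exists>L\<ge>0. \<forall>z w. norm z \<le> K \<longrightarrow> norm w \<le> K \<longrightarrow> norm (f z - f w) \<le> L * norm (z - w)"
    by (intro exI[of _ B]) (metis diff mult.commute)
qed

lemma lipschitz_on_balls_add:
  fixes f g :: "'a::real_normed_vector \<Rightarrow> 'b::real_normed_vector"
  assumes "lipschitz_on_balls f" "lipschitz_on_balls g"
  shows "lipschitz_on_balls (\<lambda>z. f z + g z)"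
  unfolding lipschitz_on_balls_def
proof
  fix K
  obtain L1 where L1: "0 \<le> L1" "\<And>z w. norm z \<le> K \<Longrightarrow> norm w \<le> K \<Longrightarrow> norm (f z - f w) \<le> L1 * norm (z - w)"
    using lipschitz_on_ballsE[OF assms(1)] by metis
  obtain L2 where L2: "0 \<le> L2" "\<And>z w. norm z \<le> K \<Longrightarrow> norm w \<le> K \<Longrightarrow> norm (g z - g w) \<le> L2 * norm (z - w)"
    using lipschitz_on_ballsE[OF assms(2)] by metis
  show "\<exists>L\<ge>0. \<forall>z w. norm z \<le> K \<longrightarrow> norm w \<le> K \<longrightarrow> norm ((f z + g z) - (f w + g w)) \<le> L * norm (z - w)"
  proof (intro exI[of _ "L1 + L2"] conjI allI impI)
    fix z w :: 'a assume zw: "norm z \<le> K" "norm w \<le> K"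
    have "norm ((f z + g z) - (f w + g w)) \<le> norm (f z - f w) + norm (g z - g w)"
      by (rule norm_diff_triangle_ineq)
    with L1(2)[OF zw] L2(2)[OF zw] show "norm ((f z + g z) - (f w + g w)) \<le> (L1 + L2) * norm (z - w)"
      by (simp add: algebra_simps)
  qed (use L1 L2 in simp)
qed

lemma lipschitz_on_balls_mult:
  fixes f g :: "'a::real_normed_vector \<Rightarrow> real"
  assumes "lipschitz_on_balls f" "lipschitz_on_balls g"
  shows "lipschitz_on_balls (\<lambda>z. f z * g z)"
  unfolding lipschitz_on_balls_def
proof
  fix K
  obtain L1 where L1: "0 \<le> L1" "\<And>z w. norm z \<le> \<bar>K\<bar> \<Longrightarrow> norm w \<le> \<bar>K\<bar> \<Longrightarrow> norm (f z - f w) \<le> L1 * norm (z - w)"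
    using lipschitz_on_ballsE[OF assms(1)] by metis
  obtain L2 where L2: "0 \<le> L2" "\<And>z w. norm z \<le> \<bar>K\<bar> \<Longrightarrow> norm w \<le> \<bar>K\<bar> \<Longrightarrow> norm (g z - g w) \<le> L2 * norm (z - w)"
    using lipschitz_on_ballsE[OF assms(2)] by metis
  define B1 where "B1 = norm (f 0) + L1 * \<bar>K\<bar>"
  define B2 where "B2 = norm (g 0) + L2 * \<bar>K\<bar>"
  have B: "\<bar>f z\<bar> \<le> B1" "\<bar>g z\<bar> \<le> B2" if "norm z \<le> \<bar>K\<bar>" for z
    using L1(2)[OF that, of 0] L2(2)[OF that, of 0] mult_left_mono[OF that L1(1)] mult_left_mono[OF that L2(1)]
    by (auto simp: B1_def B2_def)
  have "0 \<le> B1" "0 \<le> B2" using L1 L2 by (simp_all add: B1_def B2_def)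
  show "\<exists>L\<ge>0. \<forall>z w. norm z \<le> K \<longrightarrow> norm w \<le> K \<longrightarrow> norm (f z * g z - f w * g w) \<le> L * norm (z - w)"
  proof (intro exI[of _ "B1 * L2 + L1 * B2"] conjI allI impI)
    fix z w :: 'a assume "norm z \<le> K" "norm w \<le> K"
    then have zw: "norm z \<le> \<bar>K\<bar>" "norm w \<le> \<bar>K\<bar>" by auto
    have "f z * g z - f w * g w = f z * (g z - g w) + (f z - f w) * g w"
      by (simp add: algebra_simps)
    then have "norm (f z * g z - f w * g w) \<le> \<bar>f z\<bar> * \<bar>g z - g w\<bar> + \<bar>f z - f w\<bar> * \<bar>g w\<bar>"
      by (metis abs_mult abs_triangle_ineq real_norm_def)
    also have "\<dots> \<le> B1 * (L2 * norm (z - w)) + (L1 * norm (z - w)) * B2"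
      using B[OF zw(1)] B[OF zw(2)] L1(2)[OF zw] L2(2)[OF zw] L1(1) L2(1) \<open>0 \<le> B1\<close>
      by (intro add_mono mult_mono) auto
    finally show "norm (f z * g z - f w * g w) \<le> (B1 * L2 + L1 * B2) * norm (z - w)"
      by (simp add: algebra_simps)
  qed (use \<open>0 \<le> B1\<close> \<open>0 \<le> B2\<close> L1 L2 in simp)
qed

lemma lipschitz_on_balls_power:
  fixes f :: "'a::real_normed_vector \<Rightarrow> real"
  shows "lipschitz_on_balls f \<Longrightarrow> lipschitz_on_balls (\<lambda>z. f z ^ k)"
proof (induction k)
  case (Suc k)
  show ?case
    unfolding power_Suc by (rule lipschitz_on_balls_mult[OF Suc.prems Suc.IH[OF Suc.prems]])
qed (simp add: lipschitz_on_balls_const)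

lemma lipschitz_on_balls_minus: "lipschitz_on_balls f \<Longrightarrow> lipschitz_on_balls (\<lambda>z. - f z)"
  unfolding lipschitz_on_balls_def by (simp add: norm_minus_commute)

lemma lipschitz_on_balls_Pair:
  assumes "lipschitz_on_balls f" "lipschitz_on_balls g"
  shows "lipschitz_on_balls (\<lambda>z. (f z, g z))"
proof -
  have 1: "lipschitz_on_balls (\<lambda>z. (f z, 0 :: 'c))" and 2: "lipschitz_on_balls (\<lambda>z. (0 :: 'b, g z))"
    using assms by (simp_all add: lipschitz_on_balls_def norm_Pair)
  from lipschitz_on_balls_add[OF 1 2] show ?thesis by simp
qed

lemma lipschitz_on_balls_shifted_S: "lipschitz_on_balls (shifted_S p)"
proof -
  obtain a2 a3 a4 a6 a7 a8 a9 a10 where p: "p = (a2, a3, a4, a6, a7, a8, a9, a10)"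
    by (metis surj_pair)
  have x: "lipschitz_on_balls (\<lambda>z::real \<times> real. fst z + 1)" and y: "lipschitz_on_balls (\<lambda>z::real \<times> real. snd z)"
    by (intro lipschitz_on_balls_add lipschitz_on_balls_const lipschitz_on_balls_bounded_linear
        bounded_linear_fst bounded_linear_snd)+
  have "shifted_S p = (\<lambda>z. (- ((fst z + 1)^4 * snd z) + a2 * (fst z + 1)^3 * (snd z)^2 + a3 * (fst z + 1)^2 * (snd z)^3
        + a4 * (fst z + 1) * (snd z)^4,
      (- (1/4)) * (fst z + 1) + (- a6) * snd z + (1/4) * (fst z + 1)^5 + a6 * (fst z + 1)^4 * snd z
        + a7 * (fst z + 1)^3 * (snd z)^2 + a8 * (fst z + 1)^2 * (snd z)^3 + a9 * (fst z + 1) * (snd z)^4 + a10 * (snd z)^5))"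
    by (auto simp: p fun_eq_iff)
  then show ?thesis
    by (simp only:) (intro lipschitz_on_balls_Pair lipschitz_on_balls_add lipschitz_on_balls_mult
        lipschitz_on_balls_minus lipschitz_on_balls_power lipschitz_on_balls_const x y)
qed

text \<open>Gronwall's argument: with a Lipschitz constant L on a ball containing both orbits up to
  time s, the squared distance times e^(-2 L t) is nonincreasing and starts at 0.\<close>

lemma orbit_unique_forward:
  fixes F :: "real \<times> real \<Rightarrow> real \<times> real"
  assumes F: "lipschitz_on_balls F"
    and \<phi>: "\<And>t. (\<phi> has_vector_derivative F (\<phi> t)) (at t)" and \<psi>: "\<And>t. (\<psi> has_vector_derivative F (\<psi> t)) (at t)"
    and 0: "\<phi> 0 = \<psi> 0" and s: "0 \<le> s"
  shows "\<phi> s = \<psi> s"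
proof -
  have cont: "continuous_on {0..s} \<phi>" "continuous_on {0..s} \<psi>"
    using \<phi> \<psi> by (auto intro!: continuous_at_imp_continuous_on has_vector_derivative_continuous)
  obtain K1 where K1: "\<And>t. t \<in> {0..s} \<Longrightarrow> norm (\<phi> t) \<le> K1"
    using compact_imp_bounded[OF compact_continuous_image[OF cont(1) compact_Icc]] unfolding bounded_iff by blast
  obtain K2 where K2: "\<And>t. t \<in> {0..s} \<Longrightarrow> norm (\<psi> t) \<le> K2"
    using compact_imp_bounded[OF compact_continuous_image[OF cont(2) compact_Icc]] unfolding bounded_iff by blast
  obtain L where L: "0 \<le> L" "\<And>z w. norm z \<le> max K1 K2 \<Longrightarrow> norm w \<le> max K1 K2 \<Longrightarrow> norm (F z - F w) \<le> L * norm (z - w)"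
    using lipschitz_on_ballsE[OF F] by metis
  define d where "d t = \<phi> t - \<psi> t" for t
  define e where "e t = (d t \<bullet> d t) * exp (- (2 * L) * t)" for t
  have d': "(d has_derivative (\<lambda>h. h *\<^sub>R (F (\<phi> t) - F (\<psi> t)))) (at t)" for t
    using has_vector_derivative_diff[OF \<phi> \<psi>] unfolding has_vector_derivative_def d_def[abs_def] .
  have "((\<lambda>t. d t \<bullet> d t) has_derivative (\<lambda>h. d t \<bullet> (h *\<^sub>R (F (\<phi> t) - F (\<psi> t))) + (h *\<^sub>R (F (\<phi> t) - F (\<psi> t))) \<bullet> d t)) (at t)" for t
    by (rule has_derivative_inner[OF d' d'])
  then have dd: "((\<lambda>t. d t \<bullet> d t) has_real_derivative 2 * (d t \<bullet> (F (\<phi> t) - F (\<psi> t)))) (at t)" for t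
    by (rule has_derivative_imp_has_field_derivative) (simp add: inner_commute algebra_simps)
  have e': "(e has_real_derivative (2 * (d t \<bullet> (F (\<phi> t) - F (\<psi> t))) - 2 * L * (d t \<bullet> d t)) * exp (- (2 * L) * t)) (at t)" for t
    unfolding e_def[abs_def] by (rule derivative_eq_intros dd refl)+ (simp add: algebra_simps)
  have neg: "(2 * (d t \<bullet> (F (\<phi> t) - F (\<psi> t))) - 2 * L * (d t \<bullet> d t)) * exp (- (2 * L) * t) \<le> 0" if "0 \<le> t" "t \<le> s" for t
  proof -
    have "d t \<bullet> (F (\<phi> t) - F (\<psi> t)) \<le> norm (d t) * norm (F (\<phi> t) - F (\<psi> t))"
      by (rule norm_cauchy_schwarz)
    also have "\<dots> \<le> norm (d t) * (L * norm (d t))"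
      unfolding d_def using K1[of t] K2[of t] that by (intro mult_left_mono L(2)) auto
    also have "\<dots> = L * (d t \<bullet> d t)"
      by (simp add: dot_square_norm power2_eq_square)
    finally show ?thesis by (simp add: mult_nonpos_nonneg)
  qed
  have "e s \<le> e 0"
    by (rule DERIV_nonpos_imp_nonincreasing[OF s]) (use e' neg in blast)
  then have "e s \<le> 0" by (simp add: e_def d_def 0)
  then have "d s \<bullet> d s \<le> 0" by (simp add: e_def mult_le_0_iff)
  then have "d s \<bullet> d s = 0" using inner_ge_zero[of "d s"] by linarith
  then show ?thesis by (simp add: d_def)
qed

lemma orbit_unique:
  assumes F: "lipschitz_on_balls F" and "orbit_through F z \<phi>" "orbit_through F z \<psi>"
  shows "\<phi> = \<psi>"
proof
  fix s :: real
  have \<phi>: "(\<phi> has_vector_derivative F (\<phi> t)) (at t)" and \<psi>: "(\<psi> has_vector_derivative F (\<psi> t)) (at t)" for t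
    using assms(2,3) by (simp_all add: orbit_through_def)
  have 0: "\<phi> 0 = \<psi> 0" using assms(2,3) by (simp add: orbit_through_def)
  show "\<phi> s = \<psi> s"
  proof (cases "0 \<le> s")
    case True
    show ?thesis by (rule orbit_unique_forward[OF F \<phi> \<psi> 0 True])
  next
    case False
    have minus: "(uminus has_vector_derivative - 1) (at t)" for t :: real
      by (auto intro!: derivative_eq_intros)
    have rev: "((\<lambda>t. \<phi> (- t)) has_vector_derivative - F (\<phi> (- t))) (at t)"
      "((\<lambda>t. \<psi> (- t)) has_vector_derivative - F (\<psi> (- t))) (at t)" for t
      using vector_diff_chain_at[OF minus \<phi>] vector_diff_chain_at[OF minus \<psi>] by (simp_all add: o_def)
    have "\<phi> (- (- s)) = \<psi> (- (- s))"
      by (rule orbit_unique_forward[OF lipschitz_on_balls_minus[OF F] rev]) (use 0 False in simp_all)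
    then show ?thesis by simp
  qed
qed

lemma orbit_has_period_unique:
  assumes F: "lipschitz_on_balls F" and T: "orbit_has_period F z T" "orbit_has_period F z T'"
  shows "T = T'"
proof -
  obtain \<phi> where \<phi>: "orbit_through F z \<phi>" "0 < T" "\<forall>t. \<phi> (t + T) = \<phi> t"
    "\<forall>T'. 0 < T' \<and> T' < T \<longrightarrow> \<not> (\<forall>t. \<phi> (t + T') = \<phi> t)"
    using T(1) unfolding orbit_has_period_def by blast
  obtain \<psi> where \<psi>: "orbit_through F z \<psi>" "0 < T'" "\<forall>t. \<psi> (t + T') = \<psi> t"
    "\<forall>T. 0 < T \<and> T < T' \<longrightarrow> \<not> (\<forall>t. \<psi> (t + T) = \<psi> t)"
    using T(2) unfolding orbit_has_period_def by blast
  have "\<phi> = \<psi>" by (rule orbit_unique[OF F \<phi>(1) \<psi>(1)])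
  with \<phi> \<psi> show ?thesis by (metis linorder_neqE_linordered_idom)
qed

lemma P_eq:
  assumes "orbit_has_period (shifted_S p) (h, 0) T"
  shows "P h p = T"
  unfolding P_def
proof (rule the_equality)
  show "orbit_has_period (shifted_S p) (h, 0) T" by fact
  show "T' = T" if "orbit_has_period (shifted_S p) (h, 0) T'" for T'
    by (rule orbit_has_period_unique[OF lipschitz_on_balls_shifted_S that assms])
qed

text \<open>The elapsed time g is the antiderivative of \<open>\<tau>\<close> vanishing at 0. It
  increases strictly and gains T over each turn; \<open>\<Theta>\<close> is its inverse, the angle
  as a function of time.\<close>

lemma periodic_time_change:
  fixes \<tau> :: "real \<Rightarrow> real"
  assumes cont: "\<And>\<theta>. isCont \<tau> \<theta>" and pos: "\<And>\<theta>. 0 < \<tau> \<theta>" and per: "\<And>\<theta>. \<tau> (\<theta> + 2 * pi) = \<tau> \<theta>"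
  defines "T \<equiv> integral {0..2 * pi} \<tau>"
  obtains \<Theta> where "0 < T" "\<Theta> 0 = 0" "\<And>t. (\<Theta> has_real_derivative inverse (\<tau> (\<Theta> t))) (at t)"
    "\<And>t. \<Theta> (t + T) = \<Theta> t + 2 * pi" "\<And>t. 0 < t \<Longrightarrow> t < T \<Longrightarrow> 0 < \<Theta> t \<and> \<Theta> t < 2 * pi"
proof -
  obtain f where f: "\<And>x. (f has_vector_derivative \<tau> x) (at x)"
    using einterval_antiderivative[of "-\<infinity>" "\<infinity>" \<tau>] cont by auto
  define g where "g \<theta> = f \<theta> - f 0" for \<theta>
  have g': "(g has_real_derivative \<tau> x) (at x)" for x
    unfolding g_def[abs_def] using f[of x] by (auto intro!: derivative_eq_intros simp: has_real_derivative_iff_has_vector_derivative)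
  have g0: "g 0 = 0" by (simp add: g_def)
  have mono: "g x < g y" if "x < y" for x y
    using that g' pos by (metis DERIV_pos_imp_increasing)
  then have inj: "g x = g y \<Longrightarrow> x = y" for x y
    by (metis less_irrefl linorder_neqE_linordered_idom)
  have less_iff: "g x < g y \<longleftrightarrow> x < y" for x y
    using mono by (metis less_asym linorder_neqE_linordered_idom)
  have "(\<tau> has_integral g (2 * pi) - g 0) {0..2 * pi}"
    by (rule fundamental_theorem_of_calculus)
      (use g' in \<open>auto simp: has_real_derivative_iff_has_vector_derivative intro: has_vector_derivative_at_within\<close>)
  then have gT: "g (2 * pi) = T" by (simp add: T_def g0 integral_unique)
  have T: "0 < T" using mono[of 0 "2 * pi"] gT g0 by simp
  have gper: "g (x + 2 * pi) = g x + T" for x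
  proof -
    have "((\<lambda>x. g (x + 2 * pi) - g x) has_real_derivative 0) (at x)" for x
    proof -
      have "((\<lambda>x. g (x + 2 * pi)) has_real_derivative \<tau> (x + 2 * pi)) (at x)"
        using g'[of "x + 2 * pi"] by (simp add: DERIV_shift)
      from DERIV_diff[OF this g'[of x]] show ?thesis by (simp add: per)
    qed
    then have "g (x + 2 * pi) - g x = g (0 + 2 * pi) - g 0"
      using DERIV_isconst_all[of "\<lambda>x. g (x + 2 * pi) - g x" x 0] by blast
    then show ?thesis by (simp add: gT g0)
  qed
  \<comment> \<open>The values at multiples of 2 \<pi> are unbounded in both directions, which makes
    g onto.\<close>
  have gk: "g (2 * pi * real k) = T * real k" "g (- (2 * pi * real k)) = - (T * real k)" for k
  proof (induction k)
    case (Suc k)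
    have "2 * pi * real (Suc k) = 2 * pi * real k + 2 * pi" by (simp add: algebra_simps)
    then show "g (2 * pi * real (Suc k)) = T * real (Suc k)"
      using Suc(1) gper[of "2 * pi * real k"] by (simp add: algebra_simps)
    have "- (2 * pi * real (Suc k)) + 2 * pi = - (2 * pi * real k)" by (simp add: algebra_simps)
    then show "g (- (2 * pi * real (Suc k))) = - (T * real (Suc k))"
      using Suc(2) gper[of "- (2 * pi * real (Suc k))"] by (simp add: algebra_simps)
  qed (simp_all add: g0)
  have gcont: "isCont g x" for x using g' DERIV_isCont by blast
  have surj: "\<exists>x. g x = t" for t
  proof -
    obtain k where "\<bar>t\<bar> / T < real k" using reals_Archimedean2 by blast
    then have "\<bar>t\<bar> < T * real k" using T by (simp add: field_simps)
    then have "g (- (2 * pi * real k)) \<le> t" "t \<le> g (2 * pi * real k)" by (auto simp: gk)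
    then show ?thesis
      using IVT[of g "- (2 * pi * real k)" t "2 * pi * real k"] gcont by auto
  qed
  define \<Theta> where "\<Theta> = inv g"
  have g\<Theta>: "g (\<Theta> t) = t" for t using surj by (simp add: \<Theta>_def f_inv_into_f image_iff) (metis f_inv_into_f rangeI)
  have \<Theta>g: "\<Theta> (g x) = x" for x using g\<Theta> inj by blast
  have "isCont \<Theta> t" for t
    using isCont_inverse_function2[of "\<Theta> t - 1" "\<Theta> t" "\<Theta> t + 1" \<Theta> g] gcont \<Theta>g g\<Theta>[of t] by simp
  then have \<Theta>': "(\<Theta> has_real_derivative inverse (\<tau> (\<Theta> t))) (at t)" for t
    using DERIV_inverse_function[of g "\<tau> (\<Theta> t)" \<Theta> t "t - 1" "t + 1"] g' pos[of "\<Theta> t"] g\<Theta> by simp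
  show ?thesis
  proof (rule that[OF T])
    show "\<Theta> 0 = 0" using \<Theta>g[of 0] g0 by simp
    show "(\<Theta> has_real_derivative inverse (\<tau> (\<Theta> t))) (at t)" for t by (rule \<Theta>')
    show "\<Theta> (t + T) = \<Theta> t + 2 * pi" for t
      using \<Theta>g[of "\<Theta> t + 2 * pi"] by (simp add: gper g\<Theta>)
    show "0 < \<Theta> t \<and> \<Theta> t < 2 * pi" if "0 < t" "t < T" for t
      using that less_iff[of 0 "\<Theta> t"] less_iff[of "\<Theta> t" "2 * pi"] by (simp add: g\<Theta> g0 gT)
  qed
qed

subsection \<open>The orbits and their periods\<close>

lemma holomorphic_real_restrict:
  assumes f: "f holomorphic_on ball 0 d" and real: "\<And>x. x \<in> ball 0 d \<Longrightarrow> x \<in> \<real> \<Longrightarrow> f x \<in> \<real>"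
    and x: "\<bar>x\<bar> < d"
  shows "f (of_real x) = of_real (Re (f (of_real x)))"
    and "deriv f (of_real x) = of_real (Re (deriv f (of_real x)))"
    and "((\<lambda>x. Re (f (of_real x))) has_real_derivative Re (deriv f (of_real x))) (at x)"
proof -
  have xb: "complex_of_real x \<in> ball 0 d" using x by simp
  have "(f has_field_derivative deriv f (of_real x)) (at (of_real x))"
    by (rule holomorphic_derivI[OF f open_ball xb])
  then have vd: "((\<lambda>x. f (of_real x)) has_vector_derivative deriv f (of_real x)) (at x)"
    by (rule has_vector_derivative_real_field)
  have Re': "((\<lambda>x. Re (f (of_real x))) has_vector_derivative Re (deriv f (of_real x))) (at x)"
    by (rule bounded_linear.has_vector_derivative[OF bounded_linear_Re vd])
  have Im': "((\<lambda>x. Im (f (of_real x))) has_vector_derivative Im (deriv f (of_real x))) (at x)"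
    by (rule bounded_linear.has_vector_derivative[OF bounded_linear_Im vd])
  show "f (of_real x) = of_real (Re (f (of_real x)))"
    using real[OF xb] by (simp add: complex_is_Real_iff complex_eq_iff)
  show "((\<lambda>x. Re (f (of_real x))) has_real_derivative Re (deriv f (of_real x))) (at x)"
    using Re' by (simp add: has_real_derivative_iff_has_vector_derivative)
  have "((\<lambda>x. Im (f (of_real x))) has_vector_derivative 0) (at x)"
  proof (rule has_vector_derivative_transform_within_open[of "\<lambda>x. 0" 0 x "{- d<..<d}"])
    fix y assume "y \<in> {- d<..<d}"
    then have "complex_of_real y \<in> ball 0 d" by auto
    from real[OF this] show "0 = Im (f (of_real y))" by (simp add: complex_is_Real_iff)
  qed (use x in auto)
  then have "Im (deriv f (of_real x)) = 0"
    using Im' vector_derivative_unique_at by blast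
  then show "deriv f (of_real x) = of_real (Re (deriv f (of_real x)))"
    by (simp add: complex_eq_iff)
qed

lemma of_real_half_eq: "complex_of_real (2 * s * d) = of_real (2 * x) \<Longrightarrow> d * s = x"
proof -
  assume "complex_of_real (2 * s * d) = of_real (2 * x)"
  then have "2 * s * d = 2 * x" by (simp only: of_real_eq_iff)
  then show "d * s = x" by (simp add: mult.commute)
qed

text \<open>The factors 3/2, 2, 5/2 make -X'/X^5 half the derivative of u^2 Y1(u). With 4 n = 1 +
  a7, the relations of \<open>Lambda1\<close> then say that the nonlinear terms in u' form the
  multiple 4 n X^4 of the same function u^2 Y1(u).\<close>

fun param_of :: "coeffs \<Rightarrow> param" where
  "param_of (a, b, c, n) = (3/2 * a, 2 * b, 5/2 * c, 0, 4 * n - 1,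
     1/3 * (3/2 * a) * (1 - 2 * (4 * n - 1)), 1/2 * (2 * b) * (1 - (4 * n - 1)), 1/5 * (5/2 * c) * (3 - 2 * (4 * n - 1)))"

text \<open>The vector field in the variables \<open>X = e\<^sup>-\<^sup>q\<^sup>/\<^sup>4\<close> and \<open>u = y / X\<close>.\<close>

lemma shifted_S_param_of:
  "shifted_S (param_of (a, b, c, n)) (X - 1, u * X) =
    (- (X ^ 5 * (u - 3/2 * a * u ^ 2 - 2 * b * u ^ 3 - 5/2 * c * u ^ 4)),
     X * (- 1/4 * (1 - X ^ 4) + 4 * n * X ^ 4 * (u ^ 2 * (1 - a * u - b * u ^ 2 - c * u ^ 3)))
       - u * (X ^ 5 * (u - 3/2 * a * u ^ 2 - 2 * b * u ^ 3 - 5/2 * c * u ^ 4)))"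
  by (simp add: algebra_simps eval_nat_numeral)

context branches
begin

definition qr :: "coeffs \<Rightarrow> real \<Rightarrow> real" where "qr \<mu> x = Re (q (of_real x) \<mu>)"
definition qd :: "coeffs \<Rightarrow> real \<Rightarrow> real" where "qd \<mu> x = Re (deriv (\<lambda>x. q x \<mu>) (of_real x))"
definition Ur :: "coeffs \<Rightarrow> real \<Rightarrow> real" where "Ur \<mu> x = Re (U (of_real x) \<mu>)"
definition Ud :: "coeffs \<Rightarrow> real \<Rightarrow> real" where "Ud \<mu> x = Re (deriv (\<lambda>x. U x \<mu>) (of_real x))"

context
  fixes \<mu> :: coeffs
  assumes \<mu>: "\<mu> \<in> N"
begin

lemma
  assumes "\<bar>x\<bar> < \<delta>"
  shows q_of_real: "q (of_real x) \<mu> = of_real (qr \<mu> x)"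
    and deriv_q_of_real: "deriv (\<lambda>x. q x \<mu>) (of_real x) = of_real (qd \<mu> x)"
    and qr_deriv: "(qr \<mu> has_real_derivative qd \<mu> x) (at x)"
    and U_of_real: "U (of_real x) \<mu> = of_real (Ur \<mu> x)"
    and deriv_U_of_real: "deriv (\<lambda>x. U x \<mu>) (of_real x) = of_real (Ud \<mu> x)"
    and Ur_deriv: "(Ur \<mu> has_real_derivative Ud \<mu> x) (at x)"
  using holomorphic_real_restrict[OF jhol_holomorphic[OF q_jhol \<mu>] q_real[OF _ _ \<mu>] assms]
    holomorphic_real_restrict[OF jhol_holomorphic[OF U_jhol \<mu>] U_real[OF _ _ \<mu>] assms]
  unfolding qr_def[abs_def] qd_def Ur_def[abs_def] Ud_def by simp_all

lemma qd_pos: "\<bar>x\<bar> < \<delta> \<Longrightarrow> 0 < qd \<mu> x" and Ud_pos: "\<bar>x\<bar> < \<delta> \<Longrightarrow> 0 < Ud \<mu> x"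
  using q_deriv_close[of "of_real x" \<mu>] U_deriv_close[of "of_real x" \<mu>] \<mu>
    abs_Re_le_cmod[of "deriv (\<lambda>x. q x \<mu>) (of_real x) - 1"] abs_Re_le_cmod[of "deriv (\<lambda>x. U x \<mu>) (of_real x) - 1"]
  by (auto simp: qd_def Ud_def)

text \<open>Half the derivative of the identity q(x)^2 Y2(q(x)) = x^2.\<close>

lemma qd_eq:
  assumes x: "\<bar>x\<bar> < \<delta>"
  shows "qd \<mu> x * ((exp (qr \<mu> x) - 1) * exp (- 2 * nu \<mu> * qr \<mu> x)) = x"
proof -
  have xb: "complex_of_real x \<in> ball 0 \<delta>" using x by simp
  have "((\<lambda>x. q x \<mu>) has_field_derivative of_real (qd \<mu> x)) (at (of_real x))"
    unfolding deriv_q_of_real[OF x, symmetric] by (rule holomorphic_derivI[OF jhol_holomorphic[OF q_jhol \<mu>] open_ball xb])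
  from DERIV_chain2[OF Y2_deriv this, of \<mu>]
  have "((\<lambda>x. q x \<mu> ^ 2 * Y2 (q x \<mu>) \<mu>) has_field_derivative
     2 * ((exp (q (of_real x) \<mu>) - 1) * exp (of_real (- 2 * nu \<mu>) * q (of_real x) \<mu>)) * of_real (qd \<mu> x)) (at (of_real x))" .
  moreover have "((\<lambda>x. q x \<mu> ^ 2 * Y2 (q x \<mu>) \<mu>) has_field_derivative 2 * of_real x) (at (of_real x))"
  proof (rule has_field_derivative_transform_within_open[OF _ open_ball xb])
    show "((\<lambda>x. x ^ 2) has_field_derivative 2 * complex_of_real x) (at (of_real x))"
      by (auto intro!: derivative_eq_intros)
  qed (use q_eq \<mu> in auto)
  ultimately have "2 * ((exp (q (of_real x) \<mu>) - 1) * exp (of_real (- 2 * nu \<mu>) * q (of_real x) \<mu>)) * of_real (qd \<mu> x) = 2 * complex_of_real x"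
    by (rule DERIV_unique)
  then have "complex_of_real (2 * ((exp (qr \<mu> x) - 1) * exp (- 2 * nu \<mu> * qr \<mu> x)) * qd \<mu> x) = of_real (2 * x)"
    unfolding q_of_real[OF x] of_real_mult[symmetric] exp_of_real
    by (simp only: of_real_mult of_real_diff of_real_1 of_real_numeral)
  then show ?thesis by (rule of_real_half_eq)
qed

lemma Ud_eq:
  assumes x: "\<bar>x\<bar> < \<delta>" and abc: "\<mu> = (a, b, c, n)"
  shows "Ud \<mu> x * (Ur \<mu> x - 3/2 * a * Ur \<mu> x ^ 2 - 2 * b * Ur \<mu> x ^ 3 - 5/2 * c * Ur \<mu> x ^ 4) = x"
    and "Ur \<mu> x ^ 2 * (1 - a * Ur \<mu> x - b * Ur \<mu> x ^ 2 - c * Ur \<mu> x ^ 3) = x ^ 2"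
proof -
  have xb: "complex_of_real x \<in> ball 0 \<delta>" using x by simp
  have "((\<lambda>x. U x \<mu>) has_field_derivative of_real (Ud \<mu> x)) (at (of_real x))"
    unfolding deriv_U_of_real[OF x, symmetric] by (rule holomorphic_derivI[OF jhol_holomorphic[OF U_jhol \<mu>] open_ball xb])
  from DERIV_chain2[OF Y1_deriv this, of a b c n]
  have "((\<lambda>x. U x \<mu> ^ 2 * Y1 (U x \<mu>) \<mu>) has_field_derivative
     2 * (U (of_real x) \<mu> - 3/2 * of_real a * U (of_real x) \<mu> ^ 2 - 2 * of_real b * U (of_real x) \<mu> ^ 3
       - 5/2 * of_real c * U (of_real x) \<mu> ^ 4) * of_real (Ud \<mu> x)) (at (of_real x))"
    unfolding abc .
  moreover have "((\<lambda>x. U x \<mu> ^ 2 * Y1 (U x \<mu>) \<mu>) has_field_derivative 2 * of_real x) (at (of_real x))"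
  proof (rule has_field_derivative_transform_within_open[OF _ open_ball xb])
    show "((\<lambda>x. x ^ 2) has_field_derivative 2 * complex_of_real x) (at (of_real x))"
      by (auto intro!: derivative_eq_intros)
  qed (use U_eq \<mu> in auto)
  ultimately have "2 * (U (of_real x) \<mu> - 3/2 * of_real a * U (of_real x) \<mu> ^ 2 - 2 * of_real b * U (of_real x) \<mu> ^ 3
       - 5/2 * of_real c * U (of_real x) \<mu> ^ 4) * of_real (Ud \<mu> x) = 2 * complex_of_real x"
    by (rule DERIV_unique)
  then have "complex_of_real (2 * (Ur \<mu> x - 3/2 * a * Ur \<mu> x ^ 2 - 2 * b * Ur \<mu> x ^ 3 - 5/2 * c * Ur \<mu> x ^ 4) * Ud \<mu> x) = of_real (2 * x)"
    unfolding U_of_real[OF x] by simp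
  then show "Ud \<mu> x * (Ur \<mu> x - 3/2 * a * Ur \<mu> x ^ 2 - 2 * b * Ur \<mu> x ^ 3 - 5/2 * c * Ur \<mu> x ^ 4) = x"
    by (rule of_real_half_eq)
  have "complex_of_real (Ur \<mu> x ^ 2 * (1 - a * Ur \<mu> x - b * Ur \<mu> x ^ 2 - c * Ur \<mu> x ^ 3)) = of_real (x ^ 2)"
    using U_eq[OF xb \<mu>] unfolding U_of_real[OF x] by (simp add: Y1_def abc)
  then show "Ur \<mu> x ^ 2 * (1 - a * Ur \<mu> x - b * Ur \<mu> x ^ 2 - c * Ur \<mu> x ^ 3) = x ^ 2"
    by (simp only: of_real_eq_iff)
qed

lemma qr_inj:
  assumes "\<bar>x\<bar> < \<delta>" "\<bar>y\<bar> < \<delta>" "qr \<mu> x = qr \<mu> y"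
  shows "x = y"
proof -
  have less: "qr \<mu> x < qr \<mu> y" if "x < y" "\<bar>x\<bar> < \<delta>" "\<bar>y\<bar> < \<delta>" for x y
    using that(1)
  proof (rule DERIV_pos_imp_increasing)
    fix z assume "x \<le> z" "z \<le> y"
    then have "\<bar>z\<bar> < \<delta>" using that by linarith
    then show "\<exists>y. (qr \<mu> has_real_derivative y) (at z) \<and> 0 < y"
      using qr_deriv qd_pos by blast
  qed
  show ?thesis
    using less[of x y] less[of y x] assms by (metis less_irrefl linorder_neqE_linordered_idom)
qed

definition tau_speed :: "real \<Rightarrow> real \<Rightarrow> real" where
  "tau_speed \<rho> \<theta> = Re (kern (of_real \<rho>) (\<mu>, \<theta>))"

definition rad :: "real \<Rightarrow> real \<Rightarrow> real" where
  "rad \<rho> \<theta> = - (\<rho> / 4 * sin \<theta>) * exp (nu \<mu> * qr \<mu> (\<rho> * cos \<theta>))"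

context
  fixes \<rho> :: real
  assumes \<rho>: "\<bar>\<rho>\<bar> < \<delta>"
begin

lemma cos_bound: "\<bar>\<rho> * cos \<theta>\<bar> < \<delta>"
  using cos_mult_mem[of "of_real \<rho>" \<delta> \<theta>] \<rho> by (simp flip: of_real_mult)

lemma rad_of_real:
  "- (of_real \<rho> / 4 * of_real (sin \<theta>)) * exp (of_real (nu \<mu>) * q (of_real \<rho> * of_real (cos \<theta>)) \<mu>) = complex_of_real (rad \<rho> \<theta>)"
  using q_of_real[OF cos_bound, of \<theta>] by (simp add: rad_def exp_of_real[symmetric])

lemma rad_bound: "\<bar>rad \<rho> \<theta>\<bar> < \<delta>"
  using radius_mem[of "of_real \<rho>" \<mu> \<theta>] \<rho> \<mu> unfolding rad_of_real by simp

lemma kern_of_real: "kern (of_real \<rho>) (\<mu>, \<theta>) = of_real (tau_speed \<rho> \<theta>)"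
  and tau_speed_eq: "tau_speed \<rho> \<theta> = qd \<mu> (\<rho> * cos \<theta>) * exp ((1 - nu \<mu>) * qr \<mu> (\<rho> * cos \<theta>)) * Ud \<mu> (rad \<rho> \<theta>)"
proof -
  have "kern (of_real \<rho>) (\<mu>, \<theta>) =
    of_real (qd \<mu> (\<rho> * cos \<theta>) * exp ((1 - nu \<mu>) * qr \<mu> (\<rho> * cos \<theta>)) * Ud \<mu> (rad \<rho> \<theta>))"
    unfolding kern_def fst_conv snd_conv rad_of_real deriv_U_of_real[OF rad_bound]
    using q_of_real[OF cos_bound, of \<theta>] deriv_q_of_real[OF cos_bound, of \<theta>]
    by (simp add: exp_of_real[symmetric])
  then show "tau_speed \<rho> \<theta> = qd \<mu> (\<rho> * cos \<theta>) * exp ((1 - nu \<mu>) * qr \<mu> (\<rho> * cos \<theta>)) * Ud \<mu> (rad \<rho> \<theta>)"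
    "kern (of_real \<rho>) (\<mu>, \<theta>) = of_real (tau_speed \<rho> \<theta>)"
    by (simp_all add: tau_speed_def)
qed

lemma tau_speed_pos: "0 < tau_speed \<rho> \<theta>"
  unfolding tau_speed_eq using qd_pos[OF cos_bound] Ud_pos[OF rad_bound] by (intro mult_pos_pos) auto

lemma tau_speed_isCont: "isCont (tau_speed \<rho>) \<theta>"
proof -
  have "continuous_on UNIV (\<lambda>\<theta>. kern (of_real \<rho>) (\<mu>, \<theta>))"
    by (rule kern_continuous) (use \<rho> \<mu> in auto)
  then have "continuous_on UNIV (tau_speed \<rho>)"
    unfolding tau_speed_def[abs_def] by (intro continuous_intros)
  then show ?thesis by (simp add: continuous_on_eq_continuous_at)
qed

lemma T_of_real: "T (of_real \<rho>) \<mu> = of_real (integral {0..2 * pi} (tau_speed \<rho>))"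
proof -
  have "tau_speed \<rho> integrable_on {0..2 * pi}"
    by (intro integrable_continuous_real continuous_at_imp_continuous_on ballI tau_speed_isCont)
  from has_integral_linear[OF integrable_integral[OF this] bounded_linear_of_real]
  have "((\<lambda>\<theta>. complex_of_real (tau_speed \<rho> \<theta>)) has_integral of_real (integral {0..2 * pi} (tau_speed \<rho>))) {0..2 * pi}"
    by (simp add: o_def)
  then show ?thesis unfolding T_def kern_of_real by (rule integral_unique)
qed

text \<open>The solution is constructed: the angle runs with speed inverse to
  \<open>tau_speed\<close>, and X and u are read off from it through q and U. At angle 0 the
  argument of U vanishes, so the orbit starts on the axis, at q =
  \<open>qr \<mu> \<rho>\<close>.\<close>

lemma orbit_period:
  assumes "\<rho> \<noteq> 0"
  shows "orbit_has_period (shifted_S (param_of \<mu>)) (exp (- qr \<mu> \<rho> / 4) - 1, 0) (Re (T (of_real \<rho>) \<mu>))"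
proof -
  obtain a b c n where abc: "\<mu> = (a, b, c, n)" by (cases \<mu>)
  then have n: "nu \<mu> = n" by (simp add: nu_def)
  define Tr where "Tr = integral {0..2 * pi} (tau_speed \<rho>)"
  have per: "tau_speed \<rho> (\<theta> + 2 * pi) = tau_speed \<rho> \<theta>" for \<theta>
    unfolding tau_speed_eq by (simp add: rad_def)
  obtain \<Theta> where \<Theta>: "0 < Tr" "\<Theta> 0 = 0" "\<And>t. (\<Theta> has_real_derivative inverse (tau_speed \<rho> (\<Theta> t))) (at t)"
    "\<And>t. \<Theta> (t + Tr) = \<Theta> t + 2 * pi" "\<And>t. 0 < t \<Longrightarrow> t < Tr \<Longrightarrow> 0 < \<Theta> t \<and> \<Theta> t < 2 * pi"
    using periodic_time_change[OF tau_speed_isCont tau_speed_pos per] unfolding Tr_def by blast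
  define x where "x t = \<rho> * cos (\<Theta> t)" for t
  define r where "r t = rad \<rho> (\<Theta> t)" for t
  define Q where "Q t = qr \<mu> (x t)" for t
  define X where "X t = exp (- Q t / 4)" for t
  define u where "u t = Ur \<mu> (r t)" for t
  define \<phi> where "\<phi> t = (X t - 1, u t * X t)" for t
  define g where "g t = u t - 3/2 * a * u t ^ 2 - 2 * b * u t ^ 3 - 5/2 * c * u t ^ 4" for t
  have xb: "\<bar>x t\<bar> < \<delta>" for t unfolding x_def by (rule cos_bound)
  have rb: "\<bar>r t\<bar> < \<delta>" for t unfolding r_def by (rule rad_bound)
  have X4: "X t ^ 4 = exp (- Q t)" for t
    by (simp add: X_def flip: exp_of_nat_mult)
  have r_eq: "r t = - (\<rho> / 4 * sin (\<Theta> t)) * exp (n * Q t)" for t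
    by (simp add: r_def rad_def Q_def x_def n)
  have Ud: "Ud \<mu> (r t) * g t = r t" "u t ^ 2 * (1 - a * u t - b * u t ^ 2 - c * u t ^ 3) = r t ^ 2" for t
    using Ud_eq[OF rb abc, of t] by (simp_all add: g_def u_def)
  have Udp: "0 < Ud \<mu> (r t)" and qdp: "0 < qd \<mu> (x t)" for t
    by (rule Ud_pos[OF rb]) (rule qd_pos[OF xb])
  have speed: "tau_speed \<rho> (\<Theta> t) = qd \<mu> (x t) * exp (Q t - n * Q t) * Ud \<mu> (r t)" for t
    unfolding tau_speed_eq by (simp add: x_def r_def Q_def n algebra_simps)
  have x': "(x has_real_derivative - (\<rho> * sin (\<Theta> t)) * inverse (tau_speed \<rho> (\<Theta> t))) (at t)" for t
    unfolding x_def[abs_def] by (rule derivative_eq_intros \<Theta>(3) refl)+ simp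
  have Q': "(Q has_real_derivative 4 * exp (- Q t) * g t) (at t)" for t
  proof -
    have "(Q has_real_derivative qd \<mu> (x t) * (- (\<rho> * sin (\<Theta> t)) * inverse (tau_speed \<rho> (\<Theta> t)))) (at t)"
      unfolding Q_def[abs_def] by (rule DERIV_chain2[OF qr_deriv[OF xb] x'])
    also have "qd \<mu> (x t) * (- (\<rho> * sin (\<Theta> t)) * inverse (tau_speed \<rho> (\<Theta> t))) = 4 * exp (- Q t) * g t"
    proof -
      have "- (\<rho> * sin (\<Theta> t)) = 4 * r t * exp (- (n * Q t))"
        by (simp add: r_eq exp_minus)
      also have "r t = Ud \<mu> (r t) * g t" using Ud by simp
      finally have s: "- (\<rho> * sin (\<Theta> t)) = 4 * (Ud \<mu> (r t) * g t) * exp (- (n * Q t))" .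
      have "exp (- (n * Q t)) = exp (- Q t) * exp (Q t - n * Q t)"
        by (simp flip: exp_add)
      then show ?thesis
        unfolding s speed using Udp[of t] qdp[of t] by (simp add: field_simps)
    qed
    finally show ?thesis .
  qed
  have X': "(X has_real_derivative - (X t ^ 5 * g t)) (at t)" for t
  proof -
    have "X t ^ 5 = X t * exp (- Q t)" by (simp add: X4[symmetric] eval_nat_numeral)
    moreover have "(X has_real_derivative exp (- Q t / 4) * (- (4 * exp (- Q t) * g t) / 4)) (at t)"
      unfolding X_def[abs_def] by (rule DERIV_chain2[OF DERIV_exp DERIV_cdivide[OF DERIV_minus[OF Q']]])
    ultimately show ?thesis by (simp add: X_def mult_ac)
  qed
  have r': "(r has_real_derivative - (x t / 4) * exp (n * Q t) * inverse (tau_speed \<rho> (\<Theta> t)) + n * (4 * exp (- Q t) * g t) * r t) (at t)" for t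
    unfolding r_eq[abs_def] by (rule derivative_eq_intros \<Theta>(3) Q' refl)+ (simp add: x_def r_eq algebra_simps)
  have u': "(u has_real_derivative - 1/4 * (1 - X t ^ 4) + 4 * n * X t ^ 4 * (u t ^ 2 * (1 - a * u t - b * u t ^ 2 - c * u t ^ 3))) (at t)" for t
  proof -
    have "(u has_real_derivative Ud \<mu> (r t) * (- (x t / 4) * exp (n * Q t) * inverse (tau_speed \<rho> (\<Theta> t)) + n * (4 * exp (- Q t) * g t) * r t)) (at t)"
      unfolding u_def[abs_def] by (rule DERIV_chain2[OF Ur_deriv[OF rb] r'])
    also have "Ud \<mu> (r t) * (- (x t / 4) * exp (n * Q t) * inverse (tau_speed \<rho> (\<Theta> t)) + n * (4 * exp (- Q t) * g t) * r t)
      = - (1/4) * (x t / qd \<mu> (x t)) * (exp (n * Q t) * inverse (exp (Q t - n * Q t))) + 4 * n * exp (- Q t) * ((Ud \<mu> (r t) * g t) * r t)"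
      unfolding speed using Udp[of t] qdp[of t] by (simp add: field_simps)
    \<comment> \<open>By \<open>qd_eq\<close>, x / q'(x) equals (e^q - 1) e^(-2 n q); the factor
      e^(-2 n q) cancels against the exponentials from r and the speed.\<close>
    also have "x t / qd \<mu> (x t) = (exp (Q t) - 1) * exp (- 2 * n * Q t)"
      using qd_eq[OF xb, of t] qdp[of t] by (simp add: Q_def n field_simps)
    also have "exp (n * Q t) * inverse (exp (Q t - n * Q t)) = exp (- Q t) * exp (2 * n * Q t)"
      by (simp flip: exp_minus exp_add)
    also have "(Ud \<mu> (r t) * g t) * r t = u t ^ 2 * (1 - a * u t - b * u t ^ 2 - c * u t ^ 3)"
      using Ud by (simp add: power2_eq_square)
    also have "- (1/4) * ((exp (Q t) - 1) * exp (- 2 * n * Q t)) * (exp (- Q t) * exp (2 * n * Q t)) = - 1/4 * (1 - exp (- Q t))"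
    proof -
      have "exp (- 2 * n * Q t) * exp (2 * n * Q t) = 1" "exp (Q t) * exp (- Q t) = 1"
        by (simp_all flip: exp_add)
      then show ?thesis by (simp add: field_simps) 
    qed
    finally show ?thesis by (simp add: X4)
  qed
  have orbit: "orbit_through (shifted_S (param_of \<mu>)) (exp (- qr \<mu> \<rho> / 4) - 1, 0) \<phi>"
    unfolding orbit_through_def
  proof (intro conjI allI)
    have "r 0 = 0" by (simp add: r_def rad_def \<Theta>(2))
    moreover have "Ur \<mu> 0 = 0" using U_0[OF \<mu>] by (simp add: Ur_def)
    ultimately show "\<phi> 0 = (exp (- qr \<mu> \<rho> / 4) - 1, 0)"
      by (simp add: \<phi>_def X_def Q_def x_def u_def \<Theta>(2))
    fix t
    have "((\<lambda>t. (X t - 1, u t * X t)) has_vector_derivative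
      (- (X t ^ 5 * g t),
       X t * (- 1/4 * (1 - X t ^ 4) + 4 * n * X t ^ 4 * (u t ^ 2 * (1 - a * u t - b * u t ^ 2 - c * u t ^ 3))) - u t * (X t ^ 5 * g t))) (at t)"
      by (intro has_vector_derivative_Pair; unfold has_real_derivative_iff_has_vector_derivative[symmetric])
        (rule derivative_eq_intros X' u' refl | simp)+
    then show "(\<phi> has_vector_derivative shifted_S (param_of \<mu>) (\<phi> t)) (at t)"
      unfolding \<phi>_def[abs_def] abc shifted_S_param_of g_def .
  qed
  have per: "\<phi> (t + Tr) = \<phi> t" for t
    by (simp add: \<phi>_def X_def Q_def x_def u_def r_def rad_def \<Theta>(4))
  \<comment> \<open>An earlier return would restore q, hence x and the cosine of the angle, while
    the angle is still strictly between 0 and 2 \<pi>.\<close>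
  have least: "\<not> (\<forall>t. \<phi> (t + T') = \<phi> t)" if T': "0 < T'" "T' < Tr" for T'
  proof
    assume "\<forall>t. \<phi> (t + T') = \<phi> t"
    then have "\<phi> (0 + T') = \<phi> 0" by blast
    then have "Q T' = Q 0" by (simp add: \<phi>_def X_def)
    then have "x T' = x 0" using qr_inj[OF xb xb] by (simp add: Q_def)
    then have c1: "cos (\<Theta> T') = 1" using assms by (simp add: x_def \<Theta>(2))
    from \<Theta>(5)[OF T'] have th: "0 < \<Theta> T'" "\<Theta> T' < 2 * pi" by auto
    show False
      using c1 th cos_one_2pi_int[of "\<Theta> T'"] by (auto simp: mult_less_cancel_right zero_less_mult_iff)
  qed
  have "Re (T (of_real \<rho>) \<mu>) = Tr" unfolding T_of_real Tr_def by simp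
  then show ?thesis
    unfolding orbit_has_period_def using orbit per least \<Theta>(1) by auto
qed

end

end

end

section \<open>The derivative of the period with respect to h\<close>

context branches
begin

definition D :: "nat \<Rightarrow> real \<Rightarrow> coeffs \<Rightarrow> real" where
  "D k \<rho> \<mu> = Re ((deriv ^^ k) (\<lambda>w. T w \<mu>) (of_real \<rho>))"

lemma D_deriv:
  assumes "\<mu> \<in> N" "\<bar>\<rho>\<bar> < \<delta>"
  shows "((\<lambda>\<rho>. D k \<rho> \<mu>) has_real_derivative D (Suc k) \<rho> \<mu>) (at \<rho>)"
proof -
  have "(deriv ^^ k) (\<lambda>w. T w \<mu>) holomorphic_on ball 0 \<delta>"
    by (rule holomorphic_higher_deriv[OF jhol_holomorphic[OF T_jhol assms(1)] open_ball])
  then have "((deriv ^^ k) (\<lambda>w. T w \<mu>) has_field_derivative (deriv ^^ Suc k) (\<lambda>w. T w \<mu>) (of_real \<rho>)) (at (of_real \<rho>))"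
    using holomorphic_derivI[OF _ open_ball, of _ 0 \<delta> "of_real \<rho>"] assms(2) by simp
  from bounded_linear.has_vector_derivative[OF bounded_linear_Re has_vector_derivative_real_field[OF this]]
  show ?thesis
    unfolding D_def[abs_def] has_real_derivative_iff_has_vector_derivative .
qed

lemma D_continuous: "continuous_on ({- \<delta><..<\<delta>} \<times> N) (\<lambda>z. D k (fst z) (snd z))"
proof -
  have "continuous_on ({- \<delta><..<\<delta>} \<times> N) (\<lambda>z. (\<lambda>z. (deriv ^^ k) (\<lambda>w. T w (snd z)) (fst z)) (complex_of_real (fst z), snd z))"
    by (rule continuous_on_compose2[OF jhol_continuous[OF jhol_higher_deriv[OF T_jhol]]])
      (auto intro!: continuous_intros)
  then show ?thesis
    unfolding D_def by (intro continuous_intros) simp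
qed

lemma D_parity:
  assumes "\<mu> \<in> N" "\<bar>\<rho>\<bar> < \<delta>"
  shows "D k (- \<rho>) \<mu> = (- 1) ^ k * D k \<rho> \<mu>"
  using assms(2)
proof (induction k arbitrary: \<rho>)
  case 0
  then show ?case using T_even[of "of_real \<rho>" \<mu>] assms(1) by (simp add: D_def)
next
  case (Suc k)
  have "((\<lambda>\<rho>. D k \<rho> \<mu>) has_real_derivative D (Suc k) (- \<rho>) \<mu>) (at (- \<rho>))"
    using Suc.prems by (intro D_deriv assms(1)) simp
  moreover have "(uminus has_real_derivative - 1) (at \<rho>)"
    by (auto intro!: derivative_eq_intros)
  ultimately have "((\<lambda>\<rho>. D k (- \<rho>) \<mu>) has_real_derivative D (Suc k) (- \<rho>) \<mu> * - 1) (at \<rho>)"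
    by (rule DERIV_chain2[where f = "\<lambda>\<rho>. D k \<rho> \<mu>" and g = uminus])
  moreover have "((\<lambda>\<rho>. D k (- \<rho>) \<mu>) has_real_derivative (- 1) ^ k * D (Suc k) \<rho> \<mu>) (at \<rho>)"
  proof (rule has_field_derivative_transform_within_open[of "\<lambda>\<rho>. (- 1) ^ k * D k \<rho> \<mu>" _ _ "{- \<delta><..<\<delta>}"])
    show "((\<lambda>\<rho>. (- 1) ^ k * D k \<rho> \<mu>) has_real_derivative (- 1) ^ k * D (Suc k) \<rho> \<mu>) (at \<rho>)"
      by (rule DERIV_cmult[OF D_deriv[OF assms(1) Suc.prems]])
    fix x assume "x \<in> {- \<delta><..<\<delta>}"
    then show "(- 1) ^ k * D k x \<mu> = D k (- x) \<mu>" using Suc.IH[of x] by (simp add: abs_less_iff)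
  qed (use Suc.prems in \<open>auto simp: abs_less_iff\<close>)
  ultimately have "D (Suc k) (- \<rho>) \<mu> * - 1 = (- 1) ^ k * D (Suc k) \<rho> \<mu>"
    by (rule DERIV_unique)
  then show ?case by simp
qed

lemma D_odd_zero: "\<mu> \<in> N \<Longrightarrow> odd k \<Longrightarrow> D k 0 \<mu> = 0"
  using D_parity[of \<mu> 0 k] \<delta>_pos by simp

lemma D_even_zero:
  assumes "(a, b, c, n) \<in> N" "k \<le> 4"
  shows "D (2 * k) 0 (a, b, c, n) = fact (2 * k) * (2 * pi * tau k a b c n)"
  using T_deriv_even[OF assms] by (simp add: D_def)

text \<open>The value of \<rho> on the orbit that meets the axis u = 0 at q = v, the inverse of
  \<open>qr\<close>. The point (h, 0) corresponds to v = -4 ln(1 + h).\<close>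

definition R :: "real \<Rightarrow> coeffs \<Rightarrow> real" where
  "R v \<mu> = v * sqrt (Re (Y2 (of_real v) \<mu>))"

lemma R_continuous:
  "continuous_on A f \<Longrightarrow> continuous_on A g \<Longrightarrow> continuous_on A (\<lambda>x. R (f x) (g x))"
  unfolding R_def Y2_def by (intro continuous_intros)

context
  fixes v :: real and \<mu> :: coeffs
  assumes v: "\<bar>v\<bar> < \<epsilon>" and \<mu>: "\<mu> \<in> N"
begin

lemma R_bound: "\<bar>R v \<mu>\<bar> < \<delta>" unfolding R_def by (rule q_dom[OF v \<mu>])

lemma qr_R: "qr \<mu> (R v \<mu>) = v"
  using q_inverse[OF v \<mu>] by (simp only: qr_def R_def) simp

lemma R_neg: "v < 0 \<Longrightarrow> R v \<mu> < 0"
  unfolding R_def using Y2_pos[OF v \<mu>] by (intro mult_neg_pos) auto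

end

lemma R_deriv:
  assumes v: "\<bar>v\<bar> < \<epsilon>" and \<mu>: "\<mu> \<in> N"
  shows "((\<lambda>v. R v \<mu>) has_real_derivative inverse (qd \<mu> (R v \<mu>))) (at v)"
proof (rule DERIV_inverse_function)
  show "(qr \<mu> has_real_derivative qd \<mu> (R v \<mu>)) (at (R v \<mu>))" by (rule qr_deriv[OF \<mu> R_bound[OF v \<mu>]])
  show "qd \<mu> (R v \<mu>) \<noteq> 0" using qd_pos[OF \<mu> R_bound[OF v \<mu>]] by simp
  show "- \<epsilon> < v" "v < \<epsilon>" using v by auto
  show "qr \<mu> (R y \<mu>) = y" if "- \<epsilon> < y" "y < \<epsilon>" for y using that by (intro qr_R \<mu>) auto
  have "continuous_on UNIV (\<lambda>v. R v \<mu>)"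
    by (intro R_continuous continuous_intros)
  then show "isCont (\<lambda>v. R v \<mu>) v" by (simp add: continuous_on_eq_continuous_at)
qed

definition h_max :: real where "h_max = exp (\<epsilon> / 4) - 1"

lemma h_max_pos: "0 < h_max"
  using \<epsilon>_pos by (simp add: h_max_def)

lemma log_bound: "0 < h \<Longrightarrow> h < h_max \<Longrightarrow> \<bar>- 4 * ln (1 + h)\<bar> < \<epsilon>"
  using ln_less_cancel_iff[of "1 + h" "exp (\<epsilon> / 4)"] by (simp add: h_max_def)

text \<open>The \<rho>-derivative of T at the orbit through (h, 0). It differs from the h-derivative
  of the period by a factor without zeros.\<close>

definition S :: "real \<Rightarrow> coeffs \<Rightarrow> real" where
  "S h \<mu> = D 1 (R (- 4 * ln (1 + h)) \<mu>) \<mu>"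

context
  fixes h :: real
  assumes h: "0 < h" "h < h_max"
begin

lemma R_log_neg: "\<mu> \<in> N \<Longrightarrow> R (- 4 * ln (1 + h)) \<mu> < 0"
  using h by (intro R_neg log_bound) auto

lemma R_log_bound: "\<mu> \<in> N \<Longrightarrow> \<bar>R (- 4 * ln (1 + h)) \<mu>\<bar> < \<delta>"
  by (rule R_bound[OF log_bound[OF h]])

lemma period_h:
  assumes \<mu>: "\<mu> \<in> N"
  shows "orbit_has_period (shifted_S (param_of \<mu>)) (h, 0) (D 0 (R (- 4 * ln (1 + h)) \<mu>) \<mu>)"
proof -
  have "exp (- qr \<mu> (R (- 4 * ln (1 + h)) \<mu>) / 4) - 1 = h"
    unfolding qr_R[OF log_bound[OF h] \<mu>] using h by simp
  then show ?thesis
    using orbit_period[OF \<mu> R_log_bound[OF \<mu>]] R_log_neg[OF \<mu>] by (simp add: D_def)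
qed

lemma R_log_mem: "\<mu> \<in> N \<Longrightarrow> (R (- 4 * ln (1 + h)) \<mu>, \<mu>) \<in> {- \<delta><..<\<delta>} \<times> N"
  using R_log_bound[of \<mu>] unfolding mem_Sigma_iff greaterThanLessThan_iff by linarith

lemma S_continuous: "continuous_on N (S h)"
proof -
  have "continuous_on N (\<lambda>\<mu>. (R (- 4 * ln (1 + h)) \<mu>, \<mu>))"
    by (intro R_continuous continuous_intros)
  moreover have "(\<lambda>\<mu>. (R (- 4 * ln (1 + h)) \<mu>, \<mu>)) ` N \<subseteq> {- \<delta><..<\<delta>} \<times> N"
    by (rule image_subsetI) (rule R_log_mem)
  ultimately have "continuous_on N (\<lambda>\<mu>. D 1 (fst (R (- 4 * ln (1 + h)) \<mu>, \<mu>)) (snd (R (- 4 * ln (1 + h)) \<mu>, \<mu>)))"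
    by (rule continuous_on_compose2[OF D_continuous])
  then show ?thesis
    unfolding S_def[abs_def] fst_conv snd_conv .
qed

end

text \<open>Chain rule: the derivative of h \<mapsto> \<rho> is nonzero, because q' is positive and
  the logarithm has nonzero derivative.\<close>

lemma critical_at_iff:
  assumes h: "0 < h" "h < h_max" and \<mu>: "\<mu> \<in> N"
  shows "critical_at (param_of \<mu>) h \<longleftrightarrow> S h \<mu> = 0"
proof -
  let ?v = "\<lambda>h. - 4 * ln (1 + h)"
  have nb: "eventually (\<lambda>h'. h' \<in> {0<..<h_max}) (nhds h)"
    using h by (intro eventually_nhds_in_open) auto
  have per: "eventually (\<lambda>h'. \<exists>T. orbit_has_period (shifted_S (param_of \<mu>)) (h', 0) T) (nhds h)"
  proof (rule eventually_mono[OF nb])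
    fix h' assume "h' \<in> {0<..<h_max}"
    then have "0 < h'" "h' < h_max" by auto
    from period_h[OF this \<mu>] show "\<exists>T. orbit_has_period (shifted_S (param_of \<mu>)) (h', 0) T"
      by (rule exI)
  qed
  have "(?v has_real_derivative - 4 / (1 + h)) (at h)"
    using h by (auto intro!: derivative_eq_intros simp: field_simps)
  with R_deriv[OF log_bound[OF h] \<mu>]
  have "((\<lambda>h. R (?v h) \<mu>) has_real_derivative inverse (qd \<mu> (R (?v h) \<mu>)) * (- 4 / (1 + h))) (at h)"
    by (rule DERIV_chain2[where f = "\<lambda>v. R v \<mu>" and g = ?v])
  with D_deriv[OF \<mu> R_log_bound[OF h \<mu>], of 0]
  have "((\<lambda>h. D 0 (R (?v h) \<mu>) \<mu>) has_real_derivative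
      D (Suc 0) (R (?v h) \<mu>) \<mu> * (inverse (qd \<mu> (R (?v h) \<mu>)) * (- 4 / (1 + h)))) (at h)"
    by (rule DERIV_chain2[where f = "\<lambda>\<rho>. D 0 \<rho> \<mu>" and g = "\<lambda>h. R (?v h) \<mu>"])
  then have "((\<lambda>h. D 0 (R (?v h) \<mu>) \<mu>) has_real_derivative
      S h \<mu> * (inverse (qd \<mu> (R (?v h) \<mu>)) * (- 4 / (1 + h)))) (at h)"
    by (simp only: S_def One_nat_def)
  then have P': "((\<lambda>h. P h (param_of \<mu>)) has_real_derivative
      S h \<mu> * (inverse (qd \<mu> (R (?v h) \<mu>)) * (- 4 / (1 + h)))) (at h)"
  proof (rule has_field_derivative_transform_within_open[of _ _ _ "{0<..<h_max}"])
    fix x assume "x \<in> {0<..<h_max}"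
    then show "D 0 (R (?v x) \<mu>) \<mu> = P x (param_of \<mu>)"
      using P_eq[OF period_h[OF _ _ \<mu>]] by simp
  qed (use h in auto)
  have "critical_at (param_of \<mu>) h \<longleftrightarrow> ((\<lambda>h. P h (param_of \<mu>)) has_real_derivative 0) (at h)"
    using per by (simp add: critical_at_def)
  also have "\<dots> \<longleftrightarrow> S h \<mu> * (inverse (qd \<mu> (R (?v h) \<mu>)) * (- 4 / (1 + h))) = 0"
    using P' DERIV_unique by metis
  also have "\<dots> \<longleftrightarrow> S h \<mu> = 0"
    using qd_pos[OF \<mu> R_log_bound[OF h \<mu>]] h by simp
  finally show ?thesis .
qed

lemma S_continuous_h:
  assumes \<mu>: "\<mu> \<in> N"
  shows "continuous_on {0<..<h_max} (\<lambda>h. S h \<mu>)"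
proof -
  have "continuous_on {0<..<h_max} (\<lambda>h. (R (- 4 * ln (1 + h)) \<mu>, \<mu>))"
    by (intro R_continuous continuous_intros) auto
  moreover have "(\<lambda>h. (R (- 4 * ln (1 + h)) \<mu>, \<mu>)) ` {0<..<h_max} \<subseteq> {- \<delta><..<\<delta>} \<times> N"
    by (rule image_subsetI) (rule R_log_mem; use \<mu> in simp)
  ultimately have "continuous_on {0<..<h_max} (\<lambda>h. D 1 (fst (R (- 4 * ln (1 + h)) \<mu>, \<mu>)) (snd (R (- 4 * ln (1 + h)) \<mu>, \<mu>)))"
    by (rule continuous_on_compose2[OF D_continuous])
  then show ?thesis
    unfolding S_def fst_conv snd_conv .
qed

lemma R_log_inj:
  assumes \<mu>: "\<mu> \<in> N"
  shows "inj_on (\<lambda>h. R (- 4 * ln (1 + h)) \<mu>) {0<..<h_max}"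
proof (rule inj_onI)
  fix x y assume x: "x \<in> {0<..<h_max}" and y: "y \<in> {0<..<h_max}"
    and eq: "R (- 4 * ln (1 + x)) \<mu> = R (- 4 * ln (1 + y)) \<mu>"
  have "- 4 * ln (1 + x) = - 4 * ln (1 + y)"
    using arg_cong[OF eq, of "qr \<mu>"] qr_R[OF log_bound \<mu>] x y by simp
  then show "x = y" using x y by simp
qed

lemma R_log_small:
  assumes \<mu>0: "\<mu>0 \<in> N" and \<eta>: "0 < \<eta>"
  obtains e M where "0 < e" "e \<le> h_max" "open M" "\<mu>0 \<in> M" "M \<subseteq> N"
    "\<And>h \<mu>. 0 < h \<Longrightarrow> h < e \<Longrightarrow> \<mu> \<in> M \<Longrightarrow> \<bar>R (- 4 * ln (1 + h)) \<mu>\<bar> < \<eta>"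
proof -
  have "open {z :: real \<times> coeffs. \<bar>R (fst z) (snd z)\<bar> < \<eta>}"
    by (intro open_Collect_less continuous_intros R_continuous)
  moreover have "(0, \<mu>0) \<in> {z. \<bar>R (fst z) (snd z)\<bar> < \<eta>}"
    using \<eta> by (simp add: R_def)
  ultimately obtain A M where AM: "open A" "open M" "(0, \<mu>0) \<in> A \<times> M" "A \<times> M \<subseteq> {z. \<bar>R (fst z) (snd z)\<bar> < \<eta>}"
    by (rule open_prod_elim)
  obtain d where d: "0 < d" "ball 0 d \<subseteq> A" using AM(1,3) by (auto simp: open_contains_ball)
  show ?thesis
  proof (rule that[of "min h_max (exp (d / 4) - 1)" "M \<inter> N"])
    fix h :: real and \<mu> :: coeffs assume h: "0 < h" "h < min h_max (exp (d / 4) - 1)" and \<mu>: "\<mu> \<in> M \<inter> N"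
    have "ln (1 + h) < d / 4"
      using h ln_less_cancel_iff[of "1 + h" "exp (d / 4)"] by simp
    then have "- 4 * ln (1 + h) \<in> ball 0 d" using h by simp
    then have "(- 4 * ln (1 + h), \<mu>) \<in> A \<times> M" using d \<mu> by blast
    then show "\<bar>R (- 4 * ln (1 + h)) \<mu>\<bar> < \<eta>" using AM(4) by auto
  qed (use h_max_pos d AM \<mu>0 N_open in auto)
qed

text \<open>At \<rho> = 0 the derivatives of T of order 1 to 2 j - 1 vanish, the odd ones by parity
  and the even ones by hypothesis. So \<open>D 1\<close> equals a value of \<open>D (2 * j)\<close>
  times a positive multiple of \<rho>^(2 j - 1), which is negative for \<rho> < 0; hence the
  reversed sign.\<close>

lemma S_sign:
  assumes \<mu>: "(a, b, c, n) \<in> N" and j: "1 \<le> j" "j \<le> 4"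
    and zero: "\<And>i. 1 \<le> i \<Longrightarrow> i < j \<Longrightarrow> tau i a b c n = 0"
  obtains e where "0 < e" "e \<le> h_max"
    "\<And>h. 0 < h \<Longrightarrow> h < e \<Longrightarrow> 0 < tau j a b c n \<Longrightarrow> S h (a, b, c, n) < 0"
    "\<And>h. 0 < h \<Longrightarrow> h < e \<Longrightarrow> tau j a b c n < 0 \<Longrightarrow> 0 < S h (a, b, c, n)"
proof -
  let ?\<mu> = "(a, b, c, n)" and ?\<tau> = "tau j a b c n"
  have Dj: "D (2 * j) 0 ?\<mu> = fact (2 * j) * (2 * pi * ?\<tau>)" by (rule D_even_zero[OF \<mu> j(2)])
  have "isCont (\<lambda>\<rho>. D (2 * j) \<rho> ?\<mu>) 0"
    using D_deriv[OF \<mu>, of 0 "2 * j"] \<delta>_pos DERIV_isCont by auto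
  then have lim: "((\<lambda>\<rho>. D (2 * j) \<rho> ?\<mu>) \<longlongrightarrow> D (2 * j) 0 ?\<mu>) (at 0)" by (simp add: isCont_def)
  have "\<exists>\<eta>>0. \<eta> \<le> \<delta> \<and> (\<forall>\<rho>. \<rho> \<noteq> 0 \<and> \<bar>\<rho>\<bar> < \<eta> \<longrightarrow> (0 < ?\<tau> \<longrightarrow> 0 < D (2 * j) \<rho> ?\<mu>) \<and> (?\<tau> < 0 \<longrightarrow> D (2 * j) \<rho> ?\<mu> < 0))"
  proof -
    have "eventually (\<lambda>\<rho>. (0 < ?\<tau> \<longrightarrow> 0 < D (2 * j) \<rho> ?\<mu>) \<and> (?\<tau> < 0 \<longrightarrow> D (2 * j) \<rho> ?\<mu> < 0)) (at 0)"
    proof (cases "?\<tau>" "0::real" rule: linorder_cases)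
      case less
      then have "D (2 * j) 0 ?\<mu> < 0" by (simp add: Dj mult_pos_neg)
      from order_tendstoD(2)[OF lim this] show ?thesis by eventually_elim (use less in auto)
    next
      case greater
      then have "0 < D (2 * j) 0 ?\<mu>" by (simp add: Dj)
      from order_tendstoD(1)[OF lim this] show ?thesis by eventually_elim (use greater in auto)
    qed simp
    then obtain d where "0 < d" "\<forall>\<rho>. \<rho> \<noteq> 0 \<and> dist \<rho> 0 < d \<longrightarrow> (0 < ?\<tau> \<longrightarrow> 0 < D (2 * j) \<rho> ?\<mu>) \<and> (?\<tau> < 0 \<longrightarrow> D (2 * j) \<rho> ?\<mu> < 0)"
      unfolding eventually_at by auto
    then show ?thesis
      using \<delta>_pos by (intro exI[of _ "min d \<delta>"]) auto
  qed
  then obtain \<eta> where \<eta>: "0 < \<eta>" "\<eta> \<le> \<delta>" and sgn: "\<And>\<rho>. \<rho> \<noteq> 0 \<Longrightarrow> \<bar>\<rho>\<bar> < \<eta> \<Longrightarrow> 0 < ?\<tau> \<Longrightarrow> 0 < D (2 * j) \<rho> ?\<mu>"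
    "\<And>\<rho>. \<rho> \<noteq> 0 \<Longrightarrow> \<bar>\<rho>\<bar> < \<eta> \<Longrightarrow> ?\<tau> < 0 \<Longrightarrow> D (2 * j) \<rho> ?\<mu> < 0" by blast
  have Taylor: "\<exists>t. \<rho> < t \<and> t < 0 \<and> D 1 \<rho> ?\<mu> = D (2 * j) t ?\<mu> / fact (2 * j - 1) * \<rho> ^ (2 * j - 1)"
    if \<rho>: "\<rho> < 0" "- \<eta> < \<rho>" for \<rho>
  proof -
    have "\<exists>t>\<rho>. t < 0 \<and> D 1 \<rho> ?\<mu> = (\<Sum>m<2 * j - 1. D (Suc m) 0 ?\<mu> / fact m * \<rho> ^ m) + D (Suc (2 * j - 1)) t ?\<mu> / fact (2 * j - 1) * \<rho> ^ (2 * j - 1)"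
      by (rule Maclaurin_minus[of \<rho> "2 * j - 1" "\<lambda>m \<rho>. D (Suc m) \<rho> ?\<mu>"])
        (use \<rho> \<eta> j in \<open>auto intro!: D_deriv[OF \<mu>]\<close>)
    moreover have "D (Suc m) 0 ?\<mu> = 0" if "m < 2 * j - 1" for m
    proof (cases "even (Suc m)")
      case True
      then obtain i where i: "Suc m = 2 * i" by (rule evenE)
      then have "1 \<le> i" "i < j" using that by auto
      then show ?thesis unfolding i using D_even_zero[OF \<mu>, of i] zero[of i] j by simp
    qed (rule D_odd_zero[OF \<mu>])
    moreover have "Suc (2 * j - 1) = 2 * j" using j by simp
    ultimately show ?thesis by simp
  qed
  obtain e M where eM: "0 < e" "e \<le> h_max" "?\<mu> \<in> M" "\<And>h \<mu>. 0 < h \<Longrightarrow> h < e \<Longrightarrow> \<mu> \<in> M \<Longrightarrow> \<bar>R (- 4 * ln (1 + h)) \<mu>\<bar> < \<eta>"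
    by (rule R_log_small[OF \<mu> \<eta>(1)]) blast
  show ?thesis
  proof (rule that[OF eM(1,2)])
    fix h assume h: "0 < h" "h < e"
    let ?\<rho> = "R (- 4 * ln (1 + h)) ?\<mu>"
    have \<rho>: "?\<rho> < 0" "- \<eta> < ?\<rho>" using R_log_neg[of h ?\<mu>] eM(4)[OF h eM(3)] h eM(2) \<mu> by auto
    obtain t where t: "?\<rho> < t" "t < 0" "D 1 ?\<rho> ?\<mu> = D (2 * j) t ?\<mu> / fact (2 * j - 1) * ?\<rho> ^ (2 * j - 1)"
      using Taylor[OF \<rho>] by blast
    have "odd (2 * j - 1)" using j by simp
    then have p: "?\<rho> ^ (2 * j - 1) < 0" using \<rho>(1) by (simp add: zero_less_power_eq power_less_zero_eq)
    have tb: "t \<noteq> 0" "\<bar>t\<bar> < \<eta>" using t \<rho> by auto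
    show "S h ?\<mu> < 0" if "0 < ?\<tau>"
      unfolding S_def t(3) by (rule mult_pos_neg[OF divide_pos_pos[OF sgn(1)[OF tb that] fact_gt_zero] p])
    show "0 < S h ?\<mu>" if "?\<tau> < 0"
      unfolding S_def t(3) by (rule mult_neg_neg[OF divide_neg_pos[OF sgn(2)[OF tb that] fact_gt_zero] p])
  qed
qed

end

subsection \<open>At most three critical periods\<close>

text \<open>Each zero except the last one is sent to a zero of the derivative strictly before the
  next zero. This map is injective, so each differentiation loses at most one zero.\<close>

lemma Rolle_card_zeros:
  fixes g :: "nat \<Rightarrow> real \<Rightarrow> real"
  assumes "\<And>k x. k < m \<Longrightarrow> \<bar>x\<bar> < \<eta> \<Longrightarrow> (g k has_real_derivative g (Suc k) x) (at x)"
    and "\<And>x. \<bar>x\<bar> < \<eta> \<Longrightarrow> g m x \<noteq> 0"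
    and "finite Z" "\<And>x. x \<in> Z \<Longrightarrow> \<bar>x\<bar> < \<eta>" "\<And>x. x \<in> Z \<Longrightarrow> g 0 x = 0"
  shows "card Z \<le> m"
  using assms
proof (induction m arbitrary: g Z)
  case 0
  then have "Z = {}" by auto
  then show ?case by simp
next
  case (Suc m)
  show ?case
  proof (cases "Z = {}")
    case False
    define Z' where "Z' = Z - {Max Z}"
    define nxt where "nxt x = Min {y \<in> Z. x < y}" for x
    have nxt: "nxt x \<in> Z" "x < nxt x" "\<And>y. y \<in> Z \<Longrightarrow> x < y \<Longrightarrow> nxt x \<le> y" if "x \<in> Z'" for x
    proof -
      have "x \<noteq> Max Z" "x \<in> Z" using that by (auto simp: Z'_def)
      then have "x < Max Z" using Max_ge[OF Suc.prems(3), of x] by linarith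
      then have ne: "{y \<in> Z. x < y} \<noteq> {}" using Max_in[OF Suc.prems(3) False] by auto
      have fin: "finite {y \<in> Z. x < y}" using Suc.prems(3) by simp
      from Min_in[OF fin ne] show "nxt x \<in> Z" "x < nxt x" by (auto simp: nxt_def)
      show "nxt x \<le> y" if "y \<in> Z" "x < y" for y
        unfolding nxt_def using fin that by (intro Min_le) auto
    qed
    have "\<exists>z. x < z \<and> z < nxt x \<and> g 1 z = 0" if x: "x \<in> Z'" for x
    proof -
      have xZ: "x \<in> Z" using x by (simp add: Z'_def)
      have b: "\<bar>y\<bar> < \<eta>" if "x \<le> y" "y \<le> nxt x" for y
        using that Suc.prems(4)[OF xZ] Suc.prems(4)[OF nxt(1)[OF x]] by linarith
      have d: "(g 0 has_real_derivative g 1 y) (at y)" if "x \<le> y" "y \<le> nxt x" for y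
        using Suc.prems(1)[of 0 y] b[OF that] by simp
      have "\<exists>z. x < z \<and> z < nxt x \<and> (*) (g 1 z) = (\<lambda>v. 0)"
      proof (rule Rolle_deriv[where f = "g 0"])
        show "g 0 x = g 0 (nxt x)" using Suc.prems(5)[OF xZ] Suc.prems(5)[OF nxt(1)[OF x]] by simp
        show "continuous_on {x..nxt x} (g 0)"
        proof (rule continuous_at_imp_continuous_on, rule ballI)
          fix y assume "y \<in> {x..nxt x}"
          then show "isCont (g 0) y" by (intro DERIV_isCont[OF d]) auto
        qed
        show "(g 0 has_derivative (*) (g 1 y)) (at y)" if "x < y" "y < nxt x" for y
          using d[of y] that unfolding has_field_derivative_def by simp
      qed (rule nxt(2)[OF x])
      then obtain z where z: "x < z" "z < nxt x" "(*) (g 1 z) = (\<lambda>v. 0)" by (elim exE conjE)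
      from fun_cong[OF z(3), of 1] have "g 1 z = 0" by simp
      with z show ?thesis by (intro exI[of _ z] conjI)
    qed
    then obtain z where z: "\<And>x. x \<in> Z' \<Longrightarrow> x < z x" "\<And>x. x \<in> Z' \<Longrightarrow> z x < nxt x" "\<And>x. x \<in> Z' \<Longrightarrow> g 1 (z x) = 0"
      by metis
    have less: "z x < z y" if "x \<in> Z'" "y \<in> Z'" "x < y" for x y
    proof -
      have "y \<in> Z" using that by (simp add: Z'_def)
      then have "nxt x \<le> y" by (rule nxt(3)[OF that(1) _ that(3)])
      then show ?thesis using z(2)[OF that(1)] z(1)[OF that(2)] by linarith
    qed
    have inj: "inj_on z Z'"
    proof (rule inj_onI)
      fix x y assume xy: "x \<in> Z'" "y \<in> Z'" "z x = z y"
      show "x = y"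
        using less[OF xy(1,2)] less[OF xy(2,1)] xy(3) by (cases x y rule: linorder_cases) auto
    qed
    have "card (z ` Z') \<le> m"
    proof (rule Suc.IH[where g = "\<lambda>k. g (Suc k)"])
      show "(g (Suc k) has_real_derivative g (Suc (Suc k)) x) (at x)" if "k < m" "\<bar>x\<bar> < \<eta>" for k x
        using Suc.prems(1)[of "Suc k" x] that by simp
      show "g (Suc m) x \<noteq> 0" if "\<bar>x\<bar> < \<eta>" for x by (rule Suc.prems(2)[OF that])
      show "finite (z ` Z')" using Suc.prems(3) by (simp add: Z'_def)
      fix w assume "w \<in> z ` Z'"
      then obtain x where x: "x \<in> Z'" "w = z x" by (rule imageE) simp
      show "g (Suc 0) w = 0" using z(3)[OF x(1)] x(2) by simp
      have "x \<in> Z" using x(1) by (simp add: Z'_def)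
      from Suc.prems(4)[OF this] Suc.prems(4)[OF nxt(1)[OF x(1)]] z(1,2)[OF x(1)]
      show "\<bar>w\<bar> < \<eta>" unfolding x(2) by linarith
    qed
    then have "card Z' \<le> m" by (simp add: card_image[OF inj])
    moreover have "card Z' = card Z - 1"
      unfolding Z'_def by (rule card_Diff_singleton[OF Max_in[OF Suc.prems(3) False]])
    ultimately show ?thesis by linarith
  qed simp
qed

lemma tau_nonzero:
  obtains j where "1 \<le> j" "j \<le> 4" "tau j a b c n \<noteq> 0"
proof -
  have "\<exists>j. 1 \<le> j \<and> j \<le> 4 \<and> tau j a b c n \<noteq> 0"
  proof (rule ccontr)
    assume "\<not> ?thesis"
    then have z: "tau j a b c n = 0" if "1 \<le> j" "j \<le> 4" for j using that by blast
    have 1: "U_coeff 1 a b c = iso_coeff 1 n" using z[of 1] tau_1[of a b c n] by simp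
    have 2: "U_coeff 2 a b c = iso_coeff 2 n" using z[of 2] tau_2[OF 1] by simp
    have 3: "U_coeff 3 a b c = iso_coeff 3 n" using z[of 3] tau_3[OF 1 2] by simp
    have 4: "U_coeff 4 a b c = iso_coeff 4 n" using z[of 4] tau_4[OF 1 2 3] by simp
    show False using U_coeff_neq_iso[OF 1 2 3] 4 by simp
  qed
  then show ?thesis using that by blast
qed

context branches
begin

lemma D_nonzero_nbhd:
  assumes "\<mu>0 \<in> N" "D k 0 \<mu>0 \<noteq> 0"
  obtains \<eta> M where "0 < \<eta>" "\<eta> \<le> \<delta>" "open M" "\<mu>0 \<in> M" "M \<subseteq> N"
    "\<And>\<rho> \<mu>. \<bar>\<rho>\<bar> < \<eta> \<Longrightarrow> \<mu> \<in> M \<Longrightarrow> D k \<rho> \<mu> \<noteq> 0"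
proof -
  let ?Z = "({- \<delta><..<\<delta>} \<times> N) \<inter> (\<lambda>z. D k (fst z) (snd z)) -` (- {0})"
  have "open ?Z"
    by (rule continuous_open_preimage[OF D_continuous]) (auto intro: open_Times N_open)
  moreover have "(0, \<mu>0) \<in> ?Z" using assms \<delta>_pos by simp
  ultimately obtain A M where AM: "open A" "open M" "(0, \<mu>0) \<in> A \<times> M" "A \<times> M \<subseteq> ?Z"
    by (rule open_prod_elim)
  from AM(3) have 0: "0 \<in> A" "\<mu>0 \<in> M" by auto
  from AM(1) 0(1) obtain \<eta> where \<eta>: "0 < \<eta>" "ball 0 \<eta> \<subseteq> A"
    by (meson open_contains_ball)
  have mem: "(\<rho>, \<mu>) \<in> ?Z" if "\<bar>\<rho>\<bar> < \<eta>" "\<mu> \<in> M" for \<rho> \<mu>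
  proof -
    have "\<rho> \<in> A" using that(1) \<eta>(2) by (intro subsetD[OF \<eta>(2)]) simp
    then show ?thesis using that(2) by (intro subsetD[OF AM(4)]) simp
  qed
  show ?thesis
  proof (rule that[of "min \<eta> \<delta>" M])
    show "M \<subseteq> N" using mem[of 0] \<eta>(1) by auto
    show "D k \<rho> \<mu> \<noteq> 0" if "\<bar>\<rho>\<bar> < min \<eta> \<delta>" "\<mu> \<in> M" for \<rho> \<mu>
      using mem[of \<rho> \<mu>] that by simp
  qed (use \<eta>(1) \<delta>_pos AM(2) 0(2) in simp_all)
qed

text \<open>The negative zeros of the odd function \<open>D 1\<close>, their negatives and \<open>0\<close> are at most seven zeros.\<close>

lemma S_zeros_card:
  assumes "\<mu>0 \<in> N"
  obtains e M where "0 < e" "e \<le> h_max" "open M" "\<mu>0 \<in> M" "M \<subseteq> N"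
    "\<And>\<mu>. \<mu> \<in> M \<Longrightarrow> finite {h \<in> {0<..<e}. S h \<mu> = 0} \<and> card {h \<in> {0<..<e}. S h \<mu> = 0} \<le> 3"
proof -
  obtain a b c n where abc: "\<mu>0 = (a, b, c, n)" by (cases \<mu>0)
  obtain j where j: "1 \<le> j" "j \<le> 4" "tau j a b c n \<noteq> 0" by (rule tau_nonzero)
  have "D (2 * j) 0 \<mu>0 \<noteq> 0"
    unfolding abc using D_even_zero[of a b c n j] assms[unfolded abc] j by simp
  then obtain \<eta> M1 where \<eta>: "0 < \<eta>" "\<eta> \<le> \<delta>" and M1: "open M1" "\<mu>0 \<in> M1" "M1 \<subseteq> N"
    and D: "\<And>\<rho> \<mu>. \<bar>\<rho>\<bar> < \<eta> \<Longrightarrow> \<mu> \<in> M1 \<Longrightarrow> D (2 * j) \<rho> \<mu> \<noteq> 0"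
    by (rule D_nonzero_nbhd[OF assms]) blast
  obtain e M2 where e: "0 < e" "e \<le> h_max" and M2: "open M2" "\<mu>0 \<in> M2" "M2 \<subseteq> N"
    and R: "\<And>h \<mu>. 0 < h \<Longrightarrow> h < e \<Longrightarrow> \<mu> \<in> M2 \<Longrightarrow> \<bar>R (- 4 * ln (1 + h)) \<mu>\<bar> < \<eta>"
    by (rule R_log_small[OF assms \<eta>(1)]) blast
  show ?thesis
  proof (rule that[of e "M1 \<inter> M2"])
    show "open (M1 \<inter> M2)" using M1(1) M2(1) by (rule open_Int)
    show "\<mu>0 \<in> M1 \<inter> M2" using M1(2) M2(2) by simp
    show "M1 \<inter> M2 \<subseteq> N" using M1(3) by blast
    fix \<mu> assume "\<mu> \<in> M1 \<inter> M2"
    then have \<mu>: "\<mu> \<in> M1" "\<mu> \<in> M2" "\<mu> \<in> N" using M1(3) by auto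
    show "finite {h \<in> {0<..<e}. S h \<mu> = 0} \<and> card {h \<in> {0<..<e}. S h \<mu> = 0} \<le> 3"
    proof (rule finite_if_finite_subsets_card_bdd)
      fix G assume G: "G \<subseteq> {h \<in> {0<..<e}. S h \<mu> = 0}" "finite G"
      let ?r = "\<lambda>h. R (- 4 * ln (1 + h)) \<mu>"
      define Z where "Z = ?r ` G"
      have Gh: "0 < h" "h < e" "h < h_max" "S h \<mu> = 0" if "h \<in> G" for h
        using subsetD[OF G(1) that] e(2) by auto
      have "inj_on ?r G"
        by (rule inj_on_subset[OF R_log_inj[OF \<mu>(3)]]) (use Gh in auto)
      then have cZ: "card Z = card G" "finite Z" unfolding Z_def using G(2) by (auto simp: card_image)
      have Z: "x < 0" "\<bar>x\<bar> < \<eta>" "D 1 x \<mu> = 0" if x: "x \<in> Z" for x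
      proof -
        from x obtain h where h: "h \<in> G" "x = ?r h" unfolding Z_def by (rule imageE) simp
        show "x < 0" unfolding h(2) by (rule R_log_neg[OF Gh(1,3)[OF h(1)] \<mu>(3)])
        show "\<bar>x\<bar> < \<eta>" unfolding h(2) by (rule R[OF Gh(1,2)[OF h(1)] \<mu>(2)])
        show "D 1 x \<mu> = 0" using Gh(4)[OF h(1)] unfolding h(2) S_def .
      qed
      let ?Z = "insert 0 (Z \<union> uminus ` Z)"
      \<comment> \<open>The family starts at \<open>D 1\<close>, so the derivative without zeros,
        \<open>D (2 * j)\<close>, has index 2 j - 1 in it. The bound reads 2 card G + 1 \<le> 2 j -
        1 \<le> 7.\<close>
      have "card ?Z \<le> 2 * j - 1"
      proof (rule Rolle_card_zeros[where g = "\<lambda>k \<rho>. D (Suc k) \<rho> \<mu>"])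
        show "((\<lambda>\<rho>. D (Suc k) \<rho> \<mu>) has_real_derivative D (Suc (Suc k)) x \<mu>) (at x)" if "\<bar>x\<bar> < \<eta>" for k x
          using that \<eta>(2) by (intro D_deriv[OF \<mu>(3)]) simp
        show "D (Suc (2 * j - 1)) x \<mu> \<noteq> 0" if "\<bar>x\<bar> < \<eta>" for x
          using D[OF that \<mu>(1)] j(1) by simp
        show "finite ?Z" using cZ(2) by simp
        fix x assume x: "x \<in> ?Z"
        then show "\<bar>x\<bar> < \<eta>" using Z(2) \<eta>(1) by auto
        have "D 1 (- y) \<mu> = 0" if "y \<in> Z" for y
          using D_parity[OF \<mu>(3), of y 1] Z(2,3)[OF that] \<eta>(2) by simp
        moreover have "D 1 0 \<mu> = 0" by (rule D_odd_zero[OF \<mu>(3)]) simp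
        ultimately show "D (Suc 0) x \<mu> = 0" using x Z(3) by auto
      qed
      moreover have "card ?Z = Suc (2 * card G)"
      proof -
        have "0 \<notin> Z \<union> uminus ` Z" using Z(1) by force
        moreover have "False" if "x \<in> Z" "x \<in> uminus ` Z" for x
          using that Z(1)[of x] Z(1)[of "- x"] by auto
        then have "Z \<inter> uminus ` Z = {}" by blast
        then have "card (Z \<union> uminus ` Z) = card Z + card Z"
          using cZ(2) by (simp add: card_Un_disjoint card_image)
        ultimately show ?thesis using cZ by simp
      qed
      ultimately show "card G \<le> 3" using j(2) by linarith
    qed
  qed (use e in auto)
qed

end

section \<open>Affine coordinates on the parameter family\<close>

fun coeffs_of :: "param \<Rightarrow> coeffs" where
  "coeffs_of (a2, a3, a4, a6, a7, a8, a9, a10) = (2/3 * a2, 1/2 * a3, 2/5 * a4, (1 + a7) / 4)"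

lemma coeffs_of_param_of: "coeffs_of (param_of \<mu>) = \<mu>"
  by (cases \<mu>) simp

lemma param_of_mem: "param_of \<mu> \<in> Lambda1"
  by (cases \<mu>) (simp add: Lambda1_def)

lemma param_of_coeffs_of: "p \<in> Lambda1 \<Longrightarrow> param_of (coeffs_of p) = p"
  by (cases p) (auto simp: Lambda1_def field_simps)

lemma continuous_on_param_of: "continuous_on A param_of"
proof -
  have "param_of = (\<lambda>z. (3/2 * fst z, 2 * fst (snd z), 5/2 * fst (snd (snd z)), 0, 4 * snd (snd (snd z)) - 1,
     1/3 * (3/2 * fst z) * (1 - 2 * (4 * snd (snd (snd z)) - 1)), 1/2 * (2 * fst (snd z)) * (1 - (4 * snd (snd (snd z)) - 1)),
     1/5 * (5/2 * fst (snd (snd z))) * (3 - 2 * (4 * snd (snd (snd z)) - 1))))"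
    by (rule ext) (auto simp: split_paired_all)
  then show ?thesis by (rule ssubst) (intro continuous_intros)
qed

lemma continuous_on_coeffs_of: "continuous_on A coeffs_of"
proof -
  have "coeffs_of = (\<lambda>z. (2/3 * fst z, 1/2 * fst (snd z), 2/5 * fst (snd (snd z)),
     (1 + fst (snd (snd (snd (snd z))))) / 4))"
    by (rule ext) (auto simp: split_paired_all)
  then show ?thesis by (rule ssubst) (intro continuous_intros, simp)
qed

lemma nbhd_in_Lambda1_coeffs_of:
  assumes "p \<in> Lambda1" "open M" "coeffs_of p \<in> M"
  shows "nbhd_in_Lambda1 p (Lambda1 \<inter> coeffs_of -` M)"
  using assms continuous_openin_preimage_gen[OF continuous_on_coeffs_of assms(2), of Lambda1]
  by (simp add: nbhd_in_Lambda1_def)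

lemma nbhd_in_Lambda1_Int:
  "nbhd_in_Lambda1 p V \<Longrightarrow> nbhd_in_Lambda1 p W \<Longrightarrow> nbhd_in_Lambda1 p (V \<inter> W)"
  by (auto simp: nbhd_in_Lambda1_def)

lemma open_param_of_vimage:
  assumes "nbhd_in_Lambda1 p W"
  shows "open (param_of -` W)"
proof -
  obtain Q where Q: "open Q" "W = Lambda1 \<inter> Q"
    using assms by (auto simp: nbhd_in_Lambda1_def openin_open)
  then have "param_of -` W = param_of -` Q"
    using param_of_mem by (simp del: param_of.simps add: vimage_Int) blast
  then show ?thesis using open_vimage[OF Q(1) continuous_on_param_of] by simp
qed

lemma bifurcate_le_3:
  assumes p: "p \<in> Lambda1" and k: "critical_periods_bifurcate p k"
  shows "k \<le> 3"
proof -
  obtain N \<delta> \<epsilon> q U where br: "branches N \<delta> \<epsilon> q U" and N: "coeffs_of p \<in> N"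
    by (rule branches_exist)
  interpret branches N \<delta> \<epsilon> q U by (rule br)
  obtain e M where e: "0 < e" "e \<le> h_max" and M: "open M" "coeffs_of p \<in> M" "M \<subseteq> N"
    and card: "\<And>\<mu>. \<mu> \<in> M \<Longrightarrow> finite {h \<in> {0<..<e}. S h \<mu> = 0} \<and> card {h \<in> {0<..<e}. S h \<mu> = 0} \<le> 3"
    by (rule S_zeros_card[OF N]) blast
  obtain \<epsilon>0 where \<epsilon>0: "0 < \<epsilon>0" and all: "\<forall>\<epsilon>. 0 < \<epsilon> \<and> \<epsilon> < \<epsilon>0 \<longrightarrow>
        (\<exists>W0. nbhd_in_Lambda1 p W0 \<and>
          (\<forall>W. nbhd_in_Lambda1 p W \<and> W \<subseteq> W0 \<longrightarrow>
            (\<exists>p1\<in>W. finite {h \<in> {0<..<\<epsilon>}. critical_at p1 h} \<and>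
                     card {h \<in> {0<..<\<epsilon>}. critical_at p1 h} = k)))"
    using k unfolding critical_periods_bifurcate_def by (elim exE conjE)
  \<comment> \<open>Below \<open>\<epsilon>0\<close> the definition of bifurcation applies; below e
    all critical points are among the zeros already bounded.\<close>
  define d where "d = min \<epsilon>0 e / 2"
  have d: "0 < d" "d < \<epsilon>0" "d < e" using \<epsilon>0 e(1) by (auto simp: d_def min_def)
  from all d(1,2) obtain W0 where W0: "nbhd_in_Lambda1 p W0"
    "\<forall>W. nbhd_in_Lambda1 p W \<and> W \<subseteq> W0 \<longrightarrow>
            (\<exists>p1\<in>W. finite {h \<in> {0<..<d}. critical_at p1 h} \<and> card {h \<in> {0<..<d}. critical_at p1 h} = k)"
    by meson
  \<comment> \<open>The neighbourhood is shrunk to parameters whose coefficients lie in M, where the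
    bound 3 is uniform.\<close>
  let ?W = "W0 \<inter> (Lambda1 \<inter> coeffs_of -` M)"
  have "nbhd_in_Lambda1 p ?W"
    by (rule nbhd_in_Lambda1_Int[OF W0(1) nbhd_in_Lambda1_coeffs_of[OF p M(1,2)]])
  with W0(2) obtain p1 where p1: "p1 \<in> ?W" "card {h \<in> {0<..<d}. critical_at p1 h} = k"
    by (meson Int_lower1)
  have \<mu>: "coeffs_of p1 \<in> M" "param_of (coeffs_of p1) = p1" using p1(1) param_of_coeffs_of by auto
  have "{h \<in> {0<..<d}. critical_at p1 h} \<subseteq> {h \<in> {0<..<e}. S h (coeffs_of p1) = 0}"
    using critical_at_iff[of _ "coeffs_of p1"] \<mu> M(3) d(3) e(2) by auto
  then have "k \<le> card {h \<in> {0<..<e}. S h (coeffs_of p1) = 0}"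
    unfolding p1(2)[symmetric] using card[OF \<mu>(1)] by (intro card_mono) auto
  then show ?thesis using card[OF \<mu>(1)] by linarith
qed

subsection \<open>Three critical periods\<close>

lemma F3_F4_at:
  "F3 y (- 1/2) = 1327104 - 20321280 * y + 56064960 * y^2 - 125023500 * y^3 + 61618725 * y^4"
  "F4 y (- 1/2) = 1138655232 - 16101918720 * y + 51839948160 * y^2 - 120580419960 * y^3
     + 75855329550 * y^4 - 10343908575 * y^5"
  unfolding F3_def F4_def eval_rows_def rows3_def rows4_def
  by (simp_all add: fst_homog_Cons algebra_simps power_numeral_reduce)

text \<open>The interval brackets a sign change of F3(., -1/2), which is nonnegative at 7/100 and
  negative at 2/25. It is so short that bounding each monomial separately suffices.\<close>

lemma F4_pos:
  assumes "7/100 \<le> y" "y \<le> 2/25"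
  shows "0 < F4 y (- 1/2)"
proof -
  have "49/10000 \<le> y^2" using power_mono[OF assms(1), of 2] by (simp add: power_divide)
  moreover have "y^3 \<le> 8/15625" "y^5 \<le> 32/9765625"
    using power_mono[OF assms(2), of 3] power_mono[OF assms(2), of 5] assms(1) by (simp_all add: power_divide)
  moreover have "0 \<le> y^4" by simp
  ultimately show ?thesis unfolding F3_F4_at using assms(2) by linarith
qed

text \<open>Taking the largest point of the interval where F3 is nonnegative gives negativity to its
  right directly, without an estimate of the derivative.\<close>

lemma F3_last_root:
  obtains y where "7/100 \<le> y" "y < 2/25" "F3 y (- 1/2) = 0"
    "\<forall>z\<in>{y<..<2/25}. F3 z (- 1/2) < 0"
proof -
  let ?F = "\<lambda>y. F3 y (- 1/2)"
  define A where "A = {7/100..2/25} \<inter> ?F -` {0..}"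
  have cont: "continuous_on B ?F" for B
    unfolding F3_F4_at by (intro continuous_intros)
  have "compact A"
    unfolding A_def by (intro compact_Int_closed compact_Icc closed_vimage closed_atLeast cont)
  moreover have "0 \<le> ?F (7/100)" unfolding F3_F4_at by (simp add: power_divide)
  then have "7/100 \<in> A" by (simp add: A_def)
  ultimately obtain y where y: "y \<in> A" "\<And>z. z \<in> A \<Longrightarrow> z \<le> y"
    using compact_attains_sup[of A] by blast
  have neg: "?F (2/25) < 0" unfolding F3_F4_at by (simp add: power_divide)
  have ya: "7/100 \<le> y" "y \<le> 2/25" "0 \<le> ?F y" using y(1) by (auto simp: A_def)
  have "\<exists>z\<ge>y. z \<le> 2/25 \<and> ?F z = 0"
    by (rule IVT2'[OF _ ya(3,2) cont]) (use neg in simp)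
  then obtain z where z: "y \<le> z" "z \<le> 2/25" "?F z = 0" by blast
  then have "z \<in> A" using ya(1) by (simp add: A_def)
  then have "z = y" using y(2)[of z] z(1) by simp
  show ?thesis
  proof (rule that)
    show "?F y = 0" using z(3) \<open>z = y\<close> by simp
    then show "y < 2/25" using neg ya(2) by (cases "y = 2/25") auto
    show "\<forall>x\<in>{y<..<2/25}. ?F x < 0"
    proof (rule ballI, rule ccontr)
      fix x assume x: "x \<in> {y<..<2/25}" and "\<not> ?F x < 0"
      then have "x \<in> A" using ya(1) by (simp add: A_def)
      then show False using y(2)[of x] x by simp
    qed
  qed (rule ya(1))
qed

text \<open>For \<open>n = -1/2\<close> the targets are \<open>iso_coeff 1 n = 2\<close> and \<open>iso_coeff 2 n = 6\<close>; solving the first two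
  equations for \<open>b\<close> and \<open>c\<close> gives the curve \<open>\<tau>\<^sub>1 = \<tau>\<^sub>2 = 0\<close>, parametrized by \<open>y = a\<^sup>2\<close>.\<close>

definition b_curve :: "real \<Rightarrow> real" where "b_curve y = 4/3 - 5/4 * y"

definition c_curve :: "real \<Rightarrow> real" where
  "c_curve y = (6 - 1155/128 * y^2 - 315/16 * y * b_curve y - 35/8 * b_curve y ^ 2) * (4/35) / sqrt y"

lemma curve_U_coeff:
  assumes "0 < y"
  shows "U_coeff 1 (sqrt y) (b_curve y) c = iso_coeff 1 (- 1/2)"
    and "U_coeff 2 (sqrt y) (b_curve y) (c_curve y) = iso_coeff 2 (- 1/2)"
proof -
  have a2: "sqrt y ^ 2 = y" "sqrt y ^ 4 = y^2"
    using assms power_mult[of "sqrt y" 2 2] by simp_all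
  show "U_coeff 1 (sqrt y) (b_curve y) c = iso_coeff 1 (- 1/2)"
    using assms by (simp add: U_coeff_def iso_coeff_def b_curve_def power_divide algebra_simps)
  have "sqrt y * c_curve y = (6 - 1155/128 * y^2 - 315/16 * y * b_curve y - 35/8 * b_curve y ^ 2) * (4/35)"
    using assms by (simp add: c_curve_def)
  moreover have "iso_coeff 2 (- 1/2) = 6"
    by (simp add: iso_coeff_def power_divide)
  moreover have "U_coeff 2 (sqrt y) (b_curve y) (c_curve y) =
    1155/128 * y^2 + 315/16 * y * b_curve y + 35/4 * (sqrt y * c_curve y) + 35/8 * b_curve y ^ 2"
    by (simp add: U_coeff_def a2)
  ultimately show "U_coeff 2 (sqrt y) (b_curve y) (c_curve y) = iso_coeff 2 (- 1/2)"
    by simp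
qed

lemma curve_tau:
  assumes "0 < y"
  shows "tau 1 (sqrt y) (b_curve y) c (- 1/2) = 0"
    and "tau 2 (sqrt y) (b_curve y) (c_curve y) (- 1/2) = 0"
    and "F3 y (- 1/2) < 0 \<Longrightarrow> tau 3 (sqrt y) (b_curve y) (c_curve y) (- 1/2) < 0"
    and "F3 y (- 1/2) = 0 \<Longrightarrow> tau 3 (sqrt y) (b_curve y) (c_curve y) (- 1/2) = 0"
    and "F3 y (- 1/2) = 0 \<Longrightarrow> 0 < F4 y (- 1/2) \<Longrightarrow> 0 < tau 4 (sqrt y) (b_curve y) (c_curve y) (- 1/2)"
proof -
  note U = curve_U_coeff[OF assms]
  show "tau 1 (sqrt y) (b_curve y) c (- 1/2) = 0"
    unfolding tau_1 U by simp
  show "tau 2 (sqrt y) (b_curve y) (c_curve y) (- 1/2) = 0"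
    unfolding tau_2[OF U(1)] U by simp
  have y: "sqrt y ^ 2 = y" using assms by simp
  note F = F3_U_coeff[OF U(1) U(2), unfolded y]
  note tau_3 = tau_3[OF U(1) U(2)]
  show "tau 3 (sqrt y) (b_curve y) (c_curve y) (- 1/2) < 0" if "F3 y (- 1/2) < 0"
    using that assms unfolding F tau_3 by (simp add: mult_less_0_iff)
  show "tau 3 (sqrt y) (b_curve y) (c_curve y) (- 1/2) = 0" if "F3 y (- 1/2) = 0"
    using that assms unfolding F tau_3 by simp
  assume "F3 y (- 1/2) = 0" "0 < F4 y (- 1/2)"
  then have "U_coeff 3 (sqrt y) (b_curve y) (c_curve y) = iso_coeff 3 (- 1/2)"
    "0 < U_coeff 4 (sqrt y) (b_curve y) (c_curve y) - iso_coeff 4 (- 1/2)"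
    using assms unfolding F by (simp_all add: zero_less_mult_iff)
  then show "0 < tau 4 (sqrt y) (b_curve y) (c_curve y) (- 1/2)"
    using tau_4[OF U(1) U(2)] by simp
qed

text \<open>\<open>U_coeff 2\<close> is affine in c with slope 35/4 a, and a = sqrt y is
  positive.\<close>

lemma tau_2_pos_c:
  assumes "0 < y" "c_curve y < c"
  shows "0 < tau 2 (sqrt y) (b_curve y) c (- 1/2)"
proof -
  have eq: "U_coeff 2 (sqrt y) (b_curve y) c - iso_coeff 2 (- 1/2) = 35/4 * sqrt y * (c - c_curve y)"
    unfolding curve_U_coeff(2)[OF assms(1), symmetric] by (simp add: U_coeff_def algebra_simps)
  show ?thesis
    unfolding tau_2[OF curve_U_coeff(1)[OF assms(1)]] eq using assms by simp
qed

lemma tau_1_neg_b: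
  assumes "0 < y" "b < b_curve y"
  shows "tau 1 (sqrt y) b c (- 1/2) < 0"
proof -
  have "U_coeff 1 (sqrt y) b c - iso_coeff 1 (- 1/2) = 3/2 * (b - b_curve y)"
    unfolding curve_U_coeff(1)[OF assms(1), of c, symmetric] by (simp add: U_coeff_def algebra_simps)
  then show ?thesis unfolding tau_1 using assms(2) by simp
qed

lemma isCont_open_right:
  fixes f :: "real \<Rightarrow> 'a::topological_space"
  assumes "open G" "isCont f x" "f x \<in> G" "x < r"
  shows "\<exists>y>x. y < r \<and> f y \<in> G"
proof -
  have "(f \<longlongrightarrow> f x) (at_right x)"
    using assms(2) unfolding isCont_def filterlim_at_split by (rule conjunct2)
  from topological_tendstoD[OF this assms(1,3)]
  have "eventually (\<lambda>y. f y \<in> G) (at_right x)" .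
  moreover have "eventually (\<lambda>y. y \<in> {x<..<r}) (at_right x)"
    by (rule eventually_at_right_real[OF assms(4)])
  ultimately have "eventually (\<lambda>y. y > x \<and> y < r \<and> f y \<in> G) (at_right x)"
    by eventually_elim simp
  then show ?thesis
    by (rule eventually_happens'[rotated]) simp
qed

context branches
begin

lemma S_open:
  assumes "open G" "G \<subseteq> N" "0 < h" "h < h_max"
  shows "open {\<mu> \<in> G. S h \<mu> < 0}" "open {\<mu> \<in> G. 0 < S h \<mu>}"
proof -
  have cont: "continuous_on G (S h)"
    by (rule continuous_on_subset[OF S_continuous[OF assms(3,4)] assms(2)])
  have "{\<mu> \<in> G. S h \<mu> < 0} = G \<inter> S h -` {..<0}" "{\<mu> \<in> G. 0 < S h \<mu>} = G \<inter> S h -` {0<..}" by auto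
  then show "open {\<mu> \<in> G. S h \<mu> < 0}" "open {\<mu> \<in> G. 0 < S h \<mu>}"
    using continuous_open_preimage[OF cont assms(1)] by auto
qed

lemma S_zero_between:
  assumes "\<mu> \<in> N" "0 < h" "h < h'" "h' < h_max" "S h \<mu> * S h' \<mu> < 0"
  obtains x where "h < x" "x < h'" "S x \<mu> = 0"
proof -
  have cont: "continuous_on {h..h'} (\<lambda>h. S h \<mu>)"
    by (rule continuous_on_subset[OF S_continuous_h[OF assms(1)]]) (use assms in auto)
  have "\<exists>x\<ge>h. x \<le> h' \<and> S x \<mu> = 0"
  proof (cases "S h \<mu> < 0")
    case True
    then show ?thesis using assms(3,5) by (intro IVT'[OF _ _ _ cont]) (auto simp: mult_less_0_iff)
  next
    case False
    then show ?thesis using assms(3,5) by (intro IVT2'[OF _ _ _ cont]) (auto simp: mult_less_0_iff)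
  qed
  then obtain x where x: "h \<le> x" "x \<le> h'" "S x \<mu> = 0" by blast
  moreover have "x \<noteq> h" "x \<noteq> h'" using x(3) assms(5) by auto
  ultimately show ?thesis using that[of x] by simp
qed

lemma exists_S_sign:
  assumes "(a, b, c, n) \<in> N" "1 \<le> j" "j \<le> 4" "\<forall>i. 1 \<le> i \<and> i < j \<longrightarrow> tau i a b c n = 0" "0 < h'"
  shows exists_S_neg: "0 < tau j a b c n \<Longrightarrow> \<exists>h>0. h < h' \<and> S h (a, b, c, n) < 0"
    and exists_S_pos: "tau j a b c n < 0 \<Longrightarrow> \<exists>h>0. h < h' \<and> 0 < S h (a, b, c, n)"
proof -
  obtain e where e: "0 < e"
    "\<And>h. 0 < h \<Longrightarrow> h < e \<Longrightarrow> 0 < tau j a b c n \<Longrightarrow> S h (a, b, c, n) < 0"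
    "\<And>h. 0 < h \<Longrightarrow> h < e \<Longrightarrow> tau j a b c n < 0 \<Longrightarrow> 0 < S h (a, b, c, n)"
    by (rule S_sign[OF assms(1-3)]) (use assms(4) in blast)+
  have h: "0 < min h' e / 2" "min h' e / 2 < h'" "min h' e / 2 < e" using e(1) assms(5) by auto
  show "\<exists>h>0. h < h' \<and> S h (a, b, c, n) < 0" if "0 < tau j a b c n"
    using h e(2)[OF h(1,3) that] by blast
  show "\<exists>h>0. h < h' \<and> 0 < S h (a, b, c, n)" if "tau j a b c n < 0"
    using h e(3)[OF h(1,3) that] by blast
qed

text \<open>The signs of S at h0 > h1 > h2 > h3 become -, +, -, +, opposite to those of the leading
  \<open>tau\<close> at each stage. Earlier signs persist because each new parameter is taken from
  the open set where they hold; the intermediate value theorem then gives a zero in each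
  gap.\<close>

lemma three_zeros:
  assumes y: "7/100 \<le> y" "y < 2/25" "F3 y (- 1/2) = 0"
      "\<forall>z\<in>{y<..<2/25}. F3 z (- 1/2) < 0"
    and G: "open G" "G \<subseteq> N" "(sqrt y, b_curve y, c_curve y, - 1/2) \<in> G"
    and \<epsilon>': "0 < \<epsilon>'" "\<epsilon>' \<le> h_max"
  obtains \<mu> x1 x2 x3 where "\<mu> \<in> G" "0 < x1" "x1 < x2" "x2 < x3" "x3 < \<epsilon>'"
    "S x1 \<mu> = 0" "S x2 \<mu> = 0" "S x3 \<mu> = 0"
proof -
  have y0: "0 < y" using y(1) by simp
  have N: "\<mu> \<in> G \<Longrightarrow> \<mu> \<in> N" for \<mu> using G(2) by blast
  let ?\<mu> = "(sqrt y, b_curve y, c_curve y, - 1/2)"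
  have F4: "0 < F4 y (- 1/2)" using y(1,2) by (intro F4_pos) auto
  have "\<forall>i. 1 \<le> i \<and> i < 4 \<longrightarrow> tau i (sqrt y) (b_curve y) (c_curve y) (- 1/2) = 0"
  proof (intro allI impI)
    fix i :: nat assume "1 \<le> i \<and> i < 4"
    then have "i = 1 \<or> i = 2 \<or> i = 3" by linarith
    then show "tau i (sqrt y) (b_curve y) (c_curve y) (- 1/2) = 0"
      by (elim disjE; simp only: curve_tau(1,2,4)[OF y0] y(3))
  qed
  from exists_S_neg[OF N[OF G(3)] _ _ this \<epsilon>'(1) curve_tau(5)[OF y0 y(3) F4]]
  obtain h0 where h0: "0 < h0" "h0 < \<epsilon>'" "S h0 ?\<mu> < 0" by auto
  define G0 where "G0 = {\<mu> \<in> G. S h0 \<mu> < 0}"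
  have G0: "open G0" "G0 \<subseteq> G" "?\<mu> \<in> G0"
    using S_open(1)[OF G(1,2) h0(1)] h0 \<epsilon>'(2) G(3) unfolding G0_def by auto
  have cont: "isCont (\<lambda>y. (sqrt y, b_curve y, c_curve y, - 1/2 :: real)) y"
    unfolding c_curve_def b_curve_def using y0 by (intro continuous_intros) auto
  have "\<exists>z>y. z < 2/25 \<and> (sqrt z, b_curve z, c_curve z, - 1/2) \<in> G0"
    by (rule isCont_open_right[OF G0(1) cont]) (rule G0(3) y(2))+
  then obtain z where z: "y < z" "z < 2/25" and zG: "(sqrt z, b_curve z, c_curve z, - 1/2) \<in> G0"
    by blast
  have z0: "0 < z" using y0 z(1) by simp
  have F3: "F3 z (- 1/2) < 0" using y(4) z by simp
  let ?a = "sqrt z" and ?b = "b_curve z" and ?c = "c_curve z"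
  have "\<forall>i. 1 \<le> i \<and> i < 3 \<longrightarrow> tau i ?a ?b ?c (- 1/2) = 0"
  proof (intro allI impI)
    fix i :: nat assume "1 \<le> i \<and> i < 3"
    then have "i = 1 \<or> i = 2" by linarith
    then show "tau i ?a ?b ?c (- 1/2) = 0"
      by (elim disjE; simp only: curve_tau(1,2)[OF z0])
  qed
  from exists_S_pos[OF N[OF subsetD[OF G0(2) zG]] _ _ this h0(1) curve_tau(3)[OF z0 F3]]
  obtain h1 where h1: "0 < h1" "h1 < h0" "0 < S h1 (?a, ?b, ?c, - 1/2)" by auto
  define G1 where "G1 = {\<mu> \<in> G0. 0 < S h1 \<mu>}"
  have G1: "open G1" "G1 \<subseteq> G" "(?a, ?b, ?c, - 1/2) \<in> G1"
    using S_open(2)[OF G0(1) order_trans[OF G0(2) G(2)] h1(1)] h1 h0(2) \<epsilon>'(2) zG G0(2) unfolding G1_def by auto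
  have cont: "isCont (\<lambda>c. (?a, ?b, c, - 1/2 :: real)) ?c" by (intro continuous_intros)
  have "\<exists>c>?c. c < ?c + 1 \<and> (?a, ?b, c, - 1/2) \<in> G1"
    by (rule isCont_open_right[OF G1(1) cont]) (rule G1(3) less_add_one)+
  then obtain c where c: "?c < c" and cG: "(?a, ?b, c, - 1/2) \<in> G1"
    by blast
  have "\<forall>i. 1 \<le> i \<and> i < 2 \<longrightarrow> tau i ?a ?b c (- 1/2) = 0"
  proof (intro allI impI)
    fix i :: nat assume "1 \<le> i \<and> i < 2"
    then have "i = 1" by linarith
    then show "tau i ?a ?b c (- 1/2) = 0"
      by (simp only: curve_tau(1)[OF z0])
  qed
  from exists_S_neg[OF N[OF subsetD[OF G1(2) cG]] _ _ this h1(1) tau_2_pos_c[OF z0 c]]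
  obtain h2 where h2: "0 < h2" "h2 < h1" "S h2 (?a, ?b, c, - 1/2) < 0" by auto
  define G2 where "G2 = {\<mu> \<in> G1. S h2 \<mu> < 0}"
  have G2: "open G2" "G2 \<subseteq> G" "(?a, ?b - 0, c, - 1/2) \<in> G2"
    using S_open(1)[OF G1(1) order_trans[OF G1(2) G(2)] h2(1)] h2 h1(2) h0(2) \<epsilon>'(2) cG G1(2) unfolding G2_def by auto
  \<comment> \<open>\<open>tau 1\<close> becomes negative when b decreases, so the path is traversed
    as b - s with s increasing from 0.\<close>
  have cont: "isCont (\<lambda>s. (?a, ?b - s, c, - 1/2 :: real)) 0" by (intro continuous_intros)
  have "\<exists>s>0. s < 1 \<and> (?a, ?b - s, c, - 1/2) \<in> G2"
    by (rule isCont_open_right[OF G2(1) cont]) (rule G2(3) zero_less_one)+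
  then obtain s where s: "0 < s" and sG: "(?a, ?b - s, c, - 1/2) \<in> G2"
    by blast
  let ?\<nu> = "(?a, ?b - s, c, - 1/2)"
  have "?b - s < ?b" using s by simp
  from exists_S_pos[OF N[OF subsetD[OF G2(2) sG]] _ _ _ h2(1) tau_1_neg_b[OF z0 this]]
  obtain h3 where h3: "0 < h3" "h3 < h2" "0 < S h3 ?\<nu>" by auto
  have \<nu>: "?\<nu> \<in> G" "S h0 ?\<nu> < 0" "0 < S h1 ?\<nu>" "S h2 ?\<nu> < 0"
    using sG unfolding G0_def G1_def G2_def by blast+
  obtain x1 where x1: "h3 < x1" "x1 < h2" "S x1 ?\<nu> = 0"
    by (rule S_zero_between[OF N[OF \<nu>(1)] h3(1,2)])
      (use h3 \<nu> h2(2) h1(2) h0(2) \<epsilon>'(2) in \<open>auto simp: mult_less_0_iff\<close>)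
  obtain x2 where x2: "h2 < x2" "x2 < h1" "S x2 ?\<nu> = 0"
    by (rule S_zero_between[OF N[OF \<nu>(1)] h2(1,2)])
      (use \<nu> h1(2) h0(2) \<epsilon>'(2) in \<open>auto simp: mult_less_0_iff\<close>)
  obtain x3 where x3: "h1 < x3" "x3 < h0" "S x3 ?\<nu> = 0"
    by (rule S_zero_between[OF N[OF \<nu>(1)] h1(1,2)])
      (use \<nu> h0(2) \<epsilon>'(2) in \<open>auto simp: mult_less_0_iff\<close>)
  show ?thesis
    by (rule that[OF \<nu>(1) _ _ _ _ x1(3) x2(3) x3(3)]) (use x1 x2 x3 h3 h0 in auto)
qed

end

text \<open>Exactly three solutions are required: \<open>three_zeros\<close> supplies three inside
  any small neighbourhood, and \<open>S_zeros_card\<close>, on a neighbourhood and an interval fixed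
  beforehand, excludes a fourth.\<close>

lemma bifurcate_3: "\<exists>p\<in>Lambda1. critical_periods_bifurcate p 3"
proof -
  obtain y where y: "7/100 \<le> y" "y < 2/25" "F3 y (- 1/2) = 0"
    "\<forall>z\<in>{y<..<2/25}. F3 z (- 1/2) < 0"
    by (rule F3_last_root) blast
  let ?\<mu> = "(sqrt y, b_curve y, c_curve y, - 1/2)"
  define p where "p = param_of ?\<mu>"
  have p: "p \<in> Lambda1" "coeffs_of p = ?\<mu>"
    unfolding p_def by (rule param_of_mem, rule coeffs_of_param_of)
  obtain N \<delta> \<epsilon> q U where br: "branches N \<delta> \<epsilon> q U" and N: "?\<mu> \<in> N"
    by (rule branches_exist)
  interpret branches N \<delta> \<epsilon> q U by (rule br)
  obtain e M where e: "0 < e" "e \<le> h_max" and M: "open M" "?\<mu> \<in> M" "M \<subseteq> N"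
    and card: "\<And>\<mu>. \<mu> \<in> M \<Longrightarrow> finite {h \<in> {0<..<e}. S h \<mu> = 0} \<and> card {h \<in> {0<..<e}. S h \<mu> = 0} \<le> 3"
    by (rule S_zeros_card[OF N]) blast
  have "\<exists>p1\<in>W. finite {h \<in> {0<..<\<epsilon>'}. critical_at p1 h} \<and> card {h \<in> {0<..<\<epsilon>'}. critical_at p1 h} = 3"
    if \<epsilon>': "0 < \<epsilon>'" "\<epsilon>' < e" and W: "nbhd_in_Lambda1 p W" "W \<subseteq> Lambda1 \<inter> coeffs_of -` M" for \<epsilon>' W
  proof -
    let ?G = "param_of -` W"
    have GM: "?G \<subseteq> M"
    proof
      fix \<mu> assume "\<mu> \<in> ?G"
      then have "param_of \<mu> \<in> Lambda1 \<inter> coeffs_of -` M" using W(2) by blast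
      then show "\<mu> \<in> M" by (simp add: coeffs_of_param_of del: param_of.simps)
    qed
    have "\<epsilon>' \<le> h_max" using \<epsilon>'(2) e(2) by linarith
    moreover have "?\<mu> \<in> ?G" using W(1) by (simp add: nbhd_in_Lambda1_def p_def)
    ultimately obtain \<mu> x1 x2 x3 where \<mu>: "\<mu> \<in> ?G" and x: "0 < x1" "x1 < x2" "x2 < x3" "x3 < \<epsilon>'"
      "S x1 \<mu> = 0" "S x2 \<mu> = 0" "S x3 \<mu> = 0"
      using three_zeros[OF y open_param_of_vimage[OF W(1)] order_trans[OF GM M(3)] _ \<epsilon>'(1)] by blast
    let ?A = "{h \<in> {0<..<\<epsilon>'}. critical_at (param_of \<mu>) h}"
    have "\<mu> \<in> M" using GM \<mu> by blast
    have A: "?A = {h \<in> {0<..<\<epsilon>'}. S h \<mu> = 0}"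
      using critical_at_iff[of _ \<mu>] \<open>\<mu> \<in> M\<close> M(3) \<epsilon>'(2) e(2) by auto
    have sub: "?A \<subseteq> {h \<in> {0<..<e}. S h \<mu> = 0}" unfolding A using \<epsilon>'(2) by auto
    have fin: "finite ?A" using finite_subset[OF sub] card[OF \<open>\<mu> \<in> M\<close>] by blast
    have "card ?A \<le> 3" using card_mono[OF _ sub] card[OF \<open>\<mu> \<in> M\<close>] by linarith
    moreover have "{x1, x2, x3} \<subseteq> ?A" unfolding A using x by auto
    then have "card {x1, x2, x3} \<le> card ?A" by (rule card_mono[OF fin])
    moreover have "card {x1, x2, x3} = 3" using x(1-3) by simp
    ultimately have "card ?A = 3" by linarith
    with fin show ?thesis using \<mu> by blast
  qed
  moreover have "nbhd_in_Lambda1 p (Lambda1 \<inter> coeffs_of -` M)"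
    by (rule nbhd_in_Lambda1_coeffs_of[OF p(1) M(1)]) (simp only: p(2) M(2))
  ultimately have "critical_periods_bifurcate p 3"
    unfolding critical_periods_bifurcate_def using e(1) by (intro exI[of _ e] conjI allI impI) blast+
  then show ?thesis using p(1) by blast
qed

theorem theorem3p2:
  shows "(\<forall>p\<in>Lambda1. \<forall>k. critical_periods_bifurcate p k \<longrightarrow> k \<le> 3) \<and>
         (\<exists>p\<in>Lambda1. critical_periods_bifurcate p 3)"
  using bifurcate_le_3 bifurcate_3 by blast

end
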